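(* Assume that $X$ is unbounded and that $1<p<Q_u$. Suppose that $\Omega_0\subset X$ is an open set such that $X\setminus\Omega_0$ is uniformly $p$-fat. Suppose also that $F\subset\overline{\Omega}_0$ is a nonempty closed set with $\operatorname{co-dim}_A(F)>p$, and that $X\setminus F$ satisfies the discrete John condition for a Whitney cover $\mathcal{W}_{c'}(X\setminus F)$ with some $0<c'\le(6\lambda)^{-1}$, where $\lambda$ is the dilatation constant of the $(1,p)$-Poincaré inequality. Let $\Omega=\Omega_0\setminus F$. Then there is $c_0\in(0,1/2]$ such that for every $0<c\le c_0$ and every Whitney cover $\mathcal{W}_c(\Omega)$, the capacity $\operatorname{cap}_p(\cdot,\Omega)$ is quasiadditive with respect to $\mathcal{W}_c(\Omega)$.
   Context: Space: $X=(X,d,\mu)$ is a complete metric measure space, where $\mu$ is a Borel measure supported on $X$ with $0<\mu(B)<\infty$ for every open ball $B$, and $\mu$ is doubling: there is $C>0$ with $\mu(B(x,2r))\le C\mu(B(x,r))$ for all $x\in X$, $r>0$. Each ball $B$ has a fixed center $x_B$ and radius $\operatorname{rad}(B)$, and $tB=B(x_B,t\operatorname{rad}(B))$ for $t>0$. $Q_u>0$ denotes a fixed exponent for which there is $C>0$ such that $\frac{\mu(B(y,r))}{\mu(B(x,R))}\le C\big(\frac rR\big)^{Q_u}$ for all $0<r<R<\operatorname{diam}X$ and $y\in B(x,R)$ (such an exponent exists since $X$ is connected and $\mu$ is doubling). Upper gradients and Newtonian spaces: a Borel function $g\ge 0$ is an upper gradient of a measurable $f:X\to[-\infty,\infty]$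 if $|f(y)-f(x)|\le\int_\gamma g\,ds$ for every compact rectifiable curve $\gamma$ with endpoints $x,y$ (with $\int_\gamma g\,ds=\infty$ required if $|f(x)|$ or $|f(y)|$ is infinite). $N^{1,p}(X)$ is the space of functions with $\|f\|_{N^{1,p}(X)}=(\int_X|f|^p\,d\mu+\inf_g\int_Xg^p\,d\mu)^{1/p}<\infty$, the infimum being over upper gradients $g$ of $f$, modulo $u\sim v$ iff $\|u-v\|_{N^{1,p}(X)}=0$. Poincaré inequality: $X$ supports a $(1,p)$-Poincaré inequality, i.e. there are $C>0$, $\lambda\ge1$ such that $\frac1{\mu(B)}\int_B|f-f_B|\,d\mu\le Cr\big(\frac1{\mu(\lambda B)}\int_{\lambda B}g^p\,d\mu\big)^{1/p}$ for every ball $B=B(x,r)$, every measurable $f$ and every upper gradient $g$ of $f$, with $f_B=\frac1{\mu(B)}\int_Bf\,d\mu$. Relative capacity: for an open set $\Omega$ and measurable $E\subset\Omega$, $\operatorname{cap}_p(E,\Omega)=\inf_u\inf_{g_u}\int_Xg_u^p\,d\mu$ over all $u\in N^{1,p}(X)$ with $u=0$ on $X\setminus\Omega$, $u=1$ on $E$, $0\le u\le1$, and all upper gradients $g_u$ of $u$; it is $\infty$ if no such $u$ exists. Sets $E\subset\Omega$ are understood to be measurable, as in this definition. Uniform fatness: a closed set $E\subset X$ is uniformly $p$-fat if there is $C>0$ such that $\operatorname{cap}_p(E\cap B,2B)\ge C\operatorname{cap}_p(B,2B)$ for all balls $B$ centered at $E$. Aikawa codimension: for $E\subset X$, $\operatorname{co-dim}_A(E)$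 is the supremum of all $q\ge0$ for which there is a constant $C_q$ with $\int_{B(x,r)}\operatorname{dist}(y,E)^{-q}\,d\mu(y)\le C_qr^{-q}\mu(B(x,r))$ for every $x\in E$ and all $0<r<\operatorname{diam}(E)$, where the integral is interpreted as $+\infty$ if $q>0$ and $E$ has positive measure. Whitney covers: for an open set $\Omega\neq X$, $d_\Omega(x)=\operatorname{dist}(x,X\setminus\Omega)$. For $0<c\le1/2$, a Whitney cover $\mathcal{W}_c(\Omega)=\{B_i\}_{i\in\mathbb{N}}$ is a countable cover of $\Omega$ by balls $B_i=B(x_i,c\,d_\Omega(x_i))$, $x_i\in\Omega$, with uniformly bounded overlap $\sum_i\chi_{B_i}\le C<\infty$ (some $B_i$ may be empty). Discrete John condition: an open set $\Omega$ and a Whitney cover $\mathcal{W}=\mathcal{W}_c(\Omega)$ satisfy it if there exist $L>1$, $a>1$, $C>0$ such that for each $B\in\mathcal{W}$ there is a chain $\{B_m\}_{m=0}^\infty$ of balls $B_m\in\mathcal{W}$ with $B_0=B$ and, for each $m$, $B_m\cap B_{m+1}\ne\emptyset$, $B\subset LB_m$, and $\operatorname{rad}(B_m)\ge Ca^m\operatorname{rad}(B)$. Quasiadditivity: $\operatorname{cap}_p(\cdot,\Omega)$ is quasiadditive with respect to a cover $\mathcal{W}$ of $\Omega$ if there is $A>0$ such that $\sum_{Q\in\mathcal{W}}\operatorname{cap}_p(E\cap Q,\Omega)\le A\operatorname{cap}_p(E,\Omega)$ for every $E\subset\Omega$. *)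

theory Defs
  imports "HOL-Analysis.Analysis"
begin

text \<open>
  The space is the whole carrier type, and balls are given by a centre and a radius.
  The measure \<open>M\<close> lives on the Borel sets. ``Measurable'' (as opposed to ``Borel'') refers to
  \<open>\<mu>\<close>-measurability, that is, to the completion of \<open>M\<close>.
\<close>

definition metric_measure :: "'a::metric_space measure \<Rightarrow> bool" where
  "metric_measure M \<longleftrightarrow> sets M = sets borel \<and>
     (\<forall>x r. 0 < r \<longrightarrow> 0 < emeasure M (ball x r) \<and> emeasure M (ball x r) < \<infinity>)"

definition doubling :: "'a::metric_space measure \<Rightarrow> bool" where
  "doubling M \<longleftrightarrow> (\<exists>C>0. \<forall>x r. 0 < r \<longrightarrow>
     measure M (ball x (2 * r)) \<le> C * measure M (ball x r))"

text \<open>The library's \<open>diameter\<close> is \<open>0\<close> on unbounded sets, hence an extended version.\<close>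

definition ediam :: "'a::metric_space set \<Rightarrow> ennreal" where
  "ediam S = (SUP x\<in>S. SUP y\<in>S. ennreal (dist x y))"

definition volume_exponent :: "'a::metric_space measure \<Rightarrow> real \<Rightarrow> bool" where
  "volume_exponent M Q \<longleftrightarrow> 0 < Q \<and> (\<exists>C>0. \<forall>x y r R.
     0 < r \<and> r < R \<and> ennreal R < ediam (UNIV :: 'a set) \<and> y \<in> ball x R \<longrightarrow>
     measure M (ball y r) / measure M (ball x R) \<le> C * (r / R) powr Q)"

text \<open>Real powers on \<open>[0,\<infinity>]\<close>, used only for positive exponents.\<close>

definition epow :: "ennreal \<Rightarrow> real \<Rightarrow> ennreal" where
  "epow x p = (if x = \<infinity> then \<infinity> else ennreal (enn2real x powr p))"


subsection \<open>Curves and upper gradients\<close>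

definition curve_length :: "(real \<Rightarrow> 'a::metric_space) \<Rightarrow> real \<Rightarrow> real \<Rightarrow> ennreal" where
  "curve_length \<gamma> a b =
     (SUP (n, t) \<in> {(n :: nat, t :: nat \<Rightarrow> real). mono_on {..n} t \<and> t ` {..n} \<subseteq> {a..b}}.
        \<Sum>i<n. ennreal (dist (\<gamma> (t i)) (\<gamma> (t (Suc i)))))"

definition rectifiable :: "(real \<Rightarrow> 'a::metric_space) \<Rightarrow> bool" where
  "rectifiable \<gamma> \<longleftrightarrow> path \<gamma> \<and> curve_length \<gamma> 0 1 < \<infinity>"

text \<open>
  For a rectifiable \<open>\<gamma>\<close> the set below is compact and nonempty whenever \<open>0 \<le> s \<le> curve_length \<gamma> 0 1\<close>,
  and \<open>\<gamma>\<close> is constant on it.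
\<close>

definition arc_length_param :: "(real \<Rightarrow> 'a::metric_space) \<Rightarrow> real \<Rightarrow> 'a" where
  "arc_length_param \<gamma> s = \<gamma> (Inf {t \<in> {0..1}. curve_length \<gamma> 0 t = ennreal s})"

definition line_integral :: "(real \<Rightarrow> 'a::metric_space) \<Rightarrow> ('a \<Rightarrow> ennreal) \<Rightarrow> ennreal" where
  "line_integral \<gamma> g =
     (\<integral>\<^sup>+ s \<in> {0..enn2real (curve_length \<gamma> 0 1)}. g (arc_length_param \<gamma> s) \<partial>lborel)"

text \<open>
  As usual, curves are nonconstant. A constant curve would impose no condition at points where
  \<open>f\<close> is finite, and would only forbid infinite values of \<open>f\<close>.
\<close>

definition upper_gradient ::
  "'a::metric_space measure \<Rightarrow> ('a \<Rightarrow> ennreal) \<Rightarrow> ('a \<Rightarrow> ereal) \<Rightarrow> bool" where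
  "upper_gradient M g f \<longleftrightarrow>
     f \<in> borel_measurable (completion M) \<and> g \<in> borel_measurable borel \<and>
     (\<forall>\<gamma>. rectifiable \<gamma> \<and> \<not> \<gamma> constant_on {0..1} \<longrightarrow>
       (let x = pathstart \<gamma>; y = pathfinish \<gamma> in
         if \<bar>f x\<bar> = \<infinity> \<or> \<bar>f y\<bar> = \<infinity> then line_integral \<gamma> g = \<infinity>
         else e2ennreal \<bar>f y - f x\<bar> \<le> line_integral \<gamma> g))"

definition newton_norm :: "'a::metric_space measure \<Rightarrow> real \<Rightarrow> ('a \<Rightarrow> ereal) \<Rightarrow> ennreal" where
  "newton_norm M p f =
     epow ((\<integral>\<^sup>+ x. epow (e2ennreal \<bar>f x\<bar>) p \<partial>completion M) +
           (INF g \<in> {g. upper_gradient M g f}. \<integral>\<^sup>+ x. epow (g x) p \<partial>M)) (1 / p)"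

text \<open>
  The functions representing elements of \<open>N\<^sup>1\<^sup>,\<^sup>p(X)\<close>. No quotient is formed: the capacity
  below prescribes pointwise values, so it ranges over representatives.
\<close>

definition newton_space :: "'a::metric_space measure \<Rightarrow> real \<Rightarrow> ('a \<Rightarrow> ereal) set" where
  "newton_space M p = {f \<in> borel_measurable (completion M). newton_norm M p f < \<infinity>}"


subsection \<open>Poincare inequality\<close>

text \<open>
  If \<open>f\<close> is not integrable on the ball, then \<open>ball_average\<close> is some real number and the mean
  oscillation on the left-hand side below is \<open>\<infinity>\<close>, which is the usual convention.
\<close>

definition ball_average :: "'a::metric_space measure \<Rightarrow> ('a \<Rightarrow> ereal) \<Rightarrow> 'a set \<Rightarrow> real" where
  "ball_average M f B = (LINT y:B|completion M. real_of_ereal (f y)) / measure M B"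

definition poincare_inequality :: "'a::metric_space measure \<Rightarrow> real \<Rightarrow> real \<Rightarrow> bool" where
  "poincare_inequality M p lam \<longleftrightarrow> 1 \<le> lam \<and> (\<exists>C>0. \<forall>x r f g. 0 < r \<and> upper_gradient M g f \<longrightarrow>
     (\<integral>\<^sup>+ y \<in> ball x r. e2ennreal \<bar>f y - ereal (ball_average M f (ball x r))\<bar> \<partial>completion M)
        / emeasure M (ball x r)
     \<le> ennreal (C * r) *
       epow ((\<integral>\<^sup>+ y \<in> ball x (lam * r). epow (g y) p \<partial>M) / emeasure M (ball x (lam * r))) (1 / p))"


subsection \<open>Capacity, fatness, codimension\<close>

definition cap :: "'a::metric_space measure \<Rightarrow> real \<Rightarrow> 'a set \<Rightarrow> 'a set \<Rightarrow> ennreal" where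
  "cap M p E \<Omega> = Inf {(\<integral>\<^sup>+ x. epow (g x) p \<partial>M) | u g.
     u \<in> newton_space M p \<and> (\<forall>x. x \<notin> \<Omega> \<longrightarrow> u x = 0) \<and> (\<forall>x\<in>E. u x = 1) \<and>
     (\<forall>x. 0 \<le> u x \<and> u x \<le> 1) \<and> upper_gradient M g u}"

definition uniformly_fat :: "'a::metric_space measure \<Rightarrow> real \<Rightarrow> 'a set \<Rightarrow> bool" where
  "uniformly_fat M p E \<longleftrightarrow> closed E \<and> (\<exists>C>0. \<forall>x\<in>E. \<forall>r>0.
     cap M p (E \<inter> ball x r) (ball x (2 * r)) \<ge> ennreal C * cap M p (ball x r) (ball x (2 * r)))"

text \<open>\<open>dist(y,E)\<^sup>-\<^sup>q\<close> for \<open>q \<ge> 0\<close>, where \<open>0\<^sup>-\<^sup>q = \<infinity>\<close> if \<open>q > 0\<close>; note \<open>0 powr (-q) = 0\<close> in HOL.\<close>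

definition dist_neg_pow :: "'a::metric_space set \<Rightarrow> real \<Rightarrow> 'a \<Rightarrow> ennreal" where
  "dist_neg_pow E q y =
     (if q = 0 then 1 else if infdist y E = 0 then \<infinity> else ennreal (infdist y E powr (- q)))"

definition aikawa_integral ::
  "'a::metric_space measure \<Rightarrow> 'a set \<Rightarrow> real \<Rightarrow> 'a \<Rightarrow> real \<Rightarrow> ennreal" where
  "aikawa_integral M E q x r =
     (if 0 < q \<and> E \<notin> null_sets (completion M) then \<infinity>
      else \<integral>\<^sup>+ y \<in> ball x r. dist_neg_pow E q y \<partial>M)"

definition codim_A :: "'a::metric_space measure \<Rightarrow> 'a set \<Rightarrow> ereal" where
  "codim_A M E = (SUP q \<in> {q. 0 \<le> q \<and> (\<exists>C. \<forall>x\<in>E. \<forall>r. 0 < r \<and> ennreal r < ediam E \<longrightarrow>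
       aikawa_integral M E q x r \<le> ennreal (C * r powr (- q) * measure M (ball x r)))}. ereal q)"


subsection \<open>Whitney covers, John condition, quasiadditivity\<close>

definition whitney_radius :: "real \<Rightarrow> 'a::metric_space set \<Rightarrow> (nat \<Rightarrow> 'a) \<Rightarrow> nat \<Rightarrow> real" where
  "whitney_radius c \<Omega> z i = c * infdist (z i) (- \<Omega>)"

definition whitney_ball :: "real \<Rightarrow> 'a::metric_space set \<Rightarrow> (nat \<Rightarrow> 'a) \<Rightarrow> nat \<Rightarrow> 'a set" where
  "whitney_ball c \<Omega> z i = ball (z i) (whitney_radius c \<Omega> z i)"

text \<open>
  A cover \<open>{B\<^sub>i}\<close> indexed by \<open>\<nat>\<close>, where some \<open>B\<^sub>i\<close> may be empty, is given by the set \<open>I\<close> of indices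
  of its genuine balls and their centres \<open>z i\<close>.
\<close>

definition whitney_cover ::
  "real \<Rightarrow> 'a::metric_space set \<Rightarrow> nat set \<Rightarrow> (nat \<Rightarrow> 'a) \<Rightarrow> bool" where
  "whitney_cover c \<Omega> I z \<longleftrightarrow> open \<Omega> \<and> \<Omega> \<noteq> UNIV \<and> 0 < c \<and> c \<le> 1 / 2 \<and>
     z ` I \<subseteq> \<Omega> \<and> \<Omega> \<subseteq> (\<Union>i\<in>I. whitney_ball c \<Omega> z i) \<and>
     (\<exists>N :: nat. \<forall>x. finite {i \<in> I. x \<in> whitney_ball c \<Omega> z i} \<and>
        card {i \<in> I. x \<in> whitney_ball c \<Omega> z i} \<le> N)"

definition discrete_john ::
  "real \<Rightarrow> 'a::metric_space set \<Rightarrow> nat set \<Rightarrow> (nat \<Rightarrow> 'a) \<Rightarrow> bool" where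
  "discrete_john c \<Omega> I z \<longleftrightarrow> (\<exists>L>1. \<exists>a>1. \<exists>C>0. \<forall>i\<in>I. \<exists>k :: nat \<Rightarrow> nat.
     k 0 = i \<and> (\<forall>m. k m \<in> I \<and>
       whitney_ball c \<Omega> z (k m) \<inter> whitney_ball c \<Omega> z (k (Suc m)) \<noteq> {} \<and>
       whitney_ball c \<Omega> z i \<subseteq> ball (z (k m)) (L * whitney_radius c \<Omega> z (k m)) \<and>
       whitney_radius c \<Omega> z (k m) \<ge> C * a ^ m * whitney_radius c \<Omega> z i))"

definition quasiadditive ::
  "'a::metric_space measure \<Rightarrow> real \<Rightarrow> 'a set \<Rightarrow> nat set \<Rightarrow> (nat \<Rightarrow> 'a set) \<Rightarrow> bool" where
  "quasiadditive M p \<Omega> I Q \<longleftrightarrow> (\<exists>A>0. \<forall>E. E \<subseteq> \<Omega> \<and> E \<in> sets (completion M) \<longrightarrow>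
     (\<Sum>\<^sub>\<infinity>i\<in>I. cap M p (E \<inter> Q i) \<Omega>) \<le> ennreal A * cap M p E \<Omega>)"

end

theory Submission
  imports Defs
begin

text \<open>
  Quasiadditivity follows from the Hardy inequality
  \<open>\<integral> (u / d)\<^sup>p \<le> C \<integral> g\<^sup>p\<close> on \<open>\<Omega> = \<Omega>0 - F\<close>, where \<open>d\<close> is the distance to the complement, \<open>u\<close> is a test
  function for the capacity and \<open>g\<close> an upper gradient of \<open>u\<close>: multiply \<open>u\<close> by cutoff functions of the
  Whitney balls, whose gradients are of order \<open>1 / d\<close>, and use that the enlarged balls have bounded
  overlap (\<open>quasiadditive_of_hardy\<close>). As \<open>d\<close> is the smaller of the distances to the complement of
  \<open>\<Omega>0\<close> and to \<open>F\<close>, the Hardy inequality splits into two, one for each distance (\<open>hardy_union\<close>).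

  For the distance to the fat set \<open>Z\<close>, the complement of \<open>\<Omega>0\<close>, fatness gives Maz'ya's inequality
  \<open>\<integral> u\<^sup>p \<le> C r\<^sup>p \<integral> g\<^sup>p\<close> on balls of radius \<open>r\<close> centred in \<open>Z\<close>, hence the same estimate on the layers of
  points closer to \<open>Z\<close> than \<open>r\<close> (\<open>mazya_inequality\<close>, \<open>layer_estimate\<close>). Summing over dyadic
  \<open>r\<close> loses a logarithm. Wannebo's argument avoids this: with an extra weight \<open>d\<^sup>-\<^sup>\<beta>\<close> the sum
  converges with a constant of order \<open>1 / \<beta>\<close>; the inequality is applied to \<open>u d\<^sup>\<beta>\<^sup>/\<^sup>p\<close>, which removes
  the weight at the cost of an error of relative size \<open>\<beta>\<^sup>p\<^sup>-\<^sup>1\<close>, and this is absorbed since \<open>p > 1\<close>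
  (\<open>fat_hardy_truncated\<close>, \<open>fat_hardy\<close>).

  For the distance to the thin set \<open>F\<close>, the smallness of \<open>u\<close> comes from infinity:
  along a John chain the balls grow, so the means of \<open>u \<in> L\<^sup>p\<close> tend to \<open>0\<close>, and the mean over a
  Whitney ball is the sum of the increments along its chain. Summing over all Whitney balls
  and reversing the order of summation, one has to bound the sum of \<open>d\<^sup>-\<^sup>q \<mu>(B)\<close>, for
  some \<open>q > p\<close>, over the balls \<open>B\<close> whose chains meet a given ball. This is an integral of \<open>d\<^sup>-\<^sup>q\<close>
  near \<open>F\<close>, which the codimension of \<open>F\<close> bounds (\<open>shadow_sum_le\<close>, \<open>average_sum_le\<close>, \<open>thin_hardy\<close>). For bounded
  \<open>F\<close>, radii beyond the diameter of \<open>F\<close> are handled by the volume exponent \<open>Q > p\<close>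
  (\<open>codim_all_radii\<close>).

  The tools are a product rule for upper gradients along curves
  (\<open>curve_gradient_cutoff\<close>), and the Poincare inequality with exponent \<open>p\<close> on the left-hand
  side (\<open>poincare_strong\<close>).
\<close>

section \<open>Arc length\<close>

lemma curve_length_upper:
  assumes "mono_on {..n} t" "t ` {..n} \<subseteq> {a..b}"
  shows "(\<Sum>i<n. ennreal (dist (\<gamma> (t i)) (\<gamma> (t (Suc i))))) \<le> curve_length \<gamma> a b"
  unfolding curve_length_def using assms
  by (intro SUP_upper2[of "(n, t)"]) auto

lemma curve_length_least:
  assumes "\<And>n t. mono_on {..n} t \<Longrightarrow> t ` {..n} \<subseteq> {a..b} \<Longrightarrow>
    (\<Sum>i<n. ennreal (dist (\<gamma> (t i)) (\<gamma> (t (Suc i))))) \<le> X"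
  shows "curve_length \<gamma> a b \<le> X"
  unfolding curve_length_def using assms by (intro SUP_least) auto

lemma curve_length_add_least:
  assumes "a \<le> b"
    and le: "\<And>n t. mono_on {..n} t \<Longrightarrow> t ` {..n} \<subseteq> {a..b} \<Longrightarrow>
    (\<Sum>i<n. ennreal (dist (\<gamma> (t i)) (\<gamma> (t (Suc i))))) + Y \<le> X"
  shows "curve_length \<gamma> a b + Y \<le> X"
proof (cases "X = \<infinity>")
  case False
  have "Y \<le> X" using le[of 0 "\<lambda>_. a"] assms(1) by (auto simp: mono_on_def)
  then have "Y \<noteq> \<infinity>" using False by (auto simp: top_unique)
  have "curve_length \<gamma> a b \<le> X - Y"
  proof (rule curve_length_least)
    fix n :: nat and t assume "mono_on {..n} t" "t ` {..n} \<subseteq> {a..b}"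
    from le[OF this] show "(\<Sum>i<n. ennreal (dist (\<gamma> (t i)) (\<gamma> (t (Suc i))))) \<le> X - Y"
      using \<open>Y \<noteq> \<infinity>\<close> by (simp add: ennreal_le_minus_iff add.commute less_top)
  qed
  then have "curve_length \<gamma> a b + Y \<le> X - Y + Y" by (rule add_right_mono)
  also have "\<dots> = X" using \<open>Y \<le> X\<close> \<open>Y \<noteq> \<infinity>\<close> by (simp add: diff_add_cancel_ennreal)
  finally show ?thesis .
qed simp

lemma sum_lessThan_add:
  fixes f :: "nat \<Rightarrow> 'b::comm_monoid_add"
  shows "(\<Sum>i<k + m. f i) = (\<Sum>i<k. f i) + (\<Sum>i<m. f (k + i))"
  by (induction m) (auto simp: add.assoc)

lemma dist_le_curve_length:
  assumes "a \<le> b"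
  shows "ennreal (dist (\<gamma> a) (\<gamma> b)) \<le> curve_length \<gamma> a b"
proof -
  have "mono_on {..1} (\<lambda>i::nat. if i = 0 then a else b)"
    using assms by (auto simp: mono_on_def)
  moreover have "(\<lambda>i::nat. if i = 0 then a else b) ` {..1} \<subseteq> {a..b}"
    using assms by auto
  ultimately show ?thesis using curve_length_upper[of 1 "\<lambda>i::nat. if i = 0 then a else b" a b \<gamma>]
    by simp
qed

text \<open>
  Cutting off a partition at \<open>c\<close>, from above and from below, splits it there
  into two partitions with the same indices.
\<close>

lemma dist_split_le:
  fixes \<gamma> :: "real \<Rightarrow> 'a::metric_space"
  assumes "s \<le> t"
  shows "dist (\<gamma> s) (\<gamma> t) \<le> dist (\<gamma> (min s c)) (\<gamma> (min t c)) + dist (\<gamma> (max s c)) (\<gamma> (max t c))"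
proof -
  consider "t \<le> c" | "c \<le> s" | "s < c" "c < t" by linarith
  then show ?thesis
  proof cases
    case 3
    then show ?thesis using dist_triangle[of "\<gamma> s" "\<gamma> t" "\<gamma> c"] by (simp add: min_def max_def)
  qed (use assms in \<open>auto simp: min_def max_def\<close>)
qed

lemma partition_sum_split_le:
  fixes \<gamma> :: "real \<Rightarrow> 'a::metric_space"
  assumes "mono_on {..n} t"
  shows "(\<Sum>i<n. ennreal (dist (\<gamma> (t i)) (\<gamma> (t (Suc i)))))
    \<le> (\<Sum>i<n. ennreal (dist (\<gamma> (min (t i) c)) (\<gamma> (min (t (Suc i)) c))))
      + (\<Sum>i<n. ennreal (dist (\<gamma> (max (t i) c)) (\<gamma> (max (t (Suc i)) c))))"
  unfolding sum.distrib[symmetric]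
proof (rule sum_mono)
  fix i assume "i \<in> {..<n}"
  then have "t i \<le> t (Suc i)" using assms by (auto simp: mono_on_def)
  from dist_split_le[OF this, of \<gamma> c]
  show "ennreal (dist (\<gamma> (t i)) (\<gamma> (t (Suc i))))
    \<le> ennreal (dist (\<gamma> (min (t i) c)) (\<gamma> (min (t (Suc i)) c)))
      + ennreal (dist (\<gamma> (max (t i) c)) (\<gamma> (max (t (Suc i)) c)))"
    by (simp add: ennreal_plus[symmetric] del: ennreal_plus)
qed

lemma mono_on_min_max:
  fixes t :: "nat \<Rightarrow> real"
  assumes "mono_on {..n} t"
  shows "mono_on {..n} (\<lambda>i. min (t i) c)" "mono_on {..n} (\<lambda>i. max (t i) c)"
  using assms by (fastforce simp: mono_on_def min_def max_def)+

text \<open>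
  One inequality comes from cutting off a partition at \<open>c\<close>, the other from concatenating two
  partitions.
\<close>

lemma curve_length_add:
  fixes \<gamma> :: "real \<Rightarrow> 'a::metric_space"
  assumes "a \<le> c" "c \<le> b"
  shows "curve_length \<gamma> a b = curve_length \<gamma> a c + curve_length \<gamma> c b"
proof (rule antisym)
  show "curve_length \<gamma> a b \<le> curve_length \<gamma> a c + curve_length \<gamma> c b"
  proof (rule curve_length_least)
    fix n :: nat and t assume t: "mono_on {..n} t" "t ` {..n} \<subseteq> {a..b}"
    show "(\<Sum>i<n. ennreal (dist (\<gamma> (t i)) (\<gamma> (t (Suc i))))) \<le> curve_length \<gamma> a c + curve_length \<gamma> c b"
    proof (rule order_trans[OF partition_sum_split_le[OF t(1), of \<gamma> c]], rule add_mono)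
      show "(\<Sum>i<n. ennreal (dist (\<gamma> (min (t i) c)) (\<gamma> (min (t (Suc i)) c)))) \<le> curve_length \<gamma> a c"
        by (rule curve_length_upper[OF mono_on_min_max(1)[OF t(1)]])
          (use t(2) assms in \<open>auto simp: image_subset_iff\<close>)
      show "(\<Sum>i<n. ennreal (dist (\<gamma> (max (t i) c)) (\<gamma> (max (t (Suc i)) c)))) \<le> curve_length \<gamma> c b"
        by (rule curve_length_upper[OF mono_on_min_max(2)[OF t(1)]])
          (use t(2) assms in \<open>auto simp: image_subset_iff\<close>)
    qed
  qed
next
  have *: "(\<Sum>i<n. ennreal (dist (\<gamma> (t i)) (\<gamma> (t (Suc i)))))
     + (\<Sum>i<m. ennreal (dist (\<gamma> (s i)) (\<gamma> (s (Suc i))))) \<le> curve_length \<gamma> a b"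
    if t: "mono_on {..n} t" "t ` {..n} \<subseteq> {a..c}" and s: "mono_on {..m} s" "s ` {..m} \<subseteq> {c..b}"
    for n m :: nat and s t
  proof -
    define w where "w i = (if i \<le> n then t i else s (i - Suc n))" for i
    have w: "mono_on {..Suc n + m} w"
    proof (rule mono_onI)
      fix i j assume ij: "i \<in> {..Suc n + m}" "j \<in> {..Suc n + m}" "i \<le> j"
      consider "j \<le> n" | "i \<le> n" "n < j" | "n < i" using ij by linarith
      then show "w i \<le> w j"
      proof cases
        case 1 then show ?thesis using ij t(1) by (auto simp: w_def mono_on_def)
      next
        case 2
        then have "t i \<in> {a..c}" "s (j - Suc n) \<in> {c..b}"
          using ij t(2) s(2) by (auto simp: image_subset_iff)
        then show ?thesis using 2 by (auto simp: w_def)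
      next
        case 3
        then have "i - Suc n \<in> {..m}" "j - Suc n \<in> {..m}" "i - Suc n \<le> j - Suc n" using ij by auto
        from mono_onD[OF s(1) this] show ?thesis using 3 ij by (auto simp: w_def)
      qed
    qed
    have "w ` {..Suc n + m} \<subseteq> {a..b}"
    proof (rule image_subsetI)
      fix i assume i: "i \<in> {..Suc n + m}"
      show "w i \<in> {a..b}"
      proof (cases "i \<le> n")
        case True then have "t i \<in> {a..c}" using t(2) by (auto simp: image_subset_iff)
        then show ?thesis using True assms by (auto simp: w_def)
      next
        case False then have "s (i - Suc n) \<in> {c..b}" using s(2) i by (auto simp: image_subset_iff)
        then show ?thesis using False assms by (auto simp: w_def)
      qed
    qed
    from curve_length_upper[OF w this, of \<gamma>]
    have le: "(\<Sum>i<Suc n + m. ennreal (dist (\<gamma> (w i)) (\<gamma> (w (Suc i))))) \<le> curve_length \<gamma> a b" .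
    have "(\<Sum>i<Suc n + m. ennreal (dist (\<gamma> (w i)) (\<gamma> (w (Suc i)))))
      = (\<Sum>i<Suc n. ennreal (dist (\<gamma> (w i)) (\<gamma> (w (Suc i)))))
        + (\<Sum>i<m. ennreal (dist (\<gamma> (w (Suc n + i))) (\<gamma> (w (Suc (Suc n + i))))))"
      by (rule sum_lessThan_add)
    also have "\<dots> \<ge> (\<Sum>i<n. ennreal (dist (\<gamma> (t i)) (\<gamma> (t (Suc i)))))
        + (\<Sum>i<m. ennreal (dist (\<gamma> (s i)) (\<gamma> (s (Suc i)))))"
    proof (rule add_mono)
      have "(\<Sum>i<n. ennreal (dist (\<gamma> (t i)) (\<gamma> (t (Suc i))))) = (\<Sum>i<n. ennreal (dist (\<gamma> (w i)) (\<gamma> (w (Suc i)))))"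
        by (rule sum.cong) (auto simp: w_def)
      then show "(\<Sum>i<n. ennreal (dist (\<gamma> (t i)) (\<gamma> (t (Suc i))))) \<le> (\<Sum>i<Suc n. ennreal (dist (\<gamma> (w i)) (\<gamma> (w (Suc i)))))"
        by simp
      show "(\<Sum>i<m. ennreal (dist (\<gamma> (s i)) (\<gamma> (s (Suc i))))) \<le> (\<Sum>i<m. ennreal (dist (\<gamma> (w (Suc n + i))) (\<gamma> (w (Suc (Suc n + i))))))"
        by (rule eq_refl, rule sum.cong) (auto simp: w_def Suc_diff_le)
    qed
    finally show ?thesis using le by (meson order_trans)
  qed
  show "curve_length \<gamma> a c + curve_length \<gamma> c b \<le> curve_length \<gamma> a b"
  proof (rule curve_length_add_least[OF assms(1)])
    fix n :: nat and t assume t: "mono_on {..n} t" "t ` {..n} \<subseteq> {a..c}"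
    have "curve_length \<gamma> c b + (\<Sum>i<n. ennreal (dist (\<gamma> (t i)) (\<gamma> (t (Suc i))))) \<le> curve_length \<gamma> a b"
      by (rule curve_length_add_least[OF assms(2)], subst add.commute, rule *[OF t])
    then show "(\<Sum>i<n. ennreal (dist (\<gamma> (t i)) (\<gamma> (t (Suc i))))) + curve_length \<gamma> c b \<le> curve_length \<gamma> a b"
      by (simp add: add.commute)
  qed
qed

lemma curve_length_mono:
  fixes \<gamma> :: "real \<Rightarrow> 'a::metric_space"
  assumes "a \<le> a'" "b' \<le> b" "a' \<le> b'"
  shows "curve_length \<gamma> a' b' \<le> curve_length \<gamma> a b"
proof (rule curve_length_least)
  fix n :: nat and t assume t: "mono_on {..n} t" "t ` {..n} \<subseteq> {a'..b'}"
  have "{a'..b'} \<subseteq> {a..b}" using assms by auto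
  with t show "(\<Sum>i<n. ennreal (dist (\<gamma> (t i)) (\<gamma> (t (Suc i))))) \<le> curve_length \<gamma> a b"
    by (intro curve_length_upper) auto
qed

lemma curve_length_self: "curve_length \<gamma> a a = 0"
proof -
  have "curve_length \<gamma> a a \<le> 0"
  proof (rule curve_length_least)
    fix n :: nat and t assume "mono_on {..n} t" "t ` {..n} \<subseteq> {a..a}"
    then have "t i = a" if "i \<le> n" for i using that by (auto simp: image_subset_iff)
    then show "(\<Sum>i<n. ennreal (dist (\<gamma> (t i)) (\<gamma> (t (Suc i))))) \<le> 0" by simp
  qed
  then show ?thesis by simp
qed

definition arc_len :: "(real \<Rightarrow> 'a::metric_space) \<Rightarrow> real \<Rightarrow> real" where
  "arc_len \<gamma> t = enn2real (curve_length \<gamma> 0 t)"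

lemma rectifiable_curve_length:
  assumes "rectifiable \<gamma>" "0 \<le> s" "s \<le> t" "t \<le> 1"
  shows "curve_length \<gamma> s t = ennreal (arc_len \<gamma> t - arc_len \<gamma> s)" "arc_len \<gamma> s \<le> arc_len \<gamma> t"
proof -
  have fin: "curve_length \<gamma> 0 x \<noteq> \<infinity>" if "0 \<le> x" "x \<le> 1" for x
    using curve_length_mono[of 0 0 x 1 \<gamma>] that assms(1) by (auto simp: rectifiable_def top_unique less_top)
  have *: "curve_length \<gamma> 0 x = ennreal (arc_len \<gamma> x)" if "0 \<le> x" "x \<le> 1" for x
    using fin[OF that] by (simp add: arc_len_def less_top)
  show le: "arc_len \<gamma> s \<le> arc_len \<gamma> t"
    unfolding arc_len_def using fin[of t] assms
    by (intro enn2real_mono curve_length_mono) (auto simp: less_top)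
  have "ennreal (arc_len \<gamma> t) = ennreal (arc_len \<gamma> s) + curve_length \<gamma> s t"
    using curve_length_add[of 0 s t \<gamma>] assms *[of s] *[of t] by simp
  then have "curve_length \<gamma> s t = ennreal (arc_len \<gamma> t) - ennreal (arc_len \<gamma> s)"
    by simp
  then show "curve_length \<gamma> s t = ennreal (arc_len \<gamma> t - arc_len \<gamma> s)"
    by (simp add: ennreal_minus arc_len_def)
qed

lemma arc_len_0 [simp]: "arc_len \<gamma> 0 = 0"
  by (simp add: arc_len_def curve_length_self)

lemma dist_le_arc_len:
  assumes "rectifiable \<gamma>" "0 \<le> s" "s \<le> t" "t \<le> 1"
  shows "dist (\<gamma> s) (\<gamma> t) \<le> arc_len \<gamma> t - arc_len \<gamma> s"
  using dist_le_curve_length[of s t \<gamma>] rectifiable_curve_length[OF assms] assms by simp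

text \<open>
  The variation of a truncated partition depends continuously on the truncation point, and a
  partition that almost realises the total length almost realises the length up to every
  intermediate point.
\<close>

lemma continuous_on_arc_len:
  fixes \<gamma> :: "real \<Rightarrow> 'a::metric_space"
  assumes "rectifiable \<gamma>"
  shows "continuous_on {0..1} (arc_len \<gamma>)"
proof -
  have cont: "continuous_on {0..1} \<gamma>" using assms by (auto simp: rectifiable_def path_def)
  define V where "V n t x = (\<Sum>i<n. dist (\<gamma> (min (t i) x)) (\<gamma> (min (t (Suc i)) x)))"
    for n :: nat and t x
  have "\<exists>n t. mono_on {..n::nat} t \<and> t ` {..n} \<subseteq> {0..1} \<and> arc_len \<gamma> 1 - e < V n t 1" if "e > 0" for e
  proof (rule ccontr)
    assume neg: "\<not> ?thesis"
    have "curve_length \<gamma> 0 1 \<le> ennreal (arc_len \<gamma> 1 - e)"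
    proof (rule curve_length_least)
      fix n :: nat and t assume t: "mono_on {..n} t" "t ` {..n} \<subseteq> {0..1::real}"
      have "V n t 1 = (\<Sum>i<n. dist (\<gamma> (t i)) (\<gamma> (t (Suc i))))"
        unfolding V_def
      proof (rule sum.cong)
        fix i assume "i \<in> {..<n}"
        then have "t i \<le> 1" "t (Suc i) \<le> 1" using t(2) by (auto simp: image_subset_iff)
        then show "dist (\<gamma> (min (t i) 1)) (\<gamma> (min (t (Suc i)) 1)) = dist (\<gamma> (t i)) (\<gamma> (t (Suc i)))" by simp
      qed simp
      then show "(\<Sum>i<n. ennreal (dist (\<gamma> (t i)) (\<gamma> (t (Suc i))))) \<le> ennreal (arc_len \<gamma> 1 - e)"
        using neg t by (simp add: not_less) (metis ennreal_leI)
    qed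
    moreover have "curve_length \<gamma> 0 1 = ennreal (arc_len \<gamma> 1)"
      using rectifiable_curve_length(1)[OF assms, of 0 1] by simp
    moreover have "0 \<le> arc_len \<gamma> 1" by (simp add: arc_len_def)
    ultimately have "arc_len \<gamma> 1 \<le> arc_len \<gamma> 1 - e \<or> arc_len \<gamma> 1 = 0"
      by (auto simp: ennreal_le_iff2)
    moreover have "\<not> arc_len \<gamma> 1 - e < V 0 (\<lambda>_. 0) 1"
    proof
      assume "arc_len \<gamma> 1 - e < V 0 (\<lambda>_. 0) 1"
      then have "mono_on {..0::nat} (\<lambda>_. 0::real) \<and> (\<lambda>_. 0::real) ` {..0::nat} \<subseteq> {0..1} \<and>
        arc_len \<gamma> 1 - e < V 0 (\<lambda>_. 0) 1" by (auto simp: mono_on_def)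
      with neg show False by blast
    qed
    ultimately show False using that by (auto simp: V_def)
  qed
  then have "\<forall>k. \<exists>n t. mono_on {..n::nat} t \<and> t ` {..n} \<subseteq> {0..1} \<and> arc_len \<gamma> 1 - 1 / Suc k < V n t 1"
    by simp
  then obtain n t where nt: "\<And>k. mono_on {..n k::nat} (t k)" "\<And>k. t k ` {..n k} \<subseteq> {0..1}"
    "\<And>k. arc_len \<gamma> 1 - 1 / Suc k < V (n k) (t k) 1"
    by metis
  have nn: "V n t x \<ge> 0" for n t x by (auto simp: V_def intro: sum_nonneg)
  have close: "\<bar>V (n k) (t k) x - arc_len \<gamma> x\<bar> < 1 / Suc k" if x: "x \<in> {0..1}" for k x
  proof -
    have "ennreal (V (n k) (t k) x) \<le> curve_length \<gamma> 0 x"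
      unfolding V_def sum_ennreal[OF zero_le_dist, symmetric]
      by (rule curve_length_upper[OF mono_on_min_max(1)[OF nt(1)]])
        (use x nt(2)[of k] in \<open>auto simp: image_subset_iff\<close>)
    then have 1: "V (n k) (t k) x \<le> arc_len \<gamma> x"
      using rectifiable_curve_length[OF assms, of 0 x] x by simp
    have "ennreal (V (n k) (t k) 1) = (\<Sum>i<n k. ennreal (dist (\<gamma> (t k i)) (\<gamma> (t k (Suc i)))))"
      unfolding V_def sum_ennreal[OF zero_le_dist, symmetric]
    proof (rule sum.cong)
      fix i assume "i \<in> {..<n k}"
      then have "t k i \<le> 1" "t k (Suc i) \<le> 1" using nt(2)[of k] by (auto simp: image_subset_iff)
      then show "ennreal (dist (\<gamma> (min (t k i) 1)) (\<gamma> (min (t k (Suc i)) 1))) = ennreal (dist (\<gamma> (t k i)) (\<gamma> (t k (Suc i))))" by simp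
    qed simp
    also have "\<dots> \<le> ennreal (V (n k) (t k) x) + curve_length \<gamma> x 1"
      unfolding V_def sum_ennreal[OF zero_le_dist, symmetric]
      by (rule order_trans[OF partition_sum_split_le[OF nt(1), of \<gamma> _ x]], rule add_mono[OF order_refl],
          rule curve_length_upper[OF mono_on_min_max(2)[OF nt(1)]])
        (use x nt(2)[of k] in \<open>auto simp: image_subset_iff\<close>)
    also have "curve_length \<gamma> x 1 = ennreal (arc_len \<gamma> 1 - arc_len \<gamma> x)"
      using rectifiable_curve_length(1)[OF assms, of x 1] x by simp
    also have "ennreal (V (n k) (t k) x) + \<dots> = ennreal (V (n k) (t k) x + (arc_len \<gamma> 1 - arc_len \<gamma> x))"
      using nn rectifiable_curve_length(2)[OF assms, of x 1] x by (simp add: ennreal_plus[symmetric] del: ennreal_plus)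
    finally have "V (n k) (t k) 1 \<le> V (n k) (t k) x + (arc_len \<gamma> 1 - arc_len \<gamma> x)"
      using nn rectifiable_curve_length(2)[OF assms, of x 1] x by (subst (asm) ennreal_le_iff) (auto intro!: add_nonneg_nonneg)
    with 1 nt(3)[of k] show ?thesis by linarith
  qed
  have V_cont: "continuous_on {0..1} (V (n k) (t k))" for k
    unfolding V_def
  proof (intro continuous_on_sum continuous_on_dist continuous_on_compose2[OF cont] continuous_intros)
    fix i assume "i \<in> {..<n k}"
    then have "t k i \<in> {0..1}" "t k (Suc i) \<in> {0..1}" using nt(2)[of k] by (auto simp: image_subset_iff)
    then show "(\<lambda>x. min (t k i) x) ` {0..1} \<subseteq> {0..1}" "(\<lambda>x. min (t k (Suc i)) x) ` {0..1} \<subseteq> {0..1}"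
      by (auto simp: min_def)
  qed
  have "uniform_limit {0..1} (\<lambda>k. V (n k) (t k)) (arc_len \<gamma>) sequentially"
  proof (rule uniform_limitI)
    fix e :: real assume "e > 0"
    then obtain k0 where k0: "1 / Suc k0 < e" using nat_approx_posE by (metis of_nat_Suc)
    show "\<forall>\<^sub>F k in sequentially. \<forall>x\<in>{0..1}. dist (V (n k) (t k) x) (arc_len \<gamma> x) < e"
      using eventually_ge_at_top[of k0]
    proof eventually_elim
      case (elim k)
      then have "1 / Suc k \<le> 1 / Suc k0" by (simp add: frac_le)
      then show ?case using close[of _ k] k0 by (fastforce simp: dist_real_def)
    qed
  qed
  then show ?thesis by (rule uniform_limit_theorem[rotated]) (auto intro: V_cont always_eventually)
qed

lemma arc_len_nonneg: "0 \<le> arc_len \<gamma> t"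
  by (simp add: arc_len_def)

text \<open>
  By continuity of arc length, the infimum that defines \<open>arc_length_param\<close> is a parameter at which
  the length is \<open>\<tau>\<close>.
\<close>

lemma arc_length_param_attained:
  fixes \<gamma> :: "real \<Rightarrow> 'a::metric_space"
  assumes "rectifiable \<gamma>" "0 \<le> \<tau>" "\<tau> \<le> arc_len \<gamma> 1"
  shows "\<exists>t\<in>{0..1}. arc_len \<gamma> t = \<tau> \<and> arc_length_param \<gamma> \<tau> = \<gamma> t"
proof -
  let ?S = "{t \<in> {0..1}. curve_length \<gamma> 0 t = ennreal \<tau>}"
  have eq: "?S = {0..1} \<inter> arc_len \<gamma> -` {\<tau>}"
  proof -
    have "curve_length \<gamma> 0 t = ennreal \<tau> \<longleftrightarrow> arc_len \<gamma> t = \<tau>" if "t \<in> {0..1}" for t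
      using rectifiable_curve_length[OF assms(1), of 0 t] that assms(2) by simp
    then show ?thesis by auto
  qed
  have "closed ?S" unfolding eq
    by (rule continuous_closed_preimage[OF continuous_on_arc_len[OF assms(1)]]) auto
  moreover have "?S \<noteq> {}" unfolding eq
    using IVT'[of "arc_len \<gamma>" 0 \<tau> 1] continuous_on_arc_len[OF assms(1)] assms by auto
  moreover have "bdd_below ?S" by (auto intro!: bdd_belowI[of _ 0])
  ultimately have "Inf ?S \<in> ?S" by (rule closed_contains_Inf[rotated 2])
  then show ?thesis unfolding arc_length_param_def eq by auto
qed

lemma arc_length_param_dist:
  fixes \<gamma> :: "real \<Rightarrow> 'a::metric_space"
  assumes "rectifiable \<gamma>" "a \<in> {0..arc_len \<gamma> 1}" "b \<in> {0..arc_len \<gamma> 1}"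
  shows "dist (arc_length_param \<gamma> a) (arc_length_param \<gamma> b) \<le> \<bar>a - b\<bar>"
proof -
  obtain s t where st: "s \<in> {0..1}" "t \<in> {0..1}" "arc_len \<gamma> s = a" "arc_len \<gamma> t = b"
    "arc_length_param \<gamma> a = \<gamma> s" "arc_length_param \<gamma> b = \<gamma> t"
    using arc_length_param_attained[OF assms(1)] assms(2,3) by (metis atLeastAtMost_iff)
  then show ?thesis
    using dist_le_arc_len[OF assms(1), of s t] dist_le_arc_len[OF assms(1), of t s]
    by (cases "s \<le> t") (auto simp: dist_commute)
qed

lemma arc_length_param_arc_len:
  fixes \<gamma> :: "real \<Rightarrow> 'a::metric_space"
  assumes "rectifiable \<gamma>" "t \<in> {0..1}"
  shows "arc_length_param \<gamma> (arc_len \<gamma> t) = \<gamma> t"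
proof -
  have "0 \<le> arc_len \<gamma> t" "arc_len \<gamma> t \<le> arc_len \<gamma> 1"
    using rectifiable_curve_length(2)[OF assms(1), of t 1] assms(2) by (simp_all add: arc_len_nonneg)
  from arc_length_param_attained[OF assms(1) this]
  obtain s where s: "s \<in> {0..1}" "arc_len \<gamma> s = arc_len \<gamma> t" "arc_length_param \<gamma> (arc_len \<gamma> t) = \<gamma> s"
    by metis
  have "dist (\<gamma> s) (\<gamma> t) \<le> 0"
  proof (cases "s \<le> t")
    case True
    then show ?thesis using dist_le_arc_len[OF assms(1), of s t] assms(2) s(1,2) by simp
  next
    case False
    then show ?thesis using dist_le_arc_len[OF assms(1), of t s] assms(2) s(1,2)
      by (simp add: dist_commute)
  qed
  then show ?thesis using s(3) by simp
qed

lemma curve_length_comp_le: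
  assumes "mono f"
  shows "curve_length (\<gamma> \<circ> f) a b \<le> curve_length \<gamma> (f a) (f b)"
proof (rule curve_length_least)
  fix n :: nat and t assume t: "mono_on {..n} t" "t ` {..n} \<subseteq> {a..b}"
  have "mono_on {..n} (f \<circ> t)" using t(1) assms by (auto simp: mono_on_def mono_def)
  moreover have "(f \<circ> t) ` {..n} \<subseteq> {f a..f b}"
    using t(2) assms by (auto simp: image_subset_iff mono_def)
  ultimately show "(\<Sum>i<n. ennreal (dist ((\<gamma> \<circ> f) (t i)) ((\<gamma> \<circ> f) (t (Suc i))))) \<le> curve_length \<gamma> (f a) (f b)"
    using curve_length_upper[of n "f \<circ> t" "f a" "f b" \<gamma>] by simp
qed

lemma curve_length_affine:
  assumes "0 < m"
  shows "curve_length (\<lambda>x. \<gamma> (s + m * x)) a b = curve_length \<gamma> (s + m * a) (s + m * b)"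
proof (rule antisym)
  show "curve_length (\<lambda>x. \<gamma> (s + m * x)) a b \<le> curve_length \<gamma> (s + m * a) (s + m * b)"
    using curve_length_comp_le[of "\<lambda>x. s + m * x" \<gamma> a b] assms by (auto simp: mono_def comp_def)
  have "mono (\<lambda>x. (x - s) / m)" using assms by (auto simp: mono_def divide_right_mono)
  from curve_length_comp_le[OF this, of "\<lambda>x. \<gamma> (s + m * x)" "s + m * a" "s + m * b"]
  show "curve_length \<gamma> (s + m * a) (s + m * b) \<le> curve_length (\<lambda>x. \<gamma> (s + m * x)) a b"
    using assms by (simp add: comp_def)
qed

lemma measurable_lipschitz_curve:
  assumes "\<And>a b :: real. dist (c a) (c b) \<le> \<bar>a - b\<bar>"
  shows "c \<in> borel_measurable borel"
proof -
  have "dist (c x') (c x) \<le> e" if "dist x' x < e" for x x' e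
    using assms[of x' x] that by (simp add: dist_real_def)
  then have "continuous_on UNIV c" by (intro continuous_onI) blast
  then show ?thesis by (rule borel_measurable_continuous_onI)
qed

text \<open>
  All that is ever used about rectifiable curves: arc length turns such a curve into a
  1-Lipschitz curve \<open>c\<close>, here extended by constants to the whole line, and every piece of \<open>c\<close> is
  again the arc length parametrisation of a rectifiable curve.
\<close>

lemma rectifiable_arc:
  fixes \<gamma> :: "real \<Rightarrow> 'a::metric_space"
  assumes rect: "rectifiable \<gamma>"
  obtains c \<Lambda> where "0 \<le> \<Lambda>" "\<And>a b. dist (c a) (c b) \<le> \<bar>a - b\<bar>" "c 0 = pathstart \<gamma>" "c \<Lambda> = pathfinish \<gamma>"
    "\<And>g. line_integral \<gamma> g = (\<integral>\<^sup>+ \<tau> \<in> {0..\<Lambda>}. g (c \<tau>) \<partial>lborel)"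
    "\<And>a b. 0 \<le> a \<Longrightarrow> a \<le> b \<Longrightarrow> b \<le> \<Lambda> \<Longrightarrow> c a \<noteq> c b \<Longrightarrow>
       \<exists>\<sigma>. rectifiable \<sigma> \<and> \<not> \<sigma> constant_on {0..1} \<and> pathstart \<sigma> = c a \<and> pathfinish \<sigma> = c b \<and>
         (\<forall>g\<in>borel_measurable borel. line_integral \<sigma> g = (\<integral>\<^sup>+ \<tau> \<in> {a..b}. g (c \<tau>) \<partial>lborel))"
proof -
  define \<Lambda> where "\<Lambda> = arc_len \<gamma> 1"
  define c where "c \<tau> = arc_length_param \<gamma> (max 0 (min \<Lambda> \<tau>))" for \<tau>
  have \<Lambda>: "0 \<le> \<Lambda>" by (simp add: \<Lambda>_def arc_len_nonneg)
  have c_eq: "c \<tau> = arc_length_param \<gamma> \<tau>" if "\<tau> \<in> {0..\<Lambda>}" for \<tau>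
  proof -
    have "max 0 (min \<Lambda> \<tau>) = \<tau>" using that by auto
    then show ?thesis by (simp add: c_def)
  qed
  have lip: "dist (c a) (c b) \<le> \<bar>a - b\<bar>" for a b
  proof -
    have "dist (c a) (c b) \<le> \<bar>max 0 (min \<Lambda> a) - max 0 (min \<Lambda> b)\<bar>"
      unfolding c_def by (rule arc_length_param_dist[OF rect]) (use \<Lambda> in \<open>auto simp: \<Lambda>_def\<close>)
    also have "\<dots> \<le> \<bar>a - b\<bar>" by (auto simp: max_def min_def)
    finally show ?thesis .
  qed
  have c_arc: "c (arc_len \<gamma> t) = \<gamma> t" if "t \<in> {0..1}" for t
    using arc_length_param_arc_len[OF rect that] rectifiable_curve_length(2)[OF rect, of t 1] that
    by (subst c_eq) (simp_all add: \<Lambda>_def arc_len_nonneg)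
  have li: "line_integral \<gamma> g = (\<integral>\<^sup>+ \<tau> \<in> {0..\<Lambda>}. g (c \<tau>) \<partial>lborel)" for g
    unfolding line_integral_def \<Lambda>_def[unfolded arc_len_def, symmetric]
    by (rule nn_integral_cong) (auto simp: indicator_def c_eq)
  note [measurable] = measurable_lipschitz_curve[OF lip]
  show thesis
  proof (rule that[of \<Lambda> c, OF \<Lambda> lip _ _ li])
    show "c 0 = pathstart \<gamma>" "c \<Lambda> = pathfinish \<gamma>"
      using c_arc[of 0] c_arc[of 1] by (auto simp: pathstart_def pathfinish_def \<Lambda>_def)
    fix a b assume ab: "0 \<le> a" "a \<le> b" "b \<le> \<Lambda>" "c a \<noteq> c b"
    obtain s where s: "s \<in> {0..1}" "arc_len \<gamma> s = a" "c a = \<gamma> s"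
      using arc_length_param_attained[OF rect, of a] c_eq[of a] ab by (auto simp: \<Lambda>_def)
    obtain t where t: "t \<in> {0..1}" "arc_len \<gamma> t = b" "c b = \<gamma> t"
      using arc_length_param_attained[OF rect, of b] c_eq[of b] ab by (auto simp: \<Lambda>_def)
    have "s < t"
    proof (rule ccontr)
      assume "\<not> s < t"
      then have "b \<le> a" using rectifiable_curve_length(2)[OF rect, of t s] s t by auto
      then show False using ab by auto
    qed
    define m where "m = t - s"
    have m: "0 < m" "m \<le> 1" "s + m = t" using \<open>s < t\<close> s t by (auto simp: m_def)
    have range: "s + m * x \<in> {0..1}" "s \<le> s + m * x" if "x \<in> {0..1}" for x
    proof -
      have "m * x \<le> m" using that m by (simp add: mult_left_le)
      moreover have "0 \<le> m * x" using that m by simp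
      ultimately show "s + m * x \<in> {0..1}" "s \<le> s + m * x"
        using s(1) t(1) m unfolding atLeastAtMost_iff by linarith+
    qed
    define \<sigma> where "\<sigma> = (\<lambda>x. \<gamma> (s + m * x))"
    have len: "curve_length \<sigma> 0 x = ennreal (arc_len \<gamma> (s + m * x) - a)" if "x \<in> {0..1}" for x
      using rectifiable_curve_length(1)[OF rect, of s "s + m * x"] range[OF that] s
      by (simp add: \<sigma>_def curve_length_affine[OF m(1)])
    have rs: "rectifiable \<sigma>"
      unfolding rectifiable_def
    proof
      have "continuous_on {0..1} \<gamma>" using rect by (auto simp: rectifiable_def path_def)
      then show "path \<sigma>" unfolding path_def \<sigma>_def
        by (rule continuous_on_compose2) (use range in \<open>auto intro!: continuous_intros\<close>)
      show "curve_length \<sigma> 0 1 < \<infinity>" using len[of 1] by simp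
    qed
    have al: "arc_len \<sigma> x = arc_len \<gamma> (s + m * x) - a" if "x \<in> {0..1}" for x
      unfolding arc_len_def[of \<sigma>] len[OF that]
      using rectifiable_curve_length(2)[OF rect, of s "s + m * x"] range[OF that] s by simp
    have al1: "arc_len \<sigma> 1 = b - a" using al[of 1] m t by simp
    have param: "arc_length_param \<sigma> \<tau> = c (a + \<tau>)" if \<tau>: "\<tau> \<in> {0..b - a}" for \<tau>
    proof -
      obtain x where x: "x \<in> {0..1}" "arc_len \<sigma> x = \<tau>" "arc_length_param \<sigma> \<tau> = \<sigma> x"
        using arc_length_param_attained[OF rs, of \<tau>] \<tau> al1 by auto
      then have "arc_len \<gamma> (s + m * x) = a + \<tau>" using al[OF x(1)] by simp
      then have "c (a + \<tau>) = \<gamma> (s + m * x)" using c_arc[OF range(1)[OF x(1)]] by simp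
      then show ?thesis using x by (simp add: \<sigma>_def)
    qed
    have ps: "pathstart \<sigma> = c a" "pathfinish \<sigma> = c b"
      using s t m by (auto simp: pathstart_def pathfinish_def \<sigma>_def)
    have "\<not> \<sigma> constant_on {0..1}"
    proof
      assume "\<sigma> constant_on {0..1}"
      then have "\<sigma> 0 = \<sigma> 1" by (auto simp: constant_on_def)
      then show False using ps ab by (auto simp: pathstart_def pathfinish_def)
    qed
    moreover have "line_integral \<sigma> g = (\<integral>\<^sup>+ \<tau> \<in> {a..b}. g (c \<tau>) \<partial>lborel)"
      if [measurable]: "g \<in> borel_measurable borel" for g
    proof -
      have "line_integral \<sigma> g = (\<integral>\<^sup>+ \<tau> \<in> {0..b - a}. g (c (a + \<tau>)) \<partial>lborel)"
        unfolding line_integral_def al1[unfolded arc_len_def]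
        by (rule nn_integral_cong) (auto simp: indicator_def param)
      also have "\<dots> = (\<integral>\<^sup>+ \<tau>. g (c (a + 1 * \<tau>)) * indicator {a..b} (a + 1 * \<tau>) \<partial>lborel)"
        by (rule nn_integral_cong) (auto simp: indicator_def)
      also have "\<dots> = (\<integral>\<^sup>+ \<tau> \<in> {a..b}. g (c \<tau>) \<partial>lborel)"
        by (subst nn_integral_real_affine[where c=1 and t=a]) auto
      finally show ?thesis .
    qed
    ultimately show "\<exists>\<sigma>. rectifiable \<sigma> \<and> \<not> \<sigma> constant_on {0..1} \<and> pathstart \<sigma> = c a \<and> pathfinish \<sigma> = c b \<and>
         (\<forall>g\<in>borel_measurable borel. line_integral \<sigma> g = (\<integral>\<^sup>+ \<tau> \<in> {a..b}. g (c \<tau>) \<partial>lborel))"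
      using rs ps by blast
  qed
qed

section \<open>Calculus of upper gradients\<close>

text \<open>
  The condition on curves in \<open>upper_gradient\<close>. Measurability of \<open>f\<close>, which depends on the measure,
  is split off.
\<close>

definition curve_gradient :: "('a::metric_space \<Rightarrow> ennreal) \<Rightarrow> ('a \<Rightarrow> real) \<Rightarrow> bool" where
  "curve_gradient g f \<longleftrightarrow> g \<in> borel_measurable borel \<and>
     (\<forall>\<gamma>. rectifiable \<gamma> \<and> \<not> \<gamma> constant_on {0..1} \<longrightarrow>
        ennreal \<bar>f (pathfinish \<gamma>) - f (pathstart \<gamma>)\<bar> \<le> line_integral \<gamma> g)"

lemma upper_gradient_real_iff:
  "upper_gradient M g (\<lambda>x. ereal (f x)) \<longleftrightarrow> f \<in> borel_measurable (completion M) \<and> curve_gradient g f"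
proof -
  have "(\<lambda>x. ereal (f x)) \<in> borel_measurable (completion M) \<longleftrightarrow> f \<in> borel_measurable (completion M)"
  proof
    assume "(\<lambda>x. ereal (f x)) \<in> borel_measurable (completion M)"
    then have "(\<lambda>x. real_of_ereal (ereal (f x))) \<in> borel_measurable (completion M)"
      by (rule borel_measurable_real_of_ereal)
    then show "f \<in> borel_measurable (completion M)" by simp
  qed simp
  then show ?thesis
    by (simp add: upper_gradient_def curve_gradient_def Let_def e2ennreal_ereal[symmetric] ennreal.abs_eq del: e2ennreal_ereal)
qed

text \<open>
  An arc length parametrisation, described only by what is used of it: upper gradients control the
  increments of functions along every piece of the curve.
\<close>

definition gradient_arc :: "(real \<Rightarrow> 'a::metric_space) \<Rightarrow> real \<Rightarrow> bool" where
  "gradient_arc c \<Lambda> \<longleftrightarrow> 0 \<le> \<Lambda> \<and> (\<forall>a b. dist (c a) (c b) \<le> \<bar>a - b\<bar>) \<and>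
     (\<forall>g f a b. curve_gradient g f \<longrightarrow> 0 \<le> a \<longrightarrow> a \<le> b \<longrightarrow> b \<le> \<Lambda> \<longrightarrow>
        ennreal \<bar>f (c b) - f (c a)\<bar> \<le> (\<integral>\<^sup>+ \<tau> \<in> {a..b}. g (c \<tau>) \<partial>lborel))"

lemma gradient_arcD:
  assumes "gradient_arc c \<Lambda>"
  shows "0 \<le> \<Lambda>" "dist (c a) (c b) \<le> \<bar>a - b\<bar>" "c \<in> borel_measurable borel"
    and "curve_gradient g f \<Longrightarrow> 0 \<le> a \<Longrightarrow> a \<le> b \<Longrightarrow> b \<le> \<Lambda> \<Longrightarrow>
        ennreal \<bar>f (c b) - f (c a)\<bar> \<le> (\<integral>\<^sup>+ \<tau> \<in> {a..b}. g (c \<tau>) \<partial>lborel)"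
  using assms measurable_lipschitz_curve[of c] by (auto simp: gradient_arc_def)

lemma curve_gradientI:
  fixes f :: "'a::metric_space \<Rightarrow> real"
  assumes "g \<in> borel_measurable borel"
    and le: "\<And>c \<Lambda>. gradient_arc c \<Lambda> \<Longrightarrow>
      ennreal \<bar>f (c \<Lambda>) - f (c 0)\<bar> \<le> (\<integral>\<^sup>+ \<tau> \<in> {0..\<Lambda>}. g (c \<tau>) \<partial>lborel)"
  shows "curve_gradient g f"
  unfolding curve_gradient_def
proof (intro conjI allI impI assms(1))
  fix \<gamma> :: "real \<Rightarrow> 'a" assume \<gamma>: "rectifiable \<gamma> \<and> \<not> \<gamma> constant_on {0..1}"
  then have rect: "rectifiable \<gamma>" by simp
  obtain c \<Lambda> where c: "0 \<le> \<Lambda>" "\<And>a b. dist (c a) (c b) \<le> \<bar>a - b\<bar>" "c 0 = pathstart \<gamma>" "c \<Lambda> = pathfinish \<gamma>"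
    "\<And>g. line_integral \<gamma> g = (\<integral>\<^sup>+ \<tau> \<in> {0..\<Lambda>}. g (c \<tau>) \<partial>lborel)"
    "\<And>a b. 0 \<le> a \<Longrightarrow> a \<le> b \<Longrightarrow> b \<le> \<Lambda> \<Longrightarrow> c a \<noteq> c b \<Longrightarrow>
       \<exists>\<sigma>. rectifiable \<sigma> \<and> \<not> \<sigma> constant_on {0..1} \<and> pathstart \<sigma> = c a \<and> pathfinish \<sigma> = c b \<and>
         (\<forall>g\<in>borel_measurable borel. line_integral \<sigma> g = (\<integral>\<^sup>+ \<tau> \<in> {a..b}. g (c \<tau>) \<partial>lborel))"
    by (rule rectifiable_arc[OF rect]) (rule that; assumption)
  have "gradient_arc c \<Lambda>" unfolding gradient_arc_def
  proof (intro conjI allI impI c(1,2))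
    fix g :: "'a \<Rightarrow> ennreal" and f :: "'a \<Rightarrow> real" and a b assume g: "curve_gradient g f" and ab: "0 \<le> a" "a \<le> b" "b \<le> \<Lambda>"
    show "ennreal \<bar>f (c b) - f (c a)\<bar> \<le> (\<integral>\<^sup>+ \<tau> \<in> {a..b}. g (c \<tau>) \<partial>lborel)"
    proof (cases "c a = c b")
      case False
      from c(6)[OF ab this] obtain \<sigma> where \<sigma>: "rectifiable \<sigma>" "\<not> \<sigma> constant_on {0..1}" "pathstart \<sigma> = c a" "pathfinish \<sigma> = c b"
         "\<forall>g\<in>borel_measurable borel. line_integral \<sigma> g = (\<integral>\<^sup>+ \<tau> \<in> {a..b}. g (c \<tau>) \<partial>lborel)" by blast
      from g have "g \<in> borel_measurable borel" "ennreal \<bar>f (pathfinish \<sigma>) - f (pathstart \<sigma>)\<bar> \<le> line_integral \<sigma> g"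
        using \<sigma>(1,2) by (auto simp: curve_gradient_def)
      with \<sigma> show ?thesis by simp
    qed simp
  qed
  from le[OF this] show "ennreal \<bar>f (pathfinish \<gamma>) - f (pathstart \<gamma>)\<bar> \<le> line_integral \<gamma> g"
    using c(3-5) by simp
qed

lemma curve_gradient_Lipschitz_comp:
  fixes f :: "'a::metric_space \<Rightarrow> real" and \<psi> :: "real \<Rightarrow> real"
  assumes g: "curve_gradient g f" and K: "\<And>a b. \<bar>\<psi> a - \<psi> b\<bar> \<le> K * \<bar>a - b\<bar>" "0 \<le> K"
  shows "curve_gradient (\<lambda>x. ennreal K * g x) (\<lambda>x. \<psi> (f x))"
proof (rule curve_gradientI)
  have [measurable]: "g \<in> borel_measurable borel" using g by (simp add: curve_gradient_def)
  show "(\<lambda>x. ennreal K * g x) \<in> borel_measurable borel" by measurable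
  fix c :: "real \<Rightarrow> 'a" and \<Lambda> assume c: "gradient_arc c \<Lambda>"
  note [measurable] = gradient_arcD(3)[OF c]
  have "ennreal \<bar>\<psi> (f (c \<Lambda>)) - \<psi> (f (c 0))\<bar> \<le> ennreal (K * \<bar>f (c \<Lambda>) - f (c 0)\<bar>)"
    by (rule ennreal_leI, rule K)
  also have "\<dots> = ennreal K * ennreal \<bar>f (c \<Lambda>) - f (c 0)\<bar>" by (simp add: ennreal_mult K)
  also have "\<dots> \<le> ennreal K * (\<integral>\<^sup>+ \<tau> \<in> {0..\<Lambda>}. g (c \<tau>) \<partial>lborel)"
    using gradient_arcD(1)[OF c] by (intro mult_left_mono gradient_arcD(4)[OF c g]) auto
  also have "\<dots> = (\<integral>\<^sup>+ \<tau> \<in> {0..\<Lambda>}. ennreal K * g (c \<tau>) \<partial>lborel)"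
    by (subst nn_integral_cmult[symmetric]) (auto simp: mult.assoc)
  finally show "ennreal \<bar>\<psi> (f (c \<Lambda>)) - \<psi> (f (c 0))\<bar> \<le> (\<integral>\<^sup>+ \<tau> \<in> {0..\<Lambda>}. ennreal K * g (c \<tau>) \<partial>lborel)" .
qed

lemma nn_integral_Icc_add:
  fixes w :: "real \<Rightarrow> ennreal"
  assumes [measurable]: "w \<in> borel_measurable borel" and "a \<le> b" "b \<le> c"
  shows "(\<integral>\<^sup>+ x \<in> {a..b}. w x \<partial>lborel) + (\<integral>\<^sup>+ x \<in> {b..c}. w x \<partial>lborel) = (\<integral>\<^sup>+ x \<in> {a..c}. w x \<partial>lborel)"
proof -
  have "(\<integral>\<^sup>+ x \<in> {a..b}. w x \<partial>lborel) + (\<integral>\<^sup>+ x \<in> {b..c}. w x \<partial>lborel) =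
    (\<integral>\<^sup>+ x. w x * indicator {a..b} x + w x * indicator {b..c} x \<partial>lborel)"
    by (subst nn_integral_add) auto
  also have "\<dots> = (\<integral>\<^sup>+ x \<in> {a..c}. w x \<partial>lborel)"
    using AE_lborel_singleton[of b]
    by (intro nn_integral_cong_AE, eventually_elim) (use assms in \<open>auto simp: indicator_def\<close>)
  finally show ?thesis .
qed

text \<open>
  The product rule, localised. On a short piece of a curve the product changes by at most
  \<open>\<integral>g\<close> plus the value of \<open>f\<close> at an endpoint times the change of \<open>\<phi>\<close>; that value exceeds
  \<open>f\<close> at any other point of the piece by at most \<open>\<integral>g\<close> over the piece, an error which is
  multiplied by the length of the piece and vanishes in the limit. Looking at short pieces only also
  shows that \<open>g\<close> may be weighted by a function \<open>\<omega>\<close> that dominates \<open>\<phi>\<close> nearby; its lower bound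
  \<open>\<omega>0\<close> is needed because the error contains \<open>\<integral>g\<close> without the weight. The function \<open>h\<close> is a Borel
  majorant of \<open>f\<close>, as \<open>f\<close> itself need not be Borel.
\<close>

lemma curve_gradient_cutoff:
  fixes f \<phi> l \<omega> :: "'a::metric_space \<Rightarrow> real"
  assumes g: "curve_gradient g f" and f: "\<And>x. 0 \<le> f x" "\<And>x. f x \<le> 1"
    and h: "h \<in> borel_measurable borel" "\<And>x. ennreal (f x) \<le> h x"
    and \<phi>: "\<And>x. 0 \<le> \<phi> x" "\<And>x. \<phi> x \<le> 1"
    and l: "l \<in> borel_measurable borel" "\<And>x. 0 \<le> l x" "\<And>x. l x \<le> L"
    and \<omega>: "\<omega> \<in> borel_measurable borel" "0 < \<delta>" "0 < \<omega>0"
      "\<And>x z. \<phi> x \<noteq> 0 \<Longrightarrow> dist x z < \<delta> \<Longrightarrow> \<phi> x \<le> \<omega> z \<and> \<omega>0 \<le> \<omega> z"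
    and lip: "\<And>x y z. dist x y < \<delta> \<Longrightarrow> dist x z < \<delta> \<Longrightarrow> \<bar>\<phi> x - \<phi> y\<bar> \<le> l z * dist x y"
  shows "curve_gradient (\<lambda>x. g x * ennreal (\<omega> x) + h x * ennreal (l x)) (\<lambda>x. f x * \<phi> x)"
proof (rule curve_gradientI)
  have [measurable]: "g \<in> borel_measurable borel" using g by (simp add: curve_gradient_def)
  note [measurable] = h(1) l(1) \<omega>(1)
  show "(\<lambda>x. g x * ennreal (\<omega> x) + h x * ennreal (l x)) \<in> borel_measurable borel" by measurable
  fix c :: "real \<Rightarrow> 'a" and \<Lambda> assume c: "gradient_arc c \<Lambda>"
  note [measurable] = gradient_arcD(3)[OF c]
  have \<Lambda>: "0 \<le> \<Lambda>" by (rule gradient_arcD(1)[OF c])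
  have L: "0 \<le> L" using l(2,3) order_trans by blast
  define G H where "G x = g x * ennreal (\<omega> x)" and "H x = h x * ennreal (l x)" for x
  have [measurable]: "G \<in> borel_measurable borel" "H \<in> borel_measurable borel"
    unfolding G_def H_def by measurable
  let ?W = "\<lambda>x. G x + H x"
  have piece: "ennreal \<bar>f (c b) * \<phi> (c b) - f (c a) * \<phi> (c a)\<bar> \<le>
     (\<integral>\<^sup>+ \<tau> \<in> {a..b}. ?W (c \<tau>) \<partial>lborel) + ennreal (L / \<omega>0 * (b - a)) * (\<integral>\<^sup>+ \<tau> \<in> {a..b}. G (c \<tau>) \<partial>lborel)"
    if ab: "0 \<le> a" "a < b" "b \<le> \<Lambda>" "b - a < \<delta>" for a b
  proof -
    let ?I = "\<integral>\<^sup>+ \<tau> \<in> {a..b}. G (c \<tau>) \<partial>lborel"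
    have near: "dist (c s) (c t) < \<delta>" if "s \<in> {a..b}" "t \<in> {a..b}" for s t
      using gradient_arcD(2)[OF c, of s t] that ab by auto
    have osc0: "ennreal w * ennreal \<bar>f (c t) - f (c s)\<bar> \<le> ?I"
      if st: "a \<le> s" "s \<le> t" "t \<le> b" and w: "\<And>\<tau>. \<tau> \<in> {a..b} \<Longrightarrow> w \<le> \<omega> (c \<tau>)" for s t w
    proof -
      have "ennreal w * ennreal \<bar>f (c t) - f (c s)\<bar> \<le> ennreal w * (\<integral>\<^sup>+ \<tau> \<in> {s..t}. g (c \<tau>) \<partial>lborel)"
        using st ab by (intro mult_left_mono gradient_arcD(4)[OF c g]) auto
      also have "\<dots> = (\<integral>\<^sup>+ \<tau>. ennreal w * (g (c \<tau>) * indicator {s..t} \<tau>) \<partial>lborel)"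
        by (rule nn_integral_cmult[symmetric]) measurable
      also have "\<dots> \<le> ?I"
        using st w by (intro nn_integral_mono) (auto simp: G_def indicator_def mult.commute[of _ "g _"] intro!: mult_left_mono ennreal_leI)
      finally show ?thesis .
    qed
    have osc: "ennreal \<bar>f (c t) - f (c s)\<bar> \<le> ennreal (1 / \<omega>0) * ?I"
      if st: "a \<le> s" "s \<le> t" "t \<le> b" and nz: "\<phi> (c a) \<noteq> 0 \<or> \<phi> (c b) \<noteq> 0" for s t
    proof -
      have "\<omega>0 \<le> \<omega> (c \<tau>)" if "\<tau> \<in> {a..b}" for \<tau>
        using nz \<omega>(4)[of "c a" "c \<tau>"] \<omega>(4)[of "c b" "c \<tau>"] near[OF _ that, of a] near[OF _ that, of b] ab by auto
      then have "ennreal (1 / \<omega>0) * (ennreal \<omega>0 * ennreal \<bar>f (c t) - f (c s)\<bar>) \<le> ennreal (1 / \<omega>0) * ?I"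
        using st by (intro mult_left_mono osc0) auto
      then show ?thesis using \<omega>(3) by (simp add: mult.assoc[symmetric] ennreal_mult[symmetric])
    qed
    have 1: "ennreal (\<phi> (c a) * \<bar>f (c b) - f (c a)\<bar>) \<le> ?I"
    proof (cases "\<phi> (c a) = 0")
      case False
      have "\<phi> (c a) \<le> \<omega> (c \<tau>)" if "\<tau> \<in> {a..b}" for \<tau>
        using \<omega>(4)[OF False near[of a \<tau>]] that ab by auto
      then show ?thesis using osc0[of a b "\<phi> (c a)"] ab \<phi>(1) by (simp add: ennreal_mult)
    qed simp
    have 2: "ennreal (f (c b) * \<bar>\<phi> (c b) - \<phi> (c a)\<bar>) \<le>
       (\<integral>\<^sup>+ \<tau> \<in> {a..b}. H (c \<tau>) \<partial>lborel) + ennreal (L / \<omega>0 * (b - a)) * ?I"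
    proof (cases "\<phi> (c b) = \<phi> (c a)")
      case False
      have pt: "ennreal (f (c b) * \<bar>\<phi> (c b) - \<phi> (c a)\<bar>) \<le> ennreal (b - a) * (H (c \<tau>) + ennreal (L / \<omega>0) * ?I)"
        if "\<tau> \<in> {a..b}" for \<tau>
      proof -
        have "\<bar>\<phi> (c b) - \<phi> (c a)\<bar> \<le> l (c \<tau>) * dist (c b) (c a)"
          using that ab by (intro lip near) auto
        also have "\<dots> \<le> l (c \<tau>) * (b - a)"
          using gradient_arcD(2)[OF c, of b a] ab l by (intro mult_left_mono) auto
        finally have d: "\<bar>\<phi> (c b) - \<phi> (c a)\<bar> \<le> l (c \<tau>) * (b - a)" .
        have "ennreal (f (c b)) \<le> ennreal (f (c \<tau>)) + ennreal \<bar>f (c b) - f (c \<tau>)\<bar>"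
          using f by (simp add: ennreal_plus[symmetric] del: ennreal_plus) 
        also have "\<dots> \<le> h (c \<tau>) + ennreal (1 / \<omega>0) * ?I"
          using that False by (intro add_mono h osc) auto
        finally have e: "ennreal (f (c b)) \<le> h (c \<tau>) + ennreal (1 / \<omega>0) * ?I" .
        have "ennreal (f (c b) * \<bar>\<phi> (c b) - \<phi> (c a)\<bar>) = ennreal (f (c b)) * ennreal \<bar>\<phi> (c b) - \<phi> (c a)\<bar>"
          by (simp add: ennreal_mult f)
        also have "\<dots> \<le> (h (c \<tau>) + ennreal (1 / \<omega>0) * ?I) * ennreal (l (c \<tau>) * (b - a))"
          by (intro mult_mono e ennreal_leI d) auto
        also have "\<dots> = ennreal (b - a) * (H (c \<tau>) + ennreal (l (c \<tau>)) * ennreal (1 / \<omega>0) * ?I)"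
          using ennreal_mult[of "l (c \<tau>)" "b - a"] ab l
          by (simp add: H_def distrib_left distrib_right mult_ac)
        also have "ennreal (l (c \<tau>)) * ennreal (1 / \<omega>0) = ennreal (l (c \<tau>) / \<omega>0)"
          using l(2) \<omega>(3) by (simp add: ennreal_mult[symmetric])
        also have "ennreal (b - a) * (H (c \<tau>) + \<dots> * ?I) \<le> ennreal (b - a) * (H (c \<tau>) + ennreal (L / \<omega>0) * ?I)"
          using \<omega>(3) by (intro mult_left_mono add_left_mono mult_right_mono ennreal_leI divide_right_mono l) auto
        finally show ?thesis .
      qed
      let ?J = "f (c b) * \<bar>\<phi> (c b) - \<phi> (c a)\<bar>"
      have "ennreal (b - a) * ennreal ?J = (\<integral>\<^sup>+ \<tau> \<in> {a..b}. ennreal ?J \<partial>lborel)"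
        using ab nn_integral_cmult_indicator[of "{a..b}" lborel "ennreal ?J"] by (simp only: sets_lborel) (simp add: mult.commute)
      also have "\<dots> \<le> (\<integral>\<^sup>+ \<tau>. ennreal (b - a) * (H (c \<tau>) * indicator {a..b} \<tau> + ennreal (L / \<omega>0) * ?I * indicator {a..b} \<tau>) \<partial>lborel)"
        using pt by (intro nn_integral_mono) (auto simp: indicator_def)
      also have "\<dots> = ennreal (b - a) * ((\<integral>\<^sup>+ \<tau> \<in> {a..b}. H (c \<tau>) \<partial>lborel) + ennreal (L / \<omega>0) * ?I * ennreal (b - a))"
        using ab by (subst nn_integral_cmult) (auto simp: nn_integral_add nn_integral_cmult_indicator)
      also have "\<dots> = ennreal (b - a) * ((\<integral>\<^sup>+ \<tau> \<in> {a..b}. H (c \<tau>) \<partial>lborel) + ennreal (L / \<omega>0 * (b - a)) * ?I)"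
        using ab L \<omega>(3) ennreal_mult[of "L / \<omega>0" "b - a"] by (simp add: mult_ac)
      finally show ?thesis
        using ab by (subst (asm) ennreal_mult_le_mult_iff) auto
    qed simp
    have "f (c b) * \<phi> (c b) - f (c a) * \<phi> (c a) = f (c b) * (\<phi> (c b) - \<phi> (c a)) + \<phi> (c a) * (f (c b) - f (c a))"
      by (simp add: algebra_simps)
    then have "\<bar>f (c b) * \<phi> (c b) - f (c a) * \<phi> (c a)\<bar> \<le> f (c b) * \<bar>\<phi> (c b) - \<phi> (c a)\<bar> + \<phi> (c a) * \<bar>f (c b) - f (c a)\<bar>"
      using f(1)[of "c b"] \<phi>(1)[of "c a"] by (metis abs_mult abs_of_nonneg abs_triangle_ineq)
    then have "ennreal \<bar>f (c b) * \<phi> (c b) - f (c a) * \<phi> (c a)\<bar> \<le>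
      ennreal (f (c b) * \<bar>\<phi> (c b) - \<phi> (c a)\<bar>) + ennreal (\<phi> (c a) * \<bar>f (c b) - f (c a)\<bar>)"
      using f \<phi> by (simp add: ennreal_plus[symmetric] ennreal_leI del: ennreal_plus)
    also have "\<dots> \<le> ((\<integral>\<^sup>+ \<tau> \<in> {a..b}. H (c \<tau>) \<partial>lborel) + ennreal (L / \<omega>0 * (b - a)) * ?I) + ?I"
      by (rule add_mono[OF 2 1])
    also have "\<dots> = (\<integral>\<^sup>+ \<tau> \<in> {a..b}. ?W (c \<tau>) \<partial>lborel) + ennreal (L / \<omega>0 * (b - a)) * ?I"
      by (simp add: distrib_right nn_integral_add add_ac)
    finally show ?thesis .
  qed
  let ?A = "\<integral>\<^sup>+ \<tau> \<in> {0..\<Lambda>}. G (c \<tau>) \<partial>lborel" and ?T = "\<integral>\<^sup>+ \<tau> \<in> {0..\<Lambda>}. ?W (c \<tau>) \<partial>lborel"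
  have bound: "ennreal \<bar>f (c \<Lambda>) * \<phi> (c \<Lambda>) - f (c 0) * \<phi> (c 0)\<bar> \<le> ?T + ennreal (L / \<omega>0 * (\<Lambda> / n)) * ?A"
    if n: "0 < n" "\<Lambda> / n < \<delta>" "0 < \<Lambda>" for n :: nat
  proof -
    define \<eta> where "\<eta> = \<Lambda> / n"
    have \<eta>: "0 < \<eta>" "\<eta> < \<delta>" "n * \<eta> = \<Lambda>" using n by (auto simp: \<eta>_def)
    have "ennreal \<bar>f (c (i * \<eta>)) * \<phi> (c (i * \<eta>)) - f (c 0) * \<phi> (c 0)\<bar> \<le>
      (\<integral>\<^sup>+ \<tau> \<in> {0..i * \<eta>}. ?W (c \<tau>) \<partial>lborel) + ennreal (L / \<omega>0 * \<eta>) * (\<integral>\<^sup>+ \<tau> \<in> {0..i * \<eta>}. G (c \<tau>) \<partial>lborel)"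
      if "i \<le> n" for i
      using that
    proof (induction i)
      case (Suc i)
      let ?h = "\<lambda>x. f x * \<phi> x"
      have "real (Suc i) * \<eta> \<le> n * \<eta>" using Suc.prems \<eta> by (intro mult_right_mono) auto
      then have i: "0 \<le> i * \<eta>" "i * \<eta> < Suc i * \<eta>" "Suc i * \<eta> \<le> \<Lambda>" "Suc i * \<eta> - i * \<eta> = \<eta>"
        using \<eta> by (auto simp: algebra_simps)
      have "ennreal \<bar>?h (c (Suc i * \<eta>)) - ?h (c 0)\<bar> \<le>
        ennreal \<bar>?h (c (i * \<eta>)) - ?h (c 0)\<bar> + ennreal \<bar>?h (c (Suc i * \<eta>)) - ?h (c (i * \<eta>))\<bar>"
        by (simp add: ennreal_plus[symmetric] ennreal_leI del: ennreal_plus)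
      also have "\<dots> \<le> ((\<integral>\<^sup>+ \<tau> \<in> {0..i * \<eta>}. ?W (c \<tau>) \<partial>lborel) + ennreal (L / \<omega>0 * \<eta>) * (\<integral>\<^sup>+ \<tau> \<in> {0..i * \<eta>}. G (c \<tau>) \<partial>lborel))
        + ((\<integral>\<^sup>+ \<tau> \<in> {i * \<eta>..Suc i * \<eta>}. ?W (c \<tau>) \<partial>lborel) + ennreal (L / \<omega>0 * \<eta>) * (\<integral>\<^sup>+ \<tau> \<in> {i * \<eta>..Suc i * \<eta>}. G (c \<tau>) \<partial>lborel))"
        using piece[OF i(1,2,3)] Suc \<eta> unfolding i(4) by (intro add_mono) auto
      also have "\<dots> = ((\<integral>\<^sup>+ \<tau> \<in> {0..i * \<eta>}. ?W (c \<tau>) \<partial>lborel) + (\<integral>\<^sup>+ \<tau> \<in> {i * \<eta>..Suc i * \<eta>}. ?W (c \<tau>) \<partial>lborel))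
        + ennreal (L / \<omega>0 * \<eta>) * ((\<integral>\<^sup>+ \<tau> \<in> {0..i * \<eta>}. G (c \<tau>) \<partial>lborel) + (\<integral>\<^sup>+ \<tau> \<in> {i * \<eta>..Suc i * \<eta>}. G (c \<tau>) \<partial>lborel))"
        by (simp only: distrib_left add_ac)
      also have "\<dots> = (\<integral>\<^sup>+ \<tau> \<in> {0..Suc i * \<eta>}. ?W (c \<tau>) \<partial>lborel)
        + ennreal (L / \<omega>0 * \<eta>) * (\<integral>\<^sup>+ \<tau> \<in> {0..Suc i * \<eta>}. G (c \<tau>) \<partial>lborel)"
        using i by (subst (1 2) nn_integral_Icc_add) auto
      finally show ?case .
    qed simp
    from this[of n] show ?thesis unfolding \<eta>(3) by (simp add: \<eta>_def)
  qed
  have "ennreal \<bar>f (c \<Lambda>) * \<phi> (c \<Lambda>) - f (c 0) * \<phi> (c 0)\<bar> \<le> ?T"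
  proof (cases "\<Lambda> = 0 \<or> ?A = \<infinity>")
    case True
    moreover have "?A \<le> ?T" by (intro nn_integral_mono) (auto simp: indicator_def)
    ultimately show ?thesis by (auto simp: top_unique)
  next
    case False
    then obtain A where A: "?A = ennreal A" "0 \<le> A" by (cases ?A) auto
    have \<Lambda>0: "0 < \<Lambda>" using False \<Lambda> by auto
    show ?thesis
    proof (rule ennreal_le_epsilon)
      fix e :: real assume e: "0 < e"
      obtain n :: nat where n: "max (\<Lambda> / \<delta>) (L / \<omega>0 * \<Lambda> * A / e) < n" using reals_Archimedean2 by blast
      have "0 < \<Lambda> / \<delta>" using \<Lambda>0 \<omega>(2) by simp
      then have n0: "0 < real n" using n by linarith
      have "\<Lambda> / n < \<delta>" "L / \<omega>0 * (\<Lambda> / n) * A \<le> e"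
        using n n0 \<omega>(2,3) e by (simp_all add: field_simps)
      then have "ennreal \<bar>f (c \<Lambda>) * \<phi> (c \<Lambda>) - f (c 0) * \<phi> (c 0)\<bar> \<le> ?T + ennreal (L / \<omega>0 * (\<Lambda> / n)) * ?A"
        using n0 \<Lambda>0 by (intro bound) auto
      also have "\<dots> \<le> ?T + ennreal e"
        unfolding A(1) using \<open>L / \<omega>0 * (\<Lambda> / n) * A \<le> e\<close> \<omega>(3) L \<Lambda> A(2)
        by (intro add_left_mono) (simp add: ennreal_mult[symmetric] ennreal_leI)
      finally show "ennreal \<bar>f (c \<Lambda>) * \<phi> (c \<Lambda>) - f (c 0) * \<phi> (c 0)\<bar> \<le> ?T + ennreal e" .
    qed
  qed
  then show "ennreal \<bar>f (c \<Lambda>) * \<phi> (c \<Lambda>) - f (c 0) * \<phi> (c 0)\<bar> \<le>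
    (\<integral>\<^sup>+ \<tau> \<in> {0..\<Lambda>}. g (c \<tau>) * ennreal (\<omega> (c \<tau>)) + h (c \<tau>) * ennreal (l (c \<tau>)) \<partial>lborel)"
    by (simp add: G_def H_def)
qed

section \<open>Doubling measures, nets and bounded overlap\<close>

text \<open>
  The three ways in which sums over balls are compared with integrals: from above by bounded
  overlap, from below by a finite cover, and for infinite covers by exhaustion.
\<close>

lemma nn_integral_overlap_le:
  assumes "finite J" "\<And>j. j \<in> J \<Longrightarrow> A j \<in> sets N" "\<And>j. j \<in> J \<Longrightarrow> A j \<subseteq> U" "U \<in> sets N"
    and w: "w \<in> borel_measurable N" and card: "\<And>x. card {j \<in> J. x \<in> A j} \<le> n"
  shows "(\<Sum>j\<in>J. \<integral>\<^sup>+ x \<in> A j. w x \<partial>N) \<le> of_nat n * (\<integral>\<^sup>+ x \<in> U. w x \<partial>N)"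
proof -
  have "(\<Sum>j\<in>J. \<integral>\<^sup>+ x \<in> A j. w x \<partial>N) = (\<integral>\<^sup>+ x. (\<Sum>j\<in>J. w x * indicator (A j) x) \<partial>N)"
    using assms by (intro nn_integral_sum[symmetric]) auto
  also have "\<dots> \<le> (\<integral>\<^sup>+ x. of_nat n * (w x * indicator U x) \<partial>N)"
  proof (rule nn_integral_mono)
    fix x
    have "(\<Sum>j\<in>J. w x * indicator (A j) x) = (\<Sum>j\<in>J. if x \<in> A j then w x * indicator U x else 0)"
      using assms(3) by (intro sum.cong) (auto simp: indicator_def)
    also have "\<dots> = of_nat (card {j \<in> J. x \<in> A j}) * (w x * indicator U x)"
      using assms(1) by (subst sum.inter_filter[symmetric]) auto
    also have "\<dots> \<le> of_nat n * (w x * indicator U x)"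
      using card[of x] by (intro mult_right_mono) auto
    finally show "(\<Sum>j\<in>J. w x * indicator (A j) x) \<le> of_nat n * (w x * indicator U x)" .
  qed
  also have "\<dots> = of_nat n * (\<integral>\<^sup>+ x \<in> U. w x \<partial>N)"
    using assms by (intro nn_integral_cmult) auto
  finally show ?thesis .
qed

lemma nn_integral_subcover_le:
  assumes "finite J" "\<And>j. j \<in> J \<Longrightarrow> A j \<in> sets N" "B \<subseteq> (\<Union>j\<in>J. A j)" "w \<in> borel_measurable N"
  shows "(\<integral>\<^sup>+ x \<in> B. w x \<partial>N) \<le> (\<Sum>j\<in>J. \<integral>\<^sup>+ x \<in> A j. w x \<partial>N)"
proof -
  have "(\<integral>\<^sup>+ x \<in> B. w x \<partial>N) \<le> (\<integral>\<^sup>+ x. (\<Sum>j\<in>J. w x * indicator (A j) x) \<partial>N)"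
  proof (rule nn_integral_mono)
    fix x
    show "w x * indicator B x \<le> (\<Sum>j\<in>J. w x * indicator (A j) x)"
    proof (cases "x \<in> B")
      case True
      then obtain j where "j \<in> J" "x \<in> A j" using assms(3) by auto
      then have "w x * indicator B x = w x * indicator (A j) x" using True by simp
      also have "\<dots> \<le> (\<Sum>j\<in>J. w x * indicator (A j) x)" by (rule member_le_sum) (use \<open>j \<in> J\<close> assms in auto)
      finally show ?thesis .
    qed simp
  qed
  also have "\<dots> = (\<Sum>j\<in>J. \<integral>\<^sup>+ x \<in> A j. w x \<partial>N)"
    using assms by (intro nn_integral_sum) auto
  finally show ?thesis .
qed

lemma nn_integral_exhaust_le:
  assumes "A \<in> sets N" "\<And>n::nat. B n \<in> sets N" "incseq B" "A \<subseteq> (\<Union>n. B n)" "w \<in> borel_measurable N"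
    and le: "\<And>n. (\<integral>\<^sup>+ x \<in> A \<inter> B n. w x \<partial>N) \<le> c"
  shows "(\<integral>\<^sup>+ x \<in> A. w x \<partial>N) \<le> c"
proof -
  have "w x * indicator A x = (SUP n. w x * indicator (A \<inter> B n) x)" for x
  proof (cases "x \<in> A")
    case True
    then obtain n where n: "x \<in> B n" using assms(4) by auto
    show ?thesis
      by (rule antisym, rule SUP_upper2[of n]) (use True n in \<open>auto simp: indicator_def intro!: SUP_least\<close>)
  qed simp
  then have "(\<integral>\<^sup>+ x \<in> A. w x \<partial>N) = (\<integral>\<^sup>+ x. (SUP n. w x * indicator (A \<inter> B n) x) \<partial>N)" by simp
  also have "\<dots> = (SUP n. \<integral>\<^sup>+ x \<in> A \<inter> B n. w x \<partial>N)"
  proof (rule nn_integral_monotone_convergence_SUP)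
    show "incseq (\<lambda>n x. w x * indicator (A \<inter> B n) x)"
      using assms(3) by (fastforce simp: incseq_def le_fun_def indicator_def)
    show "(\<lambda>x. w x * indicator (A \<inter> B n) x) \<in> borel_measurable N" for n
      using assms by (intro borel_measurable_times_ennreal borel_measurable_indicator) auto
  qed
  also have "\<dots> \<le> c" by (intro SUP_least le)
  finally show ?thesis .
qed

lemma ball_subset_ballI: "s + dist x y \<le> R \<Longrightarrow> ball y s \<subseteq> ball x R"
  for x y :: "'a::metric_space"
proof
  fix z assume "s + dist x y \<le> R" "z \<in> ball y s"
  then show "z \<in> ball x R" using dist_triangle[of x z y] by simp
qed

lemma exists_maximal_separated:
  fixes Z :: "'a::metric_space set"
  assumes "0 < r"
  obtains S where "S \<subseteq> Z" "Z \<subseteq> (\<Union>x\<in>S. ball x r)" "\<And>y z. y \<in> S \<Longrightarrow> z \<in> S \<Longrightarrow> y \<noteq> z \<Longrightarrow> r \<le> dist y z"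
proof -
  define \<A> where "\<A> = {S. S \<subseteq> Z \<and> (\<forall>y\<in>S. \<forall>z\<in>S. y \<noteq> z \<longrightarrow> r \<le> dist y z)}"
  have "\<exists>U\<in>\<A>. \<forall>X\<in>C. X \<subseteq> U" if C: "subset.chain \<A> C" for C
  proof (intro bexI[of _ "\<Union>C"] ballI)
    have C1: "X \<in> \<A>" if "X \<in> C" for X using C that unfolding subset_chain_def by blast
    have "r \<le> dist y z" if yz: "y \<in> \<Union>C" "z \<in> \<Union>C" "y \<noteq> z" for y z
    proof -
      obtain Y W where YW: "Y \<in> C" "W \<in> C" "y \<in> Y" "z \<in> W" using yz by auto
      then have "Y \<subseteq> W \<or> W \<subseteq> Y" using C unfolding subset_chain_def by blast
      then obtain T where "T \<in> C" "y \<in> T" "z \<in> T" using YW by blast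
      then show ?thesis using C1[of T] yz(3) by (simp add: \<A>_def)
    qed
    moreover have "\<Union>C \<subseteq> Z" using C1 by (auto simp: \<A>_def)
    ultimately show "\<Union>C \<in> \<A>" unfolding \<A>_def by blast
  qed auto
  from subset_Zorn[OF this] obtain S where S: "S \<in> \<A>" "\<forall>X\<in>\<A>. S \<subseteq> X \<longrightarrow> X = S" by blast
  have "Z \<subseteq> (\<Union>x\<in>S. ball x r)"
  proof (rule ccontr)
    assume "\<not> ?thesis"
    then obtain z where z: "z \<in> Z" "\<And>x. x \<in> S \<Longrightarrow> r \<le> dist x z" by (force simp: not_less)
    then have "insert z S \<in> \<A>" using S(1) by (simp add: \<A>_def) (metis dist_commute)
    then have "insert z S = S" using S(2) by blast
    then have "z \<in> S" by blast
    then show False using z(2)[of z] assms by simp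
  qed
  with S(1) that[of S] show ?thesis by (simp add: \<A>_def)
qed

locale doubling_space =
  fixes M :: "'a::metric_space measure" and Cd :: real
  assumes sets_M: "sets M = sets borel"
    and emeasure_ball: "0 < r \<Longrightarrow> 0 < emeasure M (ball x r)" "0 < r \<Longrightarrow> emeasure M (ball x r) < \<infinity>"
    and measure_ball_double: "0 < r \<Longrightarrow> measure M (ball x (2 * r)) \<le> Cd * measure M (ball x r)"
begin

lemma space_M [simp]: "space M = UNIV"
  using sets_eq_imp_space_eq[OF sets_M] by simp

lemma borel_in_sets [measurable (raw), simp]: "A \<in> sets borel \<Longrightarrow> A \<in> sets (completion M)" "A \<in> sets borel \<Longrightarrow> A \<in> sets M"
  using sets_M by (auto intro: sets_completionI_sets)

lemma borel_measurable_completionI [measurable (raw)]: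
  "f \<in> borel_measurable borel \<Longrightarrow> f \<in> borel_measurable (completion M)"
  "f \<in> borel_measurable borel \<Longrightarrow> f \<in> borel_measurable M"
proof -
  assume "f \<in> borel_measurable borel"
  then show "f \<in> borel_measurable M" using measurable_cong_sets[OF sets_M refl] by blast
  then show "f \<in> borel_measurable (completion M)" by (rule measurable_completion)
qed

lemma measurable_infdist [measurable]:
  "(\<lambda>y. infdist y F) \<in> borel_measurable (completion M)" "(\<lambda>y. infdist y F) \<in> borel_measurable borel"
proof -
  show "(\<lambda>y. infdist y F) \<in> borel_measurable borel"
    by (intro borel_measurable_continuous_onI continuous_intros)
  then show "(\<lambda>y. infdist y F) \<in> borel_measurable (completion M)" by (rule borel_measurable_completionI)
qed

abbreviation vol :: "'a \<Rightarrow> real \<Rightarrow> real" where "vol x r \<equiv> measure M (ball x r)"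

lemma emeasure_ball_eq: "0 < r \<Longrightarrow> emeasure M (ball x r) = ennreal (vol x r)"
  using emeasure_ball(2)[of r x] by (intro emeasure_eq_ennreal_measure) auto

lemma ball_sets [measurable, simp]: "ball x r \<in> sets (completion M)" "ball x r \<in> sets M"
  by simp_all

lemma emeasure_completion_ball [simp]: "emeasure (completion M) (ball x r) = emeasure M (ball x r)"
  by simp

lemma vol_pos: "0 < r \<Longrightarrow> 0 < vol x r"
  using emeasure_ball(1)[of r x] emeasure_ball_eq[of r x] by (simp add: zero_less_measure_iff)

lemma vol_mono: "ball x r \<subseteq> ball y s \<Longrightarrow> vol x r \<le> vol y s"
proof (cases "0 < s")
  case True
  assume "ball x r \<subseteq> ball y s"
  then show ?thesis using emeasure_ball(2)[OF True, of y] by (intro measure_mono_fmeasurable) (auto simp: fmeasurable_def)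
next
  case False
  assume "ball x r \<subseteq> ball y s"
  moreover have "ball y s = {}" using False by simp
  ultimately have "ball x r = {}" by blast
  then show ?thesis by (metis measure_empty measure_nonneg)
qed

lemma Cd_ge_1: "1 \<le> Cd"
proof -
  fix x :: 'a
  have "1 * vol x 1 \<le> Cd * vol x 1"
    using measure_ball_double[of 1 x] vol_mono[of x 1 x 2] by (simp add: subset_ball)
  then show ?thesis using vol_pos[of 1 x] by (simp del: mult_1)
qed

lemma vol_power_le: "0 < r \<Longrightarrow> vol x (2 ^ n * r) \<le> Cd ^ n * vol x r"
proof (induction n)
  case (Suc n)
  have "vol x (2 ^ Suc n * r) \<le> Cd * vol x (2 ^ n * r)"
    using measure_ball_double[of "2 ^ n * r" x] Suc by (simp add: mult.assoc)
  also have "\<dots> \<le> Cd * (Cd ^ n * vol x r)" using Suc Cd_ge_1 by (intro mult_left_mono) auto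
  finally show ?case by (simp add: mult.assoc)
qed simp

lemma vol_comparable:
  "\<exists>K\<ge>1. \<forall>x y r s. 0 < r \<longrightarrow> s + dist x y \<le> t * r \<longrightarrow> vol y s \<le> K * vol x r"
proof -
  obtain n where n: "t < 2 ^ n" using real_arch_pow[of 2 t] by auto
  show ?thesis
  proof (intro exI[of _ "Cd ^ n"] conjI allI impI)
    show "1 \<le> Cd ^ n" using Cd_ge_1 by simp
    fix x y :: 'a and r s :: real assume r: "0 < r" "s + dist x y \<le> t * r"
    have "t * r \<le> 2 ^ n * r" using n r by (intro mult_right_mono) auto
    then have "vol y s \<le> vol x (2 ^ n * r)"
      using r by (intro vol_mono ball_subset_ballI) linarith
    with vol_power_le[OF r(1)] show "vol y s \<le> Cd ^ n * vol x r" by (meson order_trans)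
  qed
qed

text \<open>
  Disjoint balls of radius \<open>r\<close> with centres in a ball of radius \<open>t r\<close> all have about the volume of
  the large ball.
\<close>

lemma disjoint_balls_card:
  "\<exists>n::nat. \<forall>(S :: 'a set) x r. 0 < r \<longrightarrow> S \<subseteq> ball x (t * r) \<longrightarrow> disjoint_family_on (\<lambda>y. ball y r) S \<longrightarrow>
     finite S \<and> card S \<le> n"
proof -
  obtain K where K: "1 \<le> K" "\<And>x y r s. 0 < r \<Longrightarrow> s + dist x y \<le> (2 * t + 1) * r \<Longrightarrow> vol y s \<le> K * vol x r"
    using vol_comparable[of "2 * t + 1"] by auto
  show ?thesis
  proof (intro exI[of _ "nat \<lceil>K\<rceil>"] allI impI)
    fix S :: "'a set" and x r assume r: "0 < (r::real)" and S: "S \<subseteq> ball x (t * r)" "disjoint_family_on (\<lambda>y. ball y r) S"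
    have bound: "card T \<le> nat \<lceil>K\<rceil>" if T: "finite T" "T \<subseteq> S" for T
    proof (cases "T = {}")
      case False
      let ?V = "vol x ((t + 1) * r)"
      have d: "dist y x < t * r" if "y \<in> T" for y using T S that by (auto simp: dist_commute)
      then have "0 < t * r" using False by (metis all_not_in_conv le_less_trans zero_le_dist)
      then have V: "0 < ?V" using r by (intro vol_pos) (simp add: distrib_right)
      have "real (card T) * (?V / K) = (\<Sum>y\<in>T. ?V / K)" by simp
      also have "\<dots> \<le> (\<Sum>y\<in>T. vol y r)"
      proof (rule sum_mono)
        fix y assume "y \<in> T"
        have "?V \<le> K * vol y r" using d[OF \<open>y \<in> T\<close>] r by (intro K(2)) (auto simp: algebra_simps)
        then show "?V / K \<le> vol y r" using K(1) by (simp add: field_simps)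
      qed
      also have "\<dots> = measure M (\<Union>y\<in>T. ball y r)"
        using T S emeasure_ball(2)[OF r]
        by (intro measure_finite_Union[symmetric]) (auto intro: disjoint_family_on_mono simp: less_top)
      also have "\<dots> \<le> ?V"
      proof (rule measure_mono_fmeasurable)
        show "(\<Union>y\<in>T. ball y r) \<subseteq> ball x ((t + 1) * r)"
        proof
          fix z assume "z \<in> (\<Union>y\<in>T. ball y r)"
          then obtain y where "y \<in> T" "dist y z < r" by auto
          then show "z \<in> ball x ((t + 1) * r)"
            using d[of y] dist_triangle[of x z y] by (auto simp: algebra_simps dist_commute)
        qed
        show "ball x ((t + 1) * r) \<in> fmeasurable M"
          using emeasure_ball(2)[of "(t + 1) * r" x] \<open>0 < t * r\<close> r by (auto simp: fmeasurable_def distrib_right)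
        show "(\<Union>y\<in>T. ball y r) \<in> sets M"
          by (intro borel_in_sets borel_open open_UN) auto
      qed
      finally have "real (card T) * (?V / K) \<le> ?V" .
      then have "real (card T) \<le> K" using V K(1) by (simp add: field_simps)
      then show ?thesis by linarith
    qed simp
    show "finite S \<and> card S \<le> nat \<lceil>K\<rceil>"
      using bound finite_if_finite_subsets_card_bdd[of S "nat \<lceil>K\<rceil>"] by blast
  qed
qed

lemma separated_card:
  "\<exists>n::nat. \<forall>(S :: 'a set) x r. 0 < r \<longrightarrow> S \<subseteq> ball x (t * r) \<longrightarrow> (\<forall>y\<in>S. \<forall>z\<in>S. y \<noteq> z \<longrightarrow> r \<le> dist y z) \<longrightarrow>
     finite S \<and> card S \<le> n"
proof -
  obtain n :: nat where n: "\<And>(S :: 'a set) x r. 0 < r \<Longrightarrow> S \<subseteq> ball x (2 * t * r) \<Longrightarrow> disjoint_family_on (\<lambda>y. ball y r) S \<Longrightarrow>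
     finite S \<and> card S \<le> n"
    using disjoint_balls_card[of "2 * t"] by blast
  show ?thesis
  proof (intro exI[of _ n] allI impI)
    fix S :: "'a set" and x r assume r: "0 < (r::real)" and S: "S \<subseteq> ball x (t * r)" "\<forall>y\<in>S. \<forall>z\<in>S. y \<noteq> z \<longrightarrow> r \<le> dist y z"
    have "disjoint_family_on (\<lambda>y. ball y (r / 2)) S"
      unfolding disjoint_family_on_def
    proof (intro ballI impI)
      fix y z assume "y \<in> S" "z \<in> S" "y \<noteq> z"
      then have "r \<le> dist y z" using S by auto
      then show "ball y (r / 2) \<inter> ball z (r / 2) = {}"
        by (intro disjoint_ballI) auto
    qed
    then show "finite S \<and> card S \<le> n" using S(1) r by (intro n[of "r / 2" S x]) auto
  qed
qed

text \<open>
  A maximal separated set is a net, and doubling bounds the number of its points in a ball.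
\<close>

lemma exists_net:
  "\<exists>n::nat. \<forall>(Z :: 'a set) r. 0 < r \<longrightarrow> (\<exists>S\<subseteq>Z. Z \<subseteq> (\<Union>x\<in>S. ball x r) \<and> (\<forall>x R. finite (S \<inter> ball x R)) \<and>
     (\<forall>y. finite {x\<in>S. y \<in> ball x (t * r)} \<and> card {x\<in>S. y \<in> ball x (t * r)} \<le> n))"
proof -
  obtain n :: nat where n: "\<And>(S :: 'a set) x r. 0 < r \<Longrightarrow> S \<subseteq> ball x (t * r) \<Longrightarrow> (\<forall>y\<in>S. \<forall>z\<in>S. y \<noteq> z \<longrightarrow> r \<le> dist y z) \<Longrightarrow>
     finite S \<and> card S \<le> n"
    using separated_card[of t] by blast
  show ?thesis
  proof (intro exI[of _ n] allI impI)
    fix Z :: "'a set" and r :: real assume r: "0 < r"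
    obtain S where S: "S \<subseteq> Z" "Z \<subseteq> (\<Union>x\<in>S. ball x r)" "\<And>y z. y \<in> S \<Longrightarrow> z \<in> S \<Longrightarrow> y \<noteq> z \<Longrightarrow> r \<le> dist y z"
      using exists_maximal_separated[OF r] by metis
    have "finite (S \<inter> ball x R)" for x R
    proof -
      obtain n where "\<And>(S :: 'a set) x r'. 0 < r' \<Longrightarrow> S \<subseteq> ball x (R / r * r') \<Longrightarrow> (\<forall>y\<in>S. \<forall>z\<in>S. y \<noteq> z \<longrightarrow> r' \<le> dist y z) \<Longrightarrow>
         finite S \<and> card S \<le> (n::nat)"
        using separated_card[of "R / r"] by blast
      from this[of r "S \<inter> ball x R" x] show ?thesis using r S(3) by auto
    qed
    moreover have "finite {x\<in>S. y \<in> ball x (t * r)} \<and> card {x\<in>S. y \<in> ball x (t * r)} \<le> n" for y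
      using S(3) by (intro n[OF r, of _ y]) (auto simp: dist_commute)
    ultimately show "\<exists>S\<subseteq>Z. Z \<subseteq> (\<Union>x\<in>S. ball x r) \<and> (\<forall>x R. finite (S \<inter> ball x R)) \<and>
       (\<forall>y. finite {x\<in>S. y \<in> ball x (t * r)} \<and> card {x\<in>S. y \<in> ball x (t * r)} \<le> n)"
      using S(1,2) by blast
  qed
qed

lemma sum_vol_overlap_le:
  assumes "finite J" "\<And>j. j \<in> J \<Longrightarrow> 0 < \<rho> j" "\<And>j. j \<in> J \<Longrightarrow> ball (z j) (\<rho> j) \<subseteq> ball x R"
    and "\<And>y. card {j \<in> J. y \<in> ball (z j) (\<rho> j)} \<le> n" "0 < R"
  shows "(\<Sum>j\<in>J. vol (z j) (\<rho> j)) \<le> n * vol x R"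
proof -
  have "(\<Sum>j\<in>J. \<integral>\<^sup>+ y \<in> ball (z j) (\<rho> j). 1 \<partial>completion M) \<le> of_nat n * (\<integral>\<^sup>+ y \<in> ball x R. 1 \<partial>completion M)"
    using assms by (intro nn_integral_overlap_le) auto
  then have "(\<Sum>j\<in>J. ennreal (vol (z j) (\<rho> j))) \<le> of_nat n * ennreal (vol x R)"
    using assms by (simp add: emeasure_ball_eq)
  then show ?thesis by (simp add: sum_ennreal ennreal_of_nat_eq_real_of_nat ennreal_mult[symmetric] ennreal_le_iff)
qed

end

section \<open>The strong Poincare inequality\<close>

lemma borel_measurable_epow [measurable (raw)]:
  assumes [measurable]: "g \<in> borel_measurable N"
  shows "(\<lambda>x. epow (g x) p) \<in> borel_measurable N"
  unfolding epow_def by measurable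

lemma epow_mono: "x \<le> y \<Longrightarrow> 0 \<le> p \<Longrightarrow> epow x p \<le> epow y p"
  by (auto simp: epow_def top_unique less_top intro!: ennreal_leI powr_mono2 enn2real_mono)

lemma epow_ennreal: "0 \<le> x \<Longrightarrow> epow (ennreal x) p = ennreal (x powr p)"
  by (simp add: epow_def)

locale poincare_space = doubling_space M Cd for M :: "'a::metric_space measure" and Cd +
  fixes p lam Cp :: real
  assumes p: "1 < p" and lam: "1 \<le> lam" and Cp: "0 < Cp"
    and poincare: "0 < r \<Longrightarrow> upper_gradient M g f \<Longrightarrow>
     (\<integral>\<^sup>+ y \<in> ball x r. e2ennreal \<bar>f y - ereal (ball_average M f (ball x r))\<bar> \<partial>completion M)
        / emeasure M (ball x r)
     \<le> ennreal (Cp * r) *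
       epow ((\<integral>\<^sup>+ y \<in> ball x (lam * r). epow (g y) p \<partial>M) / emeasure M (ball x (lam * r))) (1 / p)"
begin

abbreviation N :: "'a measure" where "N \<equiv> completion M"

text \<open>
  The capacity only tests functions with values in \<open>[0,1]\<close>. Restricting to them makes all means
  finite.
\<close>

definition test_pair :: "('a \<Rightarrow> ennreal) \<Rightarrow> ('a \<Rightarrow> real) \<Rightarrow> bool" where
  "test_pair g f \<longleftrightarrow> f \<in> borel_measurable N \<and> (\<forall>x. 0 \<le> f x \<and> f x \<le> 1) \<and> curve_gradient g f"

lemma test_pairD:
  assumes "test_pair g f"
  shows "f \<in> borel_measurable N" "0 \<le> f x" "f x \<le> 1" "curve_gradient g f" "g \<in> borel_measurable borel"
    "g \<in> borel_measurable N"
  using assms by (auto simp: test_pair_def curve_gradient_def)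

definition energy :: "('a \<Rightarrow> ennreal) \<Rightarrow> 'a set \<Rightarrow> ennreal" where
  "energy g A = (\<integral>\<^sup>+ x \<in> A. epow (g x) p \<partial>N)"

lemma energy_mono: "A \<subseteq> B \<Longrightarrow> energy g A \<le> energy g B"
  unfolding energy_def by (intro nn_integral_mono) (auto simp: indicator_def)

definition ball_mean :: "('a \<Rightarrow> real) \<Rightarrow> 'a \<Rightarrow> real \<Rightarrow> real" where
  "ball_mean f x r = enn2real (\<integral>\<^sup>+ y \<in> ball x r. ennreal (f y) \<partial>N) / vol x r"

lemma nn_integral_ball_le:
  assumes "\<And>y. w y \<le> 1" "0 < r"
  shows "(\<integral>\<^sup>+ y \<in> ball x r. w y \<partial>N) \<le> ennreal (vol x r)"
proof -
  have "(\<integral>\<^sup>+ y \<in> ball x r. w y \<partial>N) \<le> (\<integral>\<^sup>+ y. indicator (ball x r) y \<partial>N)"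
    using assms(1) by (intro nn_integral_mono) (auto simp: indicator_def)
  also have "\<dots> = emeasure M (ball x r)" by (subst nn_integral_indicator) auto
  finally show ?thesis using emeasure_ball_eq[OF assms(2)] by simp
qed

lemma ball_mean_mult_vol:
  assumes "test_pair g f" "0 < r"
  shows "(\<integral>\<^sup>+ y \<in> ball x r. ennreal (f y) \<partial>N) = ennreal (ball_mean f x r * vol x r)"
proof -
  have "(\<integral>\<^sup>+ y \<in> ball x r. ennreal (f y) \<partial>N) \<le> ennreal (vol x r)"
    using test_pairD(3)[OF assms(1)] by (intro nn_integral_ball_le assms) (simp add: ennreal_le_1)
  then have "(\<integral>\<^sup>+ y \<in> ball x r. ennreal (f y) \<partial>N) < \<infinity>" using le_less_trans by fastforce
  then show ?thesis using vol_pos[OF assms(2), of x] by (simp add: ball_mean_def)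
qed

lemma ball_mean_bounds:
  assumes "test_pair g f" "0 < r"
  shows "0 \<le> ball_mean f x r" "ball_mean f x r \<le> 1"
proof -
  show "0 \<le> ball_mean f x r" by (simp add: ball_mean_def)
  have "ennreal (ball_mean f x r * vol x r) \<le> ennreal (vol x r)"
    using test_pairD(3)[OF assms(1)] unfolding ball_mean_mult_vol[OF assms, symmetric]
    by (intro nn_integral_ball_le assms) (simp add: ennreal_le_1)
  then show "ball_mean f x r \<le> 1" using vol_pos[OF assms(2), of x] by (simp add: ennreal_le_iff)
qed

lemma ball_average_eq_ball_mean:
  assumes "test_pair g f" "0 < r"
  shows "ball_average M (\<lambda>x. ereal (f x)) (ball x r) = ball_mean f x r"
proof -
  note [measurable] = test_pairD(1)[OF assms(1)]
  have "(LINT y:ball x r|N. f y) = enn2real (\<integral>\<^sup>+ y. ennreal (indicator (ball x r) y *\<^sub>R f y) \<partial>N)"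
    unfolding set_lebesgue_integral_def
  proof (rule integral_eq_nn_integral)
    show "(\<lambda>y. indicator (ball x r) y *\<^sub>R f y) \<in> borel_measurable N" by measurable
  qed (use test_pairD(2)[OF assms(1)] in \<open>auto simp: indicator_def\<close>)
  also have "(\<integral>\<^sup>+ y. ennreal (indicator (ball x r) y *\<^sub>R f y) \<partial>N) = (\<integral>\<^sup>+ y \<in> ball x r. ennreal (f y) \<partial>N)"
    by (intro nn_integral_cong) (auto simp: indicator_def)
  finally show ?thesis by (simp add: ball_average_def ball_mean_def)
qed

text \<open>
  This is the triangle inequality for integrals, but for nonnegative integrals it has to be obtained
  from one-sided estimates.
\<close>

lemma ball_mean_diff_le:
  assumes f: "test_pair g f" and r: "0 < r"
  shows "ennreal (\<bar>ball_mean f x r - c\<bar> * vol x r) \<le> (\<integral>\<^sup>+ y \<in> ball x r. ennreal \<bar>f y - c\<bar> \<partial>N)"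
proof -
  note [measurable] = test_pairD(1)[OF f]
  let ?D = "\<integral>\<^sup>+ y \<in> ball x r. ennreal \<bar>f y - c\<bar> \<partial>N"
  have c: "(\<integral>\<^sup>+ y \<in> ball x r. ennreal b \<partial>N) = ennreal (b * vol x r)" if "0 \<le> b" for b
    using that by (subst nn_integral_cmult_indicator) (auto simp: emeasure_ball_eq[OF r] ennreal_mult)
  have split: "(\<integral>\<^sup>+ y \<in> ball x r. u y \<partial>N) \<le> (\<integral>\<^sup>+ y \<in> ball x r. v y \<partial>N) + ?D"
    if "\<And>y. u y \<le> v y + ennreal \<bar>f y - c\<bar>" and [measurable]: "v \<in> borel_measurable N" for u v
  proof -
    have "(\<integral>\<^sup>+ y \<in> ball x r. u y \<partial>N) \<le> (\<integral>\<^sup>+ y. v y * indicator (ball x r) y + ennreal \<bar>f y - c\<bar> * indicator (ball x r) y \<partial>N)"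
      using that by (intro nn_integral_mono) (auto simp: indicator_def)
    also have "\<dots> = (\<integral>\<^sup>+ y \<in> ball x r. v y \<partial>N) + ?D" by (intro nn_integral_add) auto
    finally show ?thesis .
  qed
  have fin: "ennreal (b * vol x r - a * vol x r) \<le> ?D" if "ennreal (b * vol x r) \<le> ennreal (a * vol x r) + ?D" "0 \<le> a" for a b
  proof (cases "?D")
    case (real d)
    have nn: "0 \<le> a * vol x r" using that(2) by simp
    have "ennreal (b * vol x r) \<le> ennreal (a * vol x r + d)"
      using that(1) real nn by (simp add: ennreal_plus[symmetric] del: ennreal_plus)
    moreover have "0 \<le> a * vol x r + d" using nn real by simp
    ultimately have "b * vol x r \<le> a * vol x r + d" by (simp only: ennreal_le_iff)
    then show ?thesis unfolding real by (intro ennreal_leI) linarith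
  qed simp
  have mn: "0 \<le> ball_mean f x r" by (rule ball_mean_bounds[OF f r])
  have c0: "ennreal (max 0 c * vol x r) = (\<integral>\<^sup>+ y \<in> ball x r. ennreal (max 0 c) \<partial>N)" by (simp add: c)
  have "ennreal (ball_mean f x r * vol x r - max 0 c * vol x r) \<le> ?D"
  proof (rule fin)
    show "ennreal (ball_mean f x r * vol x r) \<le> ennreal (max 0 c * vol x r) + ?D"
      unfolding c0 ball_mean_mult_vol[OF f r, symmetric]
      by (rule split) (auto simp: ennreal_plus[symmetric] max_def simp del: ennreal_plus intro!: ennreal_leI)
  qed simp
  moreover have "ennreal (max 0 c * vol x r - ball_mean f x r * vol x r) \<le> ?D"
  proof (rule fin[OF _ mn])
    show "ennreal (max 0 c * vol x r) \<le> ennreal (ball_mean f x r * vol x r) + ?D"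
      unfolding c0 ball_mean_mult_vol[OF f r, symmetric]
      using test_pairD(2)[OF f]
      by (intro split) (auto simp: ennreal_plus[symmetric] max_def simp del: ennreal_plus intro!: ennreal_leI)
  qed
  ultimately have pos: "ennreal (\<bar>ball_mean f x r - c\<bar> * vol x r) \<le> ?D" if "0 \<le> c"
    using that vol_pos[OF r, of x]
    by (cases "c \<le> ball_mean f x r") (auto simp: abs_mult algebra_simps)
  show ?thesis
  proof (cases "0 \<le> c")
    case False
    have "ennreal (\<bar>ball_mean f x r - c\<bar> * vol x r) = ennreal (ball_mean f x r * vol x r) + ennreal ((- c) * vol x r)"
    proof -
      have "0 \<le> (- c) * vol x r" using False by (intro mult_nonneg_nonneg) auto
      then show ?thesis
        using False mn by (subst ennreal_plus[symmetric]) (auto simp: algebra_simps)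
    qed
    also have "\<dots> = (\<integral>\<^sup>+ y \<in> ball x r. ennreal (f y) \<partial>N) + (\<integral>\<^sup>+ y \<in> ball x r. ennreal (- c) \<partial>N)"
      using False by (simp add: c ball_mean_mult_vol[OF f r])
    also have "\<dots> = (\<integral>\<^sup>+ y. ennreal (f y) * indicator (ball x r) y + ennreal (- c) * indicator (ball x r) y \<partial>N)"
      by (intro nn_integral_add[symmetric]) auto
    also have "\<dots> \<le> ?D"
      using False test_pairD(2)[OF f]
      by (intro nn_integral_mono) (auto simp: indicator_def ennreal_plus[symmetric] simp del: ennreal_plus intro!: ennreal_leI)
    finally show ?thesis .
  qed (rule pos)
qed

lemma poincare_ball_mean:
  assumes f: "test_pair g f" and r: "0 < r" and E: "energy g (ball x (lam * r)) = ennreal E" "0 \<le> E"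
  shows "(\<integral>\<^sup>+ y \<in> ball x r. ennreal \<bar>f y - ball_mean f x r\<bar> \<partial>N) \<le>
     ennreal (Cp * r * vol x r * (E / vol x (lam * r)) powr (1 / p))"
proof -
  have ug: "upper_gradient M g (\<lambda>x. ereal (f x))"
    using f by (simp add: upper_gradient_real_iff test_pair_def)
  have lr: "0 < lam * r" using lam r by simp
  have E': "(\<integral>\<^sup>+ y \<in> ball x (lam * r). epow (g y) p \<partial>M) = ennreal E"
    using E by (simp add: energy_def nn_integral_completion)
  have "(\<integral>\<^sup>+ y \<in> ball x r. ennreal \<bar>f y - ball_mean f x r\<bar> \<partial>N) / ennreal (vol x r) \<le>
     ennreal (Cp * r) * epow (ennreal E / ennreal (vol x (lam * r))) (1 / p)"
    using poincare[OF r ug, of x]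
    by (simp add: ball_average_eq_ball_mean[OF f r] E' emeasure_ball_eq[OF r] emeasure_ball_eq[OF lr] e2ennreal_ereal)
  also have "ennreal E / ennreal (vol x (lam * r)) = ennreal (E / vol x (lam * r))"
    using vol_pos[OF lr] E(2) by (simp add: divide_ennreal)
  also have "ennreal (Cp * r) * epow \<dots> (1 / p) = ennreal (Cp * r * (E / vol x (lam * r)) powr (1 / p))"
    using vol_pos[OF lr, of x] E(2) Cp r by (simp add: epow_ennreal ennreal_mult)
  finally have "(\<integral>\<^sup>+ y \<in> ball x r. ennreal \<bar>f y - ball_mean f x r\<bar> \<partial>N) / ennreal (vol x r) * ennreal (vol x r) \<le>
     ennreal (Cp * r * (E / vol x (lam * r)) powr (1 / p)) * ennreal (vol x r)"
    by (rule mult_right_mono) simp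
  moreover have "(\<integral>\<^sup>+ y \<in> ball x r. ennreal \<bar>f y - ball_mean f x r\<bar> \<partial>N) / ennreal (vol x r) * ennreal (vol x r) =
      (\<integral>\<^sup>+ y \<in> ball x r. ennreal \<bar>f y - ball_mean f x r\<bar> \<partial>N)"
    using vol_pos[OF r, of x] by (simp add: ennreal_divide_times)
  ultimately have "(\<integral>\<^sup>+ y \<in> ball x r. ennreal \<bar>f y - ball_mean f x r\<bar> \<partial>N) \<le>
     ennreal (vol x r) * ennreal (Cp * r * (E / vol x (lam * r)) powr (1 / p))"
    by (simp add: mult.commute)
  then show ?thesis using vol_pos[OF r, of x] Cp r by (simp add: ennreal_mult[symmetric] mult_ac)
qed

text \<open>
  On the smaller ball \<open>f\<close> is close to both means. This costs the ratio \<open>K\<close> of the volumes.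
\<close>

lemma ball_mean_step:
  assumes f: "test_pair g f" and s: "0 < s" and sub: "ball y s \<subseteq> ball x R" and K: "vol x R \<le> K * vol y s"
    and E: "energy g (ball x (lam * R)) = ennreal E" "0 \<le> E"
  shows "\<bar>ball_mean f y s - ball_mean f x R\<bar> \<le> K * Cp * R * (E / vol x R) powr (1 / p)"
proof -
  have "y \<in> ball y s" using s by simp
  then have "y \<in> ball x R" using sub by blast
  then have R: "0 < R" by (metis zero_le_dist mem_ball le_less_trans)
  have VR: "0 < vol x R" and Vs: "0 < vol y s" using vol_pos R s by auto
  have VR': "vol x R \<le> vol x (lam * R)"
    using lam R by (intro vol_mono subset_ball) (simp add: mult_le_cancel_right1)
  let ?X = "Cp * R * (E / vol x R) powr (1 / p)"
  have X: "0 \<le> ?X" using Cp R by simp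
  have "ennreal (\<bar>ball_mean f y s - ball_mean f x R\<bar> * vol y s) \<le> (\<integral>\<^sup>+ z \<in> ball y s. ennreal \<bar>f z - ball_mean f x R\<bar> \<partial>N)"
    by (rule ball_mean_diff_le[OF f s])
  also have "\<dots> \<le> (\<integral>\<^sup>+ z \<in> ball x R. ennreal \<bar>f z - ball_mean f x R\<bar> \<partial>N)"
    using sub by (intro nn_integral_mono) (auto simp: indicator_def)
  also have "\<dots> \<le> ennreal (Cp * R * vol x R * (E / vol x (lam * R)) powr (1 / p))"
    by (rule poincare_ball_mean[OF f R E])
  also have "\<dots> \<le> ennreal (?X * vol x R)"
  proof (rule ennreal_leI)
    have "(E / vol x (lam * R)) powr (1 / p) \<le> (E / vol x R) powr (1 / p)"
      using E(2) VR VR' p by (intro powr_mono2 divide_left_mono) auto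
    then have "Cp * R * vol x R * (E / vol x (lam * R)) powr (1 / p) \<le> Cp * R * vol x R * (E / vol x R) powr (1 / p)"
      using Cp R VR by (intro mult_left_mono) auto
    then show "Cp * R * vol x R * (E / vol x (lam * R)) powr (1 / p) \<le> ?X * vol x R"
      by (simp add: mult_ac)
  qed
  also have "\<dots> \<le> ennreal (?X * (K * vol y s))"
    by (intro ennreal_leI mult_left_mono K X)
  finally have "\<bar>ball_mean f y s - ball_mean f x R\<bar> * vol y s \<le> ?X * (K * vol y s)"
  proof (subst (asm) ennreal_le_iff)
    have "0 \<le> K * vol y s" using K VR by linarith
    then show "0 \<le> ?X * (K * vol y s)" using X by simp
  qed
  then have "\<bar>ball_mean f y s - ball_mean f x R\<bar> * vol y s \<le> (K * ?X) * vol y s" by (simp only: mult_ac)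
  then have "\<bar>ball_mean f y s - ball_mean f x R\<bar> \<le> K * ?X" using Vs by (simp only: mult_le_cancel_right_pos)
  then show ?thesis by (simp add: mult.assoc)
qed

lemma powr_le_one_plus: "0 \<le> z \<Longrightarrow> z powr (1 / p) \<le> 1 + z"
proof -
  assume z: "0 \<le> z"
  have "z powr (1 / p) \<le> (1 + z) powr (1 / p)" using z p by (intro powr_mono2) auto
  also have "\<dots> \<le> (1 + z) powr 1" using z p by (intro powr_mono) auto
  finally show ?thesis using z by simp
qed

end

context poincare_space begin

lemma powr_le_of_root_bound:
  assumes a: "0 \<le> a" "a \<le> k * R * (E / V) powr (1 / p)" and "0 \<le> k" "0 \<le> R" "0 \<le> E" "0 \<le> V"
  shows "a powr p \<le> k powr p * R powr p * (E / V)"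
proof -
  have "a powr p \<le> (k * R * (E / V) powr (1 / p)) powr p" using a p by (intro powr_mono2) auto
  also have "\<dots> = k powr p * R powr p * (E / V)"
    using assms p by (simp add: powr_mult powr_powr)
  finally show ?thesis .
qed

lemma energy_overlap_le:
  assumes "finite S" "\<And>x. x \<in> S \<Longrightarrow> ball x \<rho> \<subseteq> U" "\<And>y. card {x \<in> S. y \<in> ball x \<rho>} \<le> n"
    "g \<in> borel_measurable borel" "U \<in> sets borel"
  shows "(\<Sum>x\<in>S. energy g (ball x \<rho>)) \<le> of_nat n * energy g U"
proof -
  have [measurable]: "g \<in> borel_measurable N" using assms(4) by simp
  show ?thesis
    unfolding energy_def by (rule nn_integral_overlap_le) (use assms in auto)
qed

text \<open>
  The \<open>(1,p)\<close>-Poincare inequality improves to exponent \<open>p\<close> on the left by chaining through nets at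
  the scales \<open>r / 2\<^sup>k\<close>. Consecutive means near \<open>y\<close> differ by at most a constant times
  \<open>2\<^sup>-\<^sup>k\<^sup>/\<^sup>2 T(y)\<^sup>1\<^sup>/\<^sup>p\<close>, where \<open>T(y)\<close> collects the \<open>p\<close>-energies over the net balls around \<open>y\<close> with
  weights \<open>2\<^sup>k\<^sup>p\<^sup>/\<^sup>2\<close>. By bounded overlap the integral of \<open>T\<close> is a convergent geometric series
  times the energy. That the means converge to \<open>f\<close> in \<open>L\<^sup>1\<close> is again the
  \<open>(1,p)\<close>-inequality, on small balls. The dilation \<open>2 lam\<close>
  is small enough for Whitney balls with \<open>c \<le> 1 / (6 lam)\<close> to stay away from the boundary.
\<close>

lemma poincare_strong:
  "\<exists>C>0. \<forall>f g x0 r. test_pair g f \<longrightarrow> 0 < r \<longrightarrow>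
     (\<integral>\<^sup>+ y \<in> ball x0 r. ennreal (\<bar>f y - ball_mean f x0 r\<bar> powr p) \<partial>N) \<le>
        ennreal (C * r powr p) * energy g (ball x0 (2 * lam * r))"
proof -
  obtain K where K: "1 \<le> K" "\<And>x y r s. 0 < r \<Longrightarrow> s + dist x y \<le> 8 * r \<Longrightarrow> vol y s \<le> K * vol x r"
    using vol_comparable[of 8] by auto
  obtain n0 :: nat where n0: "\<And>(Z :: 'a set) r. 0 < r \<Longrightarrow> (\<exists>S\<subseteq>Z. Z \<subseteq> (\<Union>x\<in>S. ball x r) \<and> (\<forall>x R. finite (S \<inter> ball x R)) \<and>
     (\<forall>y. finite {x\<in>S. y \<in> ball x (2 * lam * r)} \<and> card {x\<in>S. y \<in> ball x (2 * lam * r)} \<le> n0))"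
    using exists_net[of "2 * lam"] by blast
  \<comment> \<open>The net at scale \<open>k = 0\<close> is \<open>{x0}\<close>, with overlap \<open>1\<close>, which \<open>n0\<close> might not bound.\<close>
  define n where "n = Suc n0"
  define K1 where "K1 = 4 * K * Cp"
  have K1: "0 < K1" using K(1) Cp by (simp add: K1_def)
  \<comment> \<open>The ratio of the weighted energies at consecutive scales, and below the corresponding ratio of the increments of the means.\<close>
  define q where "q = 2 powr (- p / 2)"
  have q: "0 < q" "q < 1" using p by (auto simp: q_def powr_less_one)
  define q1 where "q1 = 2 powr (- 1 / 2 :: real)"
  have q1: "0 < q1" "q1 < 1" by (auto simp: q1_def powr_less_one)
  define c1 where "c1 = 1 / (1 - q1)"
  have c1: "0 < c1" using q1 by (simp add: c1_def)
  define C where "C = c1 powr p * (K1 powr p * n / (1 - q))"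
  have C: "0 < C" unfolding C_def using c1 K1 q by (simp add: n_def)
  have main: "(\<integral>\<^sup>+ y \<in> ball x0 r. ennreal (\<bar>f y - ball_mean f x0 r\<bar> powr p) \<partial>N) \<le>
        ennreal (C * r powr p) * energy g (ball x0 (2 * lam * r))"
    if f: "test_pair g f" and r: "0 < r" for f g x0 r
  proof (cases "energy g (ball x0 (2 * lam * r)) = \<infinity>")
    case True
    then show ?thesis using C r by (simp add: ennreal_mult_top)
  next
    case False
    define E0 where "E0 = enn2real (energy g (ball x0 (2 * lam * r)))"
    have E0: "energy g (ball x0 (2 * lam * r)) = ennreal E0" "0 \<le> E0"
      using False by (auto simp: E0_def less_top)
    have sub_fin: "energy g A = ennreal (enn2real (energy g A))" if "A \<subseteq> ball x0 (2 * lam * r)" for A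
      using energy_mono[OF that, of g] False by (auto simp: less_top)
    note [measurable] = test_pairD(1,5)[OF f]
    define \<rho> where "\<rho> k = r / 2 ^ k" for k :: nat
    have \<rho>: "0 < \<rho> k" "\<rho> (Suc k) = \<rho> k / 2" "\<rho> k \<le> r" "\<rho> 0 = r" for k
      using r by (auto simp: \<rho>_def divide_le_eq_1 field_simps mult_le_cancel_left1)
    define P where "P k S \<longleftrightarrow> finite S \<and> S \<subseteq> ball x0 r \<and> ball x0 r \<subseteq> (\<Union>x\<in>S. ball x (\<rho> k)) \<and>
        (\<forall>y. card {x\<in>S. y \<in> ball x (2 * lam * \<rho> k)} \<le> n) \<and> (k = 0 \<longrightarrow> S = {x0})" for k :: nat and S
    have "\<exists>S. P k S" for k
    proof (cases k)
      case 0
      have "card {x \<in> {x0}. y \<in> ball x (2 * lam * \<rho> k)} \<le> card {x0}" for y by (rule card_mono) auto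
      then show ?thesis using 0 r \<rho> by (intro exI[of _ "{x0}"]) (auto simp: P_def n_def intro: le_trans)
    next
      case (Suc j)
      obtain S where S: "S \<subseteq> ball x0 r" "ball x0 r \<subseteq> (\<Union>x\<in>S. ball x (\<rho> k))" "\<And>x R. finite (S \<inter> ball x R)"
        "\<And>y. card {x\<in>S. y \<in> ball x (2 * lam * \<rho> k)} \<le> n0"
        using n0[OF \<rho>(1)[of k], of "ball x0 r"] by blast
      have "finite S" using S(1) S(3)[of x0 r] by (simp add: inf.absorb1)
      then show ?thesis using S Suc by (intro exI[of _ S]) (auto simp: P_def n_def intro: le_SucI)
    qed
    then obtain S where S': "\<And>k. P k (S k)" by metis
    have S: "finite (S k)" "S k \<subseteq> ball x0 r" "ball x0 r \<subseteq> (\<Union>x\<in>S k. ball x (\<rho> k))"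
      "card {x\<in>S k. y \<in> ball x (2 * lam * \<rho> k)} \<le> n" "S 0 = {x0}" for k y
      using S'[of k] S'[of 0] unfolding P_def by simp_all
    have sub2: "ball x (2 * lam * \<rho> k) \<subseteq> ball x0 (2 * lam * r)" if "x \<in> S k" for x k
    proof (cases k)
      case 0 then show ?thesis using that S(5) \<rho>(4) by auto
    next
      case (Suc j)
      have "2 * \<rho> k \<le> r" using \<rho>(2,3)[of j] Suc by simp
      then have "lam * (2 * \<rho> k) \<le> lam * r" using lam by (intro mult_left_mono) auto
      moreover have "1 * r \<le> lam * r" using lam r by (intro mult_right_mono) auto
      moreover have "dist x0 x < r" using subsetD[OF S(2) that] by simp
      ultimately show ?thesis by (intro ball_subset_ballI) (simp add: algebra_simps)
    qed
    have sub1: "ball x (\<rho> k) \<subseteq> ball x (lam * \<rho> k)" "ball x (lam * \<rho> k) \<subseteq> ball x (2 * lam * \<rho> k)" for x k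
      using lam \<rho>(1)[of k] by (auto intro!: subset_ball simp: mult_le_cancel_right1)
    have card1: "card {x\<in>S k. y \<in> ball x (\<rho> k)} \<le> n" "card {x\<in>S k. y \<in> ball x (lam * \<rho> k)} \<le> n" for k y
    proof -
      have "card {x\<in>S k. y \<in> ball x (\<rho> k)} \<le> card {x\<in>S k. y \<in> ball x (2 * lam * \<rho> k)}"
      proof (rule card_mono)
        show "{x\<in>S k. y \<in> ball x (\<rho> k)} \<subseteq> {x\<in>S k. y \<in> ball x (2 * lam * \<rho> k)}"
          using sub1[of _ k] by blast
      qed (simp add: S(1))
      moreover have "card {x\<in>S k. y \<in> ball x (lam * \<rho> k)} \<le> card {x\<in>S k. y \<in> ball x (2 * lam * \<rho> k)}"
      proof (rule card_mono)
        show "{x\<in>S k. y \<in> ball x (lam * \<rho> k)} \<subseteq> {x\<in>S k. y \<in> ball x (2 * lam * \<rho> k)}"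
          using sub1(2)[of _ k] by blast
      qed (simp add: S(1))
      ultimately show "card {x\<in>S k. y \<in> ball x (\<rho> k)} \<le> n" "card {x\<in>S k. y \<in> ball x (lam * \<rho> k)} \<le> n"
        using S(4)[of k y] by auto
    qed
    define e where "e x k = enn2real (energy g (ball x (2 * lam * \<rho> k)))" for x k
    have e: "energy g (ball x (2 * lam * \<rho> k)) = ennreal (e x k)" if "x \<in> S k" for x k
      using sub_fin[OF sub2[OF that]] by (simp add: e_def)
    have e0: "0 \<le> e x k" for x k by (simp add: e_def)
    have e_sum: "(\<Sum>x\<in>S k. e x k) \<le> n * E0" for k
    proof -
      have "(\<Sum>x\<in>S k. energy g (ball x (2 * lam * \<rho> k))) \<le> of_nat n * energy g (ball x0 (2 * lam * r))"
        using S(1,4) sub2 by (intro energy_overlap_le) auto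
      then have "(\<Sum>x\<in>S k. ennreal (e x k)) \<le> of_nat n * ennreal E0"
        using e by (simp add: E0(1))
      then show ?thesis using e0 E0(2)
        by (simp add: sum_ennreal ennreal_of_nat_eq_real_of_nat ennreal_mult[symmetric] ennreal_le_iff)
    qed
    \<comment> \<open>Both means are compared with the mean over the ball of radius \<open>2 \<rho> k\<close> around \<open>x\<close>.\<close>
    have step: "\<bar>ball_mean f x (\<rho> k) - ball_mean f x' (\<rho> (Suc k))\<bar> powr p \<le> K1 powr p * \<rho> k powr p * (e x k / vol x (\<rho> k))"
      if x: "x \<in> S k" and d: "dist x x' < \<rho> k + \<rho> (Suc k)" for x x' k
    proof -
      let ?R = "2 * \<rho> k"
      have E: "energy g (ball x (lam * ?R)) = ennreal (e x k)" using e[OF x] by (simp add: mult_ac)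
      have R: "0 < ?R" using \<rho>(1) by simp
      have "\<bar>ball_mean f x (\<rho> k) - ball_mean f x ?R\<bar> \<le> K * Cp * ?R * (e x k / vol x ?R) powr (1 / p)"
        using \<rho>(1)[of k] by (intro ball_mean_step[OF f _ _ _ E e0] K subset_ball) auto
      moreover have "\<bar>ball_mean f x' (\<rho> (Suc k)) - ball_mean f x ?R\<bar> \<le> K * Cp * ?R * (e x k / vol x ?R) powr (1 / p)"
        using \<rho>(1)[of k] d \<rho>(2)[of k]
        by (intro ball_mean_step[OF f _ _ _ E e0] K ball_subset_ballI) (auto simp: dist_commute)
      ultimately have "\<bar>ball_mean f x (\<rho> k) - ball_mean f x' (\<rho> (Suc k))\<bar> \<le> 2 * (K * Cp * ?R * (e x k / vol x ?R) powr (1 / p))"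
        by linarith
      also have "\<dots> = K1 * \<rho> k * (e x k / vol x ?R) powr (1 / p)" by (simp add: K1_def)
      finally have le: "\<bar>ball_mean f x (\<rho> k) - ball_mean f x' (\<rho> (Suc k))\<bar> \<le> K1 * \<rho> k * (e x k / vol x ?R) powr (1 / p)" .
      have "vol x (\<rho> k) \<le> vol x ?R" by (intro vol_mono subset_ball) (use \<rho>(1)[of k] in simp)
      then have "K1 * \<rho> k * (e x k / vol x ?R) powr (1 / p) \<le> K1 * \<rho> k * (e x k / vol x (\<rho> k)) powr (1 / p)"
        using vol_pos[OF \<rho>(1), of x k] vol_pos[OF R, of x] \<rho>(1)[of k] K1 p e0
        by (intro mult_left_mono powr_mono2 divide_left_mono) auto
      with le have "\<bar>ball_mean f x (\<rho> k) - ball_mean f x' (\<rho> (Suc k))\<bar> \<le> K1 * \<rho> k * (e x k / vol x (\<rho> k)) powr (1 / p)"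
        by linarith
      then show ?thesis
        using K1 \<rho>(1)[of k] e0 by (intro powr_le_of_root_bound) auto
    qed
    \<comment> \<open>This sum dominates the \<open>p\<close>-th power of the \<open>k\<close>-th increment, whichever net points near \<open>y\<close> are chosen.\<close>
    define \<Theta> where "\<Theta> k y = (\<Sum>x\<in>S k. ennreal (K1 powr p * \<rho> k powr p * (e x k / vol x (\<rho> k))) * indicator (ball x (\<rho> k)) y)"
      for k y
    have [measurable]: "\<Theta> k \<in> borel_measurable N" for k unfolding \<Theta>_def by measurable
    define T where "T y = (\<Sum>k. ennreal ((1 / q) ^ k) * \<Theta> k y)" for y
    have [measurable]: "T \<in> borel_measurable N" unfolding T_def by measurable
    have int_\<Theta>: "(\<integral>\<^sup>+ y. \<Theta> k y \<partial>N) \<le> ennreal (K1 powr p * \<rho> k powr p * (n * E0))" for k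
    proof -
      have "(\<integral>\<^sup>+ y. \<Theta> k y \<partial>N) = (\<Sum>x\<in>S k. ennreal (K1 powr p * \<rho> k powr p * (e x k / vol x (\<rho> k))) * ennreal (vol x (\<rho> k)))"
        unfolding \<Theta>_def by (simp add: nn_integral_sum nn_integral_cmult_indicator emeasure_ball_eq[OF \<rho>(1)])
      also have "\<dots> = (\<Sum>x\<in>S k. ennreal (K1 powr p * \<rho> k powr p * e x k))"
        using vol_pos[OF \<rho>(1)] e0 by (intro sum.cong) (auto simp: ennreal_mult[symmetric] less_imp_neq[symmetric])
      also have "\<dots> = ennreal (K1 powr p * \<rho> k powr p * (\<Sum>x\<in>S k. e x k))"
        using e0 by (simp add: sum_ennreal sum_distrib_left)
      also have "\<dots> \<le> ennreal (K1 powr p * \<rho> k powr p * (n * E0))"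
        by (intro ennreal_leI mult_left_mono e_sum) auto
      finally show ?thesis .
    qed
    have \<rho>p: "(1 / q) ^ k * \<rho> k powr p = r powr p * q ^ k" for k
    proof -
      have "(2 ^ k) powr p = 2 powr (k * p)" by (simp add: powr_realpow[symmetric] powr_powr)
      moreover have "q ^ k = 2 powr (- p / 2 * k)" by (simp add: q_def powr_power mult.commute)
      ultimately have "(2 ^ k) powr p * q ^ k * q ^ k = 1" by (simp add: powr_add[symmetric] field_simps)
      then show ?thesis using q r by (simp add: \<rho>_def powr_divide field_simps)
    qed
    have int_T: "(\<integral>\<^sup>+ y. T y \<partial>N) \<le> ennreal (K1 powr p * r powr p * (n * E0) * (1 / (1 - q)))"
    proof -
      have "(\<integral>\<^sup>+ y. T y \<partial>N) = (\<Sum>k. ennreal ((1 / q) ^ k) * (\<integral>\<^sup>+ y. \<Theta> k y \<partial>N))"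
        unfolding T_def by (simp add: nn_integral_suminf nn_integral_cmult)
      also have "\<dots> \<le> (\<Sum>k. ennreal (K1 powr p * r powr p * (n * E0) * q ^ k))"
      proof (intro suminf_le)
        fix k
        have "ennreal ((1 / q) ^ k) * (\<integral>\<^sup>+ y. \<Theta> k y \<partial>N) \<le> ennreal ((1 / q) ^ k) * ennreal (K1 powr p * \<rho> k powr p * (n * E0))"
          by (intro mult_left_mono int_\<Theta>) auto
        also have "\<dots> = ennreal (K1 powr p * (n * E0) * ((1 / q) ^ k * \<rho> k powr p))"
          using q E0 by (simp add: ennreal_mult[symmetric] mult_ac)
        also have "\<dots> = ennreal (K1 powr p * r powr p * (n * E0) * q ^ k)" unfolding \<rho>p by (simp add: mult_ac)
        finally show "ennreal ((1 / q) ^ k) * (\<integral>\<^sup>+ y. \<Theta> k y \<partial>N) \<le> ennreal (K1 powr p * r powr p * (n * E0) * q ^ k)" .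
      qed auto
      also have "\<dots> = ennreal (\<Sum>k. K1 powr p * r powr p * (n * E0) * q ^ k)"
        using q E0 by (intro suminf_ennreal2 summable_mult summable_geometric) auto
      also have "(\<Sum>k. K1 powr p * r powr p * (n * E0) * q ^ k) = K1 powr p * r powr p * (n * E0) * (1 / (1 - q))"
        using q by (subst suminf_mult) (auto simp: suminf_geometric summable_geometric)
      finally show ?thesis .
    qed
    \<comment> \<open>The error after finitely many steps of the chain; its integral tends to \<open>0\<close>.\<close>
    define \<Psi> where "\<Psi> k y = (\<Sum>x\<in>S k. ennreal \<bar>f y - ball_mean f x (\<rho> k)\<bar> * indicator (ball x (\<rho> k)) y)" for k y
    have [measurable]: "\<Psi> k \<in> borel_measurable N" for k unfolding \<Psi>_def by measurable
    have tele: "ennreal (\<bar>f y - ball_mean f x0 r\<bar> - c1 * enn2real (T y) powr (1 / p)) \<le> \<Psi> m y"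
      if y: "y \<in> ball x0 r" and fin: "T y \<noteq> \<infinity>" for y m
    proof -
      have "\<forall>k. \<exists>x. x \<in> S k \<and> y \<in> ball x (\<rho> k)" using S(3) y by blast
      then obtain x where x: "\<And>k. x k \<in> S k" "\<And>k. y \<in> ball (x k) (\<rho> k)" by metis
      define t where "t = enn2real (T y)"
      have t: "T y = ennreal t" "0 \<le> t" using fin by (auto simp: t_def less_top)
      let ?a = "\<lambda>k. ball_mean f (x k) (\<rho> k)"
      have st: "\<bar>?a k - ?a (Suc k)\<bar> \<le> q1 ^ k * t powr (1 / p)" for k
      proof -
        have "dist (x k) (x (Suc k)) < \<rho> k + \<rho> (Suc k)"
          using x(2)[of k] x(2)[of "Suc k"] dist_triangle[of "x k" "x (Suc k)" y] by (auto simp: dist_commute)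
        from step[OF x(1) this] have "ennreal (\<bar>?a k - ?a (Suc k)\<bar> powr p) \<le>
            ennreal (K1 powr p * \<rho> k powr p * (e (x k) k / vol (x k) (\<rho> k))) * indicator (ball (x k) (\<rho> k)) y"
          using x(2)[of k] by (simp add: ennreal_leI)
        also have "\<dots> \<le> \<Theta> k y" unfolding \<Theta>_def
          by (rule member_le_sum[OF x(1)]) (auto simp: S(1))
        finally have "ennreal ((1 / q) ^ k) * ennreal (\<bar>?a k - ?a (Suc k)\<bar> powr p) \<le> ennreal ((1 / q) ^ k) * \<Theta> k y"
          by (rule mult_left_mono) simp
        also have "\<dots> = (\<Sum>i\<in>{k}. ennreal ((1 / q) ^ i) * \<Theta> i y)" by simp
        also have "\<dots> \<le> T y" unfolding T_def by (rule sum_le_suminf) auto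
        finally have "ennreal ((1 / q) ^ k * \<bar>?a k - ?a (Suc k)\<bar> powr p) \<le> ennreal t"
          using q t(1) by (simp add: ennreal_mult)
        then have "(1 / q) ^ k * \<bar>?a k - ?a (Suc k)\<bar> powr p \<le> t"
          using t(2) by (simp only: ennreal_le_iff)
        then have "\<bar>?a k - ?a (Suc k)\<bar> powr p \<le> q ^ k * t" using q by (simp add: field_simps)
        then have "(\<bar>?a k - ?a (Suc k)\<bar> powr p) powr (1 / p) \<le> (q ^ k * t) powr (1 / p)"
          using p by (intro powr_mono2) auto
        also have "\<dots> = (q ^ k) powr (1 / p) * t powr (1 / p)" using q t by (simp add: powr_mult)
        also have "(q ^ k) powr (1 / p) = q1 ^ k"
          using p by (simp add: q_def q1_def powr_power powr_powr)
        finally show ?thesis using p by (simp add: powr_powr)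
      qed
      have "\<bar>?a 0 - ?a m\<bar> \<le> (\<Sum>k<m. q1 ^ k) * t powr (1 / p)" for m
      proof (induction m)
        case (Suc m)
        then show ?case using st[of m] by (simp add: distrib_right)
      qed simp
      also have "(\<Sum>k<m. q1 ^ k) * t powr (1 / p) \<le> c1 * t powr (1 / p)" for m
      proof (intro mult_right_mono)
        have "(\<Sum>k<m. q1 ^ k) \<le> (\<Sum>k. q1 ^ k)" using q1 by (intro sum_le_suminf summable_geometric) auto
        then show "(\<Sum>k<m. q1 ^ k) \<le> c1" using q1 by (simp add: suminf_geometric c1_def)
      qed auto
      finally have "\<bar>?a 0 - ?a m\<bar> \<le> c1 * t powr (1 / p)" .
      moreover have "?a 0 = ball_mean f x0 r" using x(1)[of 0] S(5) \<rho>(4) by simp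
      ultimately have "ennreal (\<bar>f y - ball_mean f x0 r\<bar> - c1 * t powr (1 / p)) \<le> ennreal \<bar>f y - ?a m\<bar>"
        by (intro ennreal_leI) linarith
      also have "\<dots> = ennreal \<bar>f y - ?a m\<bar> * indicator (ball (x m) (\<rho> m)) y" using x(2)[of m] by simp
      also have "\<dots> \<le> \<Psi> m y" unfolding \<Psi>_def by (rule member_le_sum[OF x(1)]) (auto simp: S(1))
      finally show ?thesis by (simp add: t_def)
    qed
    have int_\<Psi>: "(\<integral>\<^sup>+ y. \<Psi> k y \<partial>N) \<le> ennreal (Cp * r * n * (vol x0 (2 * lam * r) + E0) / 2 ^ k)" for k
    proof -
      have "(\<integral>\<^sup>+ y. \<Psi> k y \<partial>N) = (\<Sum>x\<in>S k. \<integral>\<^sup>+ y \<in> ball x (\<rho> k). ennreal \<bar>f y - ball_mean f x (\<rho> k)\<bar> \<partial>N)"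
        unfolding \<Psi>_def by (intro nn_integral_sum) auto
      also have "\<dots> \<le> (\<Sum>x\<in>S k. ennreal (Cp * \<rho> k * (vol x (\<rho> k) + e x k)))"
      proof (rule sum_mono)
        fix x assume x: "x \<in> S k"
        define E where "E = enn2real (energy g (ball x (lam * \<rho> k)))"
        have E: "energy g (ball x (lam * \<rho> k)) = ennreal E" "0 \<le> E"
          using sub_fin[of "ball x (lam * \<rho> k)"] sub2[OF x] sub1(2)[of x k] by (auto simp: E_def)
        have "ennreal E \<le> ennreal (e x k)" unfolding E(1)[symmetric] e[OF x, symmetric] by (rule energy_mono[OF sub1(2)])
        then have Ee: "E \<le> e x k" using e0 by simp
        have V: "0 < vol x (\<rho> k)" "vol x (\<rho> k) \<le> vol x (lam * \<rho> k)"
          using vol_pos[OF \<rho>(1)] vol_mono[OF sub1(1)] by auto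
        \<comment> \<open>A crude bound on the root suffices here, because of the factor \<open>\<rho> k\<close>.\<close>
        have "(E / vol x (lam * \<rho> k)) powr (1 / p) \<le> 1 + E / vol x (lam * \<rho> k)"
          using E(2) V by (intro powr_le_one_plus) auto
        also have "\<dots> \<le> 1 + e x k / vol x (\<rho> k)"
          using E(2) V Ee by (intro add_left_mono frac_le) auto
        finally have "vol x (\<rho> k) * (E / vol x (lam * \<rho> k)) powr (1 / p) \<le> vol x (\<rho> k) * (1 + e x k / vol x (\<rho> k))"
          using V by (intro mult_left_mono) auto
        also have "\<dots> = vol x (\<rho> k) + e x k" using V by (simp add: field_simps)
        finally have "Cp * \<rho> k * (vol x (\<rho> k) * (E / vol x (lam * \<rho> k)) powr (1 / p)) \<le> Cp * \<rho> k * (vol x (\<rho> k) + e x k)"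
          using Cp \<rho>(1)[of k] by (intro mult_left_mono) auto
        with poincare_ball_mean[OF f \<rho>(1) E]
        show "(\<integral>\<^sup>+ y \<in> ball x (\<rho> k). ennreal \<bar>f y - ball_mean f x (\<rho> k)\<bar> \<partial>N) \<le> ennreal (Cp * \<rho> k * (vol x (\<rho> k) + e x k))"
          by (simp add: mult.assoc) (meson ennreal_leI order_trans)
      qed
      also have "\<dots> = ennreal (Cp * \<rho> k * ((\<Sum>x\<in>S k. vol x (\<rho> k)) + (\<Sum>x\<in>S k. e x k)))"
        using Cp \<rho>(1)[of k] e0 by (subst sum_ennreal) (auto simp: sum_distrib_left sum.distrib distrib_left)
      also have "\<dots> \<le> ennreal (Cp * \<rho> k * (n * vol x0 (2 * lam * r) + n * E0))"
      proof (intro ennreal_leI mult_left_mono add_mono e_sum)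
        show "(\<Sum>x\<in>S k. vol x (\<rho> k)) \<le> n * vol x0 (2 * lam * r)"
        proof (rule sum_vol_overlap_le)
          show "ball x (\<rho> k) \<subseteq> ball x0 (2 * lam * r)" if "x \<in> S k" for x
            using sub1[of x k] sub2[OF that] by (rule order_trans[OF order_trans])
        qed (use S(1) card1(1) \<rho>(1) r lam in auto)
      qed (use Cp \<rho>(1)[of k] in auto)
      also have "Cp * \<rho> k * (n * vol x0 (2 * lam * r) + n * E0) = Cp * r * n * (vol x0 (2 * lam * r) + E0) / 2 ^ k"
        by (simp add: \<rho>_def field_simps)
      finally show ?thesis .
    qed
    let ?B = "{y \<in> ball x0 r. T y \<noteq> \<infinity>}"
    let ?h = "\<lambda>y. ennreal (\<bar>f y - ball_mean f x0 r\<bar> - c1 * enn2real (T y) powr (1 / p))"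
    have "(\<integral>\<^sup>+ y. ?h y * indicator ?B y \<partial>N) = 0"
    proof -
      have "(\<lambda>k. ennreal (Cp * r * n * (vol x0 (2 * lam * r) + E0) * (1 / 2) ^ k)) \<longlonglongrightarrow>
         ennreal (Cp * r * n * (vol x0 (2 * lam * r) + E0) * 0)"
        by (intro tendsto_ennrealI tendsto_mult tendsto_const LIMSEQ_power_zero) auto
      moreover have "(\<integral>\<^sup>+ y. ?h y * indicator ?B y \<partial>N) \<le> ennreal (Cp * r * n * (vol x0 (2 * lam * r) + E0) * (1 / 2) ^ k)" for k
      proof -
        have "(\<integral>\<^sup>+ y. ?h y * indicator ?B y \<partial>N) \<le> (\<integral>\<^sup>+ y. \<Psi> k y \<partial>N)"
          using tele by (intro nn_integral_mono) (auto simp: indicator_def)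
        also have "\<dots> \<le> ennreal (Cp * r * n * (vol x0 (2 * lam * r) + E0) / 2 ^ k)" by (rule int_\<Psi>)
        also have "Cp * r * n * (vol x0 (2 * lam * r) + E0) / 2 ^ k = Cp * r * n * (vol x0 (2 * lam * r) + E0) * (1 / 2) ^ k"
          by (simp only: power_inverse divide_inverse mult_1)
        finally show ?thesis .
      qed
      ultimately have "(\<integral>\<^sup>+ y. ?h y * indicator ?B y \<partial>N) \<le> ennreal (Cp * r * n * (vol x0 (2 * lam * r) + E0) * 0)"
        by (intro tendsto_lowerbound[of _ _ sequentially]) (auto intro: always_eventually)
      then show ?thesis by simp
    qed
    moreover have "(\<lambda>y. ?h y * indicator ?B y) \<in> borel_measurable N" by measurable
    ultimately have "AE y in N. ?h y * indicator ?B y = 0"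
      using nn_integral_0_iff_AE by blast
    then have "AE y in N. ennreal (\<bar>f y - ball_mean f x0 r\<bar> powr p) * indicator (ball x0 r) y \<le> ennreal (c1 powr p) * T y"
    proof eventually_elim
      case (elim y)
      show ?case
      proof (cases "y \<in> ?B")
        case True
        then have "\<bar>f y - ball_mean f x0 r\<bar> \<le> c1 * enn2real (T y) powr (1 / p)"
          using elim by (simp add: ennreal_eq_0_iff)
        then have "\<bar>f y - ball_mean f x0 r\<bar> powr p \<le> (c1 * enn2real (T y) powr (1 / p)) powr p"
          using p by (intro powr_mono2) auto
        also have "\<dots> = c1 powr p * enn2real (T y)" using c1 p by (simp add: powr_mult powr_powr)
        finally have "ennreal (\<bar>f y - ball_mean f x0 r\<bar> powr p) \<le> ennreal (c1 powr p) * ennreal (enn2real (T y))"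
          by (simp add: ennreal_mult[symmetric] ennreal_leI)
        then show ?thesis using True by (simp add: less_top)
      next
        case False
        then show ?thesis using c1 by (auto simp: ennreal_mult_top indicator_def)
      qed
    qed
    then have "(\<integral>\<^sup>+ y \<in> ball x0 r. ennreal (\<bar>f y - ball_mean f x0 r\<bar> powr p) \<partial>N) \<le> (\<integral>\<^sup>+ y. ennreal (c1 powr p) * T y \<partial>N)"
      by (rule nn_integral_mono_AE)
    also have "\<dots> = ennreal (c1 powr p) * (\<integral>\<^sup>+ y. T y \<partial>N)" by (rule nn_integral_cmult) measurable
    also have "\<dots> \<le> ennreal (c1 powr p) * ennreal (K1 powr p * r powr p * (n * E0) * (1 / (1 - q)))"
      by (intro mult_left_mono int_T) auto
    also have "\<dots> = ennreal (C * r powr p) * energy g (ball x0 (2 * lam * r))"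
      unfolding E0(1) using q E0(2) C by (simp add: ennreal_mult[symmetric] C_def mult_ac)
    finally show ?thesis .
  qed
  show ?thesis using C main by blast
qed

end

section \<open>Test functions and capacity\<close>

lemma epow_add_le:
  assumes "0 < p"
  shows "epow (a + b) p \<le> ennreal (2 powr p) * (epow a p + epow b p)"
proof (cases "a = \<infinity> \<or> b = \<infinity>")
  case True
  then have top: "epow a p + epow b p = \<infinity>" by (auto simp: epow_def)
  show ?thesis unfolding top by (simp add: ennreal_mult_top)
next
  case False
  then obtain x y where xy: "a = ennreal x" "b = ennreal y" "0 \<le> x" "0 \<le> y"
    by (cases a; cases b) auto
  have "(x + y) powr p \<le> (2 * max x y) powr p" using xy assms by (intro powr_mono2) auto
  also have "\<dots> = 2 powr p * (max x y powr p)" using xy by (simp add: powr_mult)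
  also have "\<dots> \<le> 2 powr p * (x powr p + y powr p)"
    by (intro mult_left_mono) (auto simp: max_def)
  finally show ?thesis
    using xy by (simp add: epow_ennreal ennreal_plus[symmetric] ennreal_mult[symmetric] ennreal_leI del: ennreal_plus)
qed

lemma powr_add_le:
  fixes a b :: real
  assumes "0 < p" "0 \<le> a" "0 \<le> b"
  shows "(a + b) powr p \<le> 2 powr p * (a powr p + b powr p)"
proof -
  have "(a + b) powr p \<le> (2 * max a b) powr p" using assms by (intro powr_mono2) auto
  also have "\<dots> = 2 powr p * (max a b powr p)" using assms by (simp add: powr_mult)
  also have "\<dots> \<le> 2 powr p * (a powr p + b powr p)"
    by (intro mult_left_mono) (auto simp: max_def)
  finally show ?thesis .
qed

lemma epow_mult_ennreal: "0 \<le> c \<Longrightarrow> 0 < p \<Longrightarrow> epow (ennreal c * x) p = ennreal (c powr p) * epow x p"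
  by (cases x; cases "c = 0") (auto simp: epow_def ennreal_mult[symmetric] powr_mult ennreal_mult_top ennreal_mult_eq_top_iff)

context poincare_space begin

text \<open>
  Upper gradients are Borel functions, but \<open>f\<close> is only measurable for the completion. In an upper
  gradient of a product, \<open>f\<close> is therefore replaced by a Borel majorant.
\<close>

lemma exists_borel_majorant:
  assumes f: "f \<in> borel_measurable N"
  obtains h where "h \<in> borel_measurable borel" "\<And>x. ennreal (f x) \<le> h x" "AE x in N. h x = ennreal (f x)"
proof -
  have "(\<lambda>x. ennreal (f x)) \<in> borel_measurable N" using f by measurable
  from completion_ex_borel_measurable[OF this]
  obtain u where u: "u \<in> borel_measurable M" "AE x in M. ennreal (f x) = u x" by blast
  from u(2) obtain A where A: "{x \<in> space M. \<not> ennreal (f x) = u x} \<subseteq> A" "emeasure M A = 0" "A \<in> sets M"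
    by (rule AE_E)
  have uA: "ennreal (f x) = u x" if "x \<notin> A" for x using A(1) that by auto
  have [measurable]: "A \<in> sets borel" "u \<in> borel_measurable borel"
    using A(3) u(1) sets_M measurable_cong_sets[OF sets_M refl] by auto
  have null: "A \<in> null_sets N" using A by (intro null_sets_completionI) auto
  show thesis
  proof (rule that[of "\<lambda>x. if x \<in> A then \<infinity> else u x"])
    show "(\<lambda>x. if x \<in> A then \<infinity> else u x) \<in> borel_measurable borel" by measurable
    show "ennreal (f x) \<le> (if x \<in> A then \<infinity> else u x)" for x using uA by auto
    show "AE x in N. (if x \<in> A then \<infinity> else u x) = ennreal (f x)"
      using AE_not_in[OF null] by eventually_elim (use uA in auto)
  qed
qed

definition p_integral :: "('a \<Rightarrow> real) \<Rightarrow> 'a set \<Rightarrow> ennreal" where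
  "p_integral f A = (\<integral>\<^sup>+ x \<in> A. ennreal (f x powr p) \<partial>N)"

lemma p_integral_mono: "(\<And>x. x \<in> A \<Longrightarrow> 0 \<le> f x \<and> f x \<le> h x) \<Longrightarrow> A \<subseteq> B \<Longrightarrow> p_integral f A \<le> p_integral h B"
  unfolding p_integral_def using p
  by (intro nn_integral_mono) (auto simp: indicator_def intro!: ennreal_leI powr_mono2)

lemma p_integral_cmult: "0 \<le> c \<Longrightarrow> (\<And>x. 0 \<le> f x) \<Longrightarrow> f \<in> borel_measurable N \<Longrightarrow> A \<in> sets N \<Longrightarrow>
   p_integral (\<lambda>x. c * f x) A = ennreal (c powr p) * p_integral f A"
  unfolding p_integral_def
  by (subst nn_integral_cmult[symmetric]) (auto simp: powr_mult ennreal_mult mult.assoc)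

lemma p_integral_add_le:
  assumes "\<And>x. 0 \<le> f x" "\<And>x. 0 \<le> h x" and [measurable]: "f \<in> borel_measurable N" "h \<in> borel_measurable N" "A \<in> sets N"
  shows "p_integral (\<lambda>x. f x + h x) A \<le> ennreal (2 powr p) * (p_integral f A + p_integral h A)"
proof -
  have "p_integral (\<lambda>x. f x + h x) A \<le> (\<integral>\<^sup>+ x. ennreal (2 powr p) * (ennreal (f x powr p) * indicator A x + ennreal (h x powr p) * indicator A x) \<partial>N)"
    unfolding p_integral_def
  proof (rule nn_integral_mono)
    fix x
    have "ennreal ((f x + h x) powr p) \<le> ennreal (2 powr p) * (ennreal (f x powr p) + ennreal (h x powr p))"
      using powr_add_le[of p "f x" "h x"] p assms(1,2)
      by (simp add: ennreal_plus[symmetric] ennreal_mult[symmetric] ennreal_leI del: ennreal_plus)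
    then show "ennreal ((f x + h x) powr p) * indicator A x \<le>
      ennreal (2 powr p) * (ennreal (f x powr p) * indicator A x + ennreal (h x powr p) * indicator A x)"
      by (auto simp: indicator_def)
  qed
  also have "\<dots> = ennreal (2 powr p) * (p_integral f A + p_integral h A)"
    unfolding p_integral_def by (simp add: nn_integral_cmult nn_integral_add)
  finally show ?thesis .
qed

text \<open>
  The product rule in the form in which it is used. After exceptional points are discarded, the Borel
  majorant of \<open>f\<close> is \<open>f\<close> itself.
\<close>

lemma test_pair_product:
  assumes f: "test_pair g f"
    and \<phi>: "\<phi> \<in> borel_measurable borel" "\<And>x. 0 \<le> \<phi> x" "\<And>x. \<phi> x \<le> 1"
    and l: "l \<in> borel_measurable borel" "\<And>x. 0 \<le> l x" "\<And>x. l x \<le> L"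
    and \<omega>: "\<omega> \<in> borel_measurable borel" "\<And>x. 0 \<le> \<omega> x" "0 < \<delta>" "0 < \<omega>0"
      "\<And>x z. \<phi> x \<noteq> 0 \<Longrightarrow> dist x z < \<delta> \<Longrightarrow> \<phi> x \<le> \<omega> z \<and> \<omega>0 \<le> \<omega> z"
    and lip: "\<And>x y z. dist x y < \<delta> \<Longrightarrow> dist x z < \<delta> \<Longrightarrow> \<bar>\<phi> x - \<phi> y\<bar> \<le> l z * dist x y"
  obtains g' where "test_pair g' (\<lambda>x. f x * \<phi> x)"
    "AE x in N. epow (g' x) p \<le> ennreal (2 powr p) * (epow (g x) p * ennreal (\<omega> x powr p) + ennreal ((f x * l x) powr p))"
proof -
  obtain h where h: "h \<in> borel_measurable borel" "\<And>x. ennreal (f x) \<le> h x" "AE x in N. h x = ennreal (f x)"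
    using exists_borel_majorant[OF test_pairD(1)[OF f]] by blast
  have c: "curve_gradient (\<lambda>x. g x * ennreal (\<omega> x) + h x * ennreal (l x)) (\<lambda>x. f x * \<phi> x)"
    by (rule curve_gradient_cutoff[OF test_pairD(4)[OF f] _ _ h(1,2) \<phi>(2,3) l \<omega>(1,3,4,5) lip])
      (use test_pairD(2,3)[OF f] in auto)
  show thesis
  proof (rule that)
    have "f x * \<phi> x \<le> 1" for x using test_pairD(2,3)[OF f, of x] \<phi>(2,3)[of x] by (simp add: mult_le_one)
    moreover have "(\<lambda>x. f x * \<phi> x) \<in> borel_measurable N"
      using test_pairD(1)[OF f] borel_measurable_completionI(1)[OF \<phi>(1)] by (rule borel_measurable_times)
    ultimately show "test_pair (\<lambda>x. g x * ennreal (\<omega> x) + h x * ennreal (l x)) (\<lambda>x. f x * \<phi> x)"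
      using c test_pairD(2)[OF f] \<phi>(2) by (simp add: test_pair_def)
    show "AE x in N. epow (g x * ennreal (\<omega> x) + h x * ennreal (l x)) p \<le>
      ennreal (2 powr p) * (epow (g x) p * ennreal (\<omega> x powr p) + ennreal ((f x * l x) powr p))"
      using h(3)
    proof eventually_elim
      case (elim x)
      have 1: "epow (g x * ennreal (\<omega> x)) p = epow (g x) p * ennreal (\<omega> x powr p)"
        using p epow_mult_ennreal[of "\<omega> x" p "g x"] \<omega>(2) by (simp add: mult.commute)
      have 2: "epow (h x * ennreal (l x)) p = ennreal ((f x * l x) powr p)"
        using test_pairD(2)[OF f, of x] l(2)[of x] unfolding elim
        by (simp add: ennreal_mult[symmetric] epow_ennreal)
      show ?case using epow_add_le[of p "g x * ennreal (\<omega> x)" "h x * ennreal (l x)"] p unfolding 1 2 by simp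
    qed
  qed
qed

text \<open>
  This function vanishes off the ball of radius \<open>3 r / 2\<close>. The remaining room up to radius \<open>2 r\<close> is
  what the localisation in the product rule needs.
\<close>

definition ball_cutoff :: "'a \<Rightarrow> real \<Rightarrow> 'a \<Rightarrow> real" where
  "ball_cutoff x r y = max 0 (min 1 (3 - 2 * dist x y / r))"

lemma ball_cutoff_simps:
  assumes "0 < r"
  shows "0 \<le> ball_cutoff x r y" "ball_cutoff x r y \<le> 1" "y \<in> ball x r \<Longrightarrow> ball_cutoff x r y = 1"
    "ball_cutoff x r y \<noteq> 0 \<Longrightarrow> dist x y < 3 / 2 * r"
proof -
  show "0 \<le> ball_cutoff x r y" "ball_cutoff x r y \<le> 1" "y \<in> ball x r \<Longrightarrow> ball_cutoff x r y = 1"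
    using assms by (auto simp: ball_cutoff_def field_simps)
  show "dist x y < 3 / 2 * r" if "ball_cutoff x r y \<noteq> 0"
  proof (rule ccontr)
    assume "\<not> dist x y < 3 / 2 * r"
    then have "3 - 2 * dist x y / r \<le> 0" using assms by (simp add: field_simps)
    then show False using that by (simp add: ball_cutoff_def)
  qed
qed

lemma ball_cutoff_lipschitz:
  assumes "0 < r"
  shows "\<bar>ball_cutoff x r y - ball_cutoff x r z\<bar> \<le> 2 / r * dist y z"
proof -
  have "\<bar>ball_cutoff x r y - ball_cutoff x r z\<bar> \<le> \<bar>(3 - 2 * dist x y / r) - (3 - 2 * dist x z / r)\<bar>"
    unfolding ball_cutoff_def by linarith
  also have "\<dots> = 2 / r * \<bar>dist x y - dist x z\<bar>"
  proof -
    have "(3 - 2 * dist x y / r) - (3 - 2 * dist x z / r) = 2 / r * (dist x z - dist x y)"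
      by (simp add: algebra_simps diff_divide_distrib)
    then show ?thesis using assms by (simp only: abs_mult abs_minus_commute) simp
  qed
  also have "\<dots> \<le> 2 / r * dist y z"
    using abs_dist_diff_le[of y x z] assms by (intro mult_left_mono) (auto simp: dist_commute)
  finally show ?thesis .
qed

lemma test_pair_ball_cutoff:
  assumes f: "test_pair g f" and r: "0 < r"
  obtains g' where "test_pair g' (\<lambda>y. f y * ball_cutoff x r y)"
    "energy g' UNIV \<le> ennreal (2 powr p) * (energy g (ball x (2 * r)) + ennreal ((2 / r) powr p) * p_integral f (ball x (2 * r)))"
proof -
  let ?l = "\<lambda>y. (2 / r) * indicat_real (ball x (2 * r)) y"
  note [measurable] = test_pairD(1,5,6)[OF f]
  have in2: "z \<in> ball x (2 * r)" if "dist y z < r / 4" "dist x y < 7 / 4 * r" for y z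
    using that dist_triangle[of x z y] by simp
  obtain g' where g': "test_pair g' (\<lambda>y. f y * ball_cutoff x r y)"
    "AE y in N. epow (g' y) p \<le> ennreal (2 powr p) * (epow (g y) p * ennreal (indicat_real (ball x (2 * r)) y powr p) + ennreal ((f y * ?l y) powr p))"
  proof (rule test_pair_product[OF f, of "ball_cutoff x r" ?l "2 / r" "indicat_real (ball x (2 * r))" "r / 4" 1])
    show "ball_cutoff x r \<in> borel_measurable borel" unfolding ball_cutoff_def
      using r by (intro borel_measurable_continuous_onI continuous_intros) auto
    show "indicat_real (ball x (2 * r)) \<in> borel_measurable borel"
      by (intro borel_measurable_indicator) auto
    show "?l \<in> borel_measurable borel"
      by (intro borel_measurable_times borel_measurable_const borel_measurable_indicator) auto
    fix y y' z
    show "ball_cutoff x r y \<le> indicat_real (ball x (2 * r)) z \<and> 1 \<le> indicat_real (ball x (2 * r)) z"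
      if "ball_cutoff x r y \<noteq> 0" "dist y z < r / 4"
    proof -
      have "z \<in> ball x (2 * r)"
        using ball_cutoff_simps(4)[OF r that(1)] that(2) r by (intro in2) auto
      then show ?thesis using ball_cutoff_simps(2)[OF r] by simp
    qed
    assume d: "dist y y' < r / 4" "dist y z < r / 4"
    show "\<bar>ball_cutoff x r y - ball_cutoff x r y'\<bar> \<le> ?l z * dist y y'"
    proof (cases "ball_cutoff x r y = 0 \<and> ball_cutoff x r y' = 0")
      case False
      then have "dist x y < 3 / 2 * r \<or> dist x y' < 3 / 2 * r" using ball_cutoff_simps(4)[OF r] by blast
      then have "dist x y < 7 / 4 * r" using d(1) dist_triangle[of x y y'] r by (auto simp: dist_commute)
      then have "z \<in> ball x (2 * r)" using d by (intro in2) auto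
      then show ?thesis using ball_cutoff_lipschitz[OF r, of x y y'] by simp
    qed (use r in simp)
  qed (use r ball_cutoff_simps in \<open>auto simp: indicator_def\<close>)
  have "energy g' UNIV \<le> (\<integral>\<^sup>+ y. ennreal (2 powr p) * (epow (g y) p * indicator (ball x (2 * r)) y + ennreal ((f y * ?l y) powr p)) \<partial>N)"
    unfolding energy_def
  proof (intro nn_integral_mono_AE)
    have ind: "ennreal (indicat_real (ball x (2 * r)) y powr p) = indicator (ball x (2 * r)) y" for y
      using p by (simp add: indicator_def)
    show "AE y in N. epow (g' y) p * indicator UNIV y \<le>
      ennreal (2 powr p) * (epow (g y) p * indicator (ball x (2 * r)) y + ennreal ((f y * ?l y) powr p))"
      using g'(2) unfolding ind by simp
  qed
  also have "\<dots> = ennreal (2 powr p) * (energy g (ball x (2 * r)) + (\<integral>\<^sup>+ y. ennreal ((f y * ?l y) powr p) \<partial>N))"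
    unfolding energy_def by (simp add: nn_integral_cmult nn_integral_add)
  also have "(\<integral>\<^sup>+ y. ennreal ((f y * ?l y) powr p) \<partial>N) = p_integral (\<lambda>y. 2 / r * f y) (ball x (2 * r))"
    unfolding p_integral_def using p by (intro nn_integral_cong) (auto simp: indicator_def mult.commute)
  also have "\<dots> = ennreal ((2 / r) powr p) * p_integral f (ball x (2 * r))"
    using test_pairD[OF f] r by (intro p_integral_cmult) auto
  finally show thesis using g'(1) that by blast
qed

text \<open>
  By this lemma and the next, the capacity is the infimum of the energies of test pairs.
\<close>

lemma cap_le_energy:
  assumes u: "test_pair g u" and "\<And>x. x \<in> E \<Longrightarrow> u x = 1" "\<And>x. x \<notin> \<Omega> \<Longrightarrow> u x = 0" and fin: "p_integral u UNIV < \<infinity>"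
  shows "cap M p E \<Omega> \<le> energy g UNIV"
proof (cases "energy g UNIV = \<infinity>")
  case False
  have ug: "upper_gradient M g (\<lambda>x. ereal (u x))" using u by (simp add: upper_gradient_real_iff test_pair_def)
  have e: "(\<integral>\<^sup>+ x. epow (g x) p \<partial>M) = energy g UNIV" by (simp add: energy_def nn_integral_completion)
  have "(\<integral>\<^sup>+ x. epow (e2ennreal \<bar>ereal (u x)\<bar>) p \<partial>N) = p_integral u UNIV"
    unfolding p_integral_def using test_pairD(2)[OF u]
    by (intro nn_integral_cong) (simp add: e2ennreal_ereal epow_ennreal)
  moreover have "(INF g \<in> {g. upper_gradient M g (\<lambda>x. ereal (u x))}. \<integral>\<^sup>+ x. epow (g x) p \<partial>M) \<le> energy g UNIV"
    unfolding e[symmetric] by (rule INF_lower) (use ug in simp)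
  ultimately have "newton_norm M p (\<lambda>x. ereal (u x)) \<le> epow (p_integral u UNIV + energy g UNIV) (1 / p)"
    unfolding newton_norm_def using p by (intro epow_mono add_mono) auto
  also have "\<dots> < \<infinity>" using fin False by (auto simp: epow_def less_top)
  finally have "(\<lambda>x. ereal (u x)) \<in> newton_space M p"
    using test_pairD(1)[OF u] by (simp add: newton_space_def)
  then show ?thesis unfolding cap_def e[symmetric] using ug assms(2,3) test_pairD(2,3)[OF u]
    by (intro Inf_lower CollectI exI[of _ "\<lambda>x. ereal (u x)"] exI[of _ g]) (auto simp: zero_ereal_def one_ereal_def)
qed simp

lemma cap_greatest:
  assumes "\<And>g u. test_pair g u \<Longrightarrow> (\<And>x. x \<in> E \<Longrightarrow> u x = 1) \<Longrightarrow> (\<And>x. x \<notin> \<Omega> \<Longrightarrow> u x = 0) \<Longrightarrow> p_integral u UNIV < \<infinity> \<Longrightarrow>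
    X \<le> energy g UNIV"
  shows "X \<le> cap M p E \<Omega>"
  unfolding cap_def
proof (rule Inf_greatest, clarify)
  fix u :: "'a \<Rightarrow> ereal" and g
  assume u: "u \<in> newton_space M p" "\<forall>x. x \<notin> \<Omega> \<longrightarrow> u x = 0" "\<forall>x\<in>E. u x = 1" "\<forall>x. 0 \<le> u x \<and> u x \<le> 1" "upper_gradient M g u"
  define f where "f x = real_of_ereal (u x)" for x
  have uf: "u = (\<lambda>x. ereal (f x))"
  proof
    fix x
    have "\<bar>u x\<bar> \<noteq> \<infinity>" using u(4)[rule_format, of x] by (cases "u x") auto
    then show "u x = ereal (f x)" by (simp add: f_def ereal_real)
  qed
  have f01: "0 \<le> f x" "f x \<le> 1" for x using u(4)[rule_format, of x] unfolding uf by (auto simp: one_ereal_def)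
  then have a: "test_pair g f" using u(5) unfolding uf by (simp add: upper_gradient_real_iff test_pair_def)
  have "newton_norm M p u \<noteq> \<infinity>" using u(1) by (auto simp: newton_space_def)
  then have "(\<integral>\<^sup>+ x. epow (e2ennreal \<bar>u x\<bar>) p \<partial>N) \<noteq> \<infinity>"
    by (auto simp: newton_norm_def epow_def split: if_splits)
  also have "(\<integral>\<^sup>+ x. epow (e2ennreal \<bar>u x\<bar>) p \<partial>N) = p_integral f UNIV"
    unfolding p_integral_def uf using f01
    by (intro nn_integral_cong) (simp add: e2ennreal_ereal epow_ennreal)
  finally have "X \<le> energy g UNIV"
    using u(2,3) by (intro assms[OF a]) (auto simp: uf less_top one_ereal_def zero_ereal_def)
  then show "X \<le> (\<integral>\<^sup>+ x. epow (g x) p \<partial>M)" by (simp add: energy_def nn_integral_completion)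
qed

end

section \<open>Maz'ya's inequality near a uniformly fat set\<close>

locale growing_poincare_space = poincare_space +
  fixes Q Cq :: real
  assumes Q: "0 < Q" and Cq: "0 < Cq"
    and growth: "0 < r \<Longrightarrow> r < R \<Longrightarrow> y \<in> ball x R \<Longrightarrow> vol y r \<le> Cq * (r / R) powr Q * vol x R"
begin

text \<open>
  Since the volume grows at least like a positive power of the radius, a ball fills only a small part
  of a much larger ball.
\<close>

lemma growth_small:
  assumes "0 < \<epsilon>"
  shows "\<exists>T>1. \<forall>x y r. 0 < r \<longrightarrow> y \<in> ball x (T * r) \<longrightarrow> vol y r \<le> \<epsilon> * vol x (T * r)"
proof -
  define T where "T = max 2 ((Cq / \<epsilon>) powr (1 / Q))"
  have T: "1 < T" by (simp add: T_def)
  have "Cq / \<epsilon> = ((Cq / \<epsilon>) powr (1 / Q)) powr Q" using Cq assms Q by (simp add: powr_powr)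
  also have "\<dots> \<le> T powr Q" using Q by (intro powr_mono2) (auto simp: T_def)
  finally have "Cq / \<epsilon> \<le> T powr Q" .
  then have le: "Cq * (1 / T) powr Q \<le> \<epsilon>" using assms T by (simp add: powr_divide field_simps)
  show ?thesis
  proof (intro exI[of _ T] conjI allI impI T)
    fix x y :: 'a and r :: real assume r: "0 < r" "y \<in> ball x (T * r)"
    have "r < T * r" using T r(1) by simp
    from growth[OF r(1) this r(2)] have "vol y r \<le> Cq * (1 / T) powr Q * vol x (T * r)"
      using r(1) by simp
    also have "\<dots> \<le> \<epsilon> * vol x (T * r)" by (intro mult_right_mono le) simp
    finally show "vol y r \<le> \<epsilon> * vol x (T * r)" .
  qed
qed

text \<open>
  A test function is \<open>1\<close> on the ball of radius \<open>r\<close>, but its mean over a ball of much larger radius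
  is at most \<open>1/2\<close>, as it vanishes off the ball of radius \<open>2 r\<close>. So it deviates from that mean by
  \<open>1/2\<close>, and the Poincare inequality bounds its energy from below.
\<close>

lemma cap_ball_ge:
  "\<exists>c>0. \<forall>x r. 0 < r \<longrightarrow> ennreal (c * (vol x r / r powr p)) \<le> cap M p (ball x r) (ball x (2 * r))"
proof -
  obtain C where C: "0 < C" "\<And>f g x0 r. test_pair g f \<Longrightarrow> 0 < r \<Longrightarrow>
     p_integral (\<lambda>y. \<bar>f y - ball_mean f x0 r\<bar>) (ball x0 r) \<le> ennreal (C * r powr p) * energy g (ball x0 (2 * lam * r))"
    using poincare_strong unfolding p_integral_def by blast
  obtain T where T: "1 < T" "\<And>x y r. 0 < r \<Longrightarrow> y \<in> ball x (T * r) \<Longrightarrow> vol y r \<le> 1 / 2 * vol x (T * r)"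
    using growth_small[of "1/2"] by auto
  define c where "c = 1 / (2 powr p * (C * (2 * T) powr p))"
  have c: "0 < c" using C T by (simp add: c_def)
  show ?thesis
  proof (intro exI[of _ c] conjI allI impI c cap_greatest)
    fix x r g u assume r: "0 < r" and u: "test_pair g u" "\<And>y. y \<in> ball x r \<Longrightarrow> u y = 1" "\<And>y. y \<notin> ball x (2 * r) \<Longrightarrow> u y = 0"
    define R where "R = T * (2 * r)"
    have R: "0 < R" using T(1) r by (simp add: R_def)
    have "2 * r \<le> R" using T(1) r unfolding R_def by simp
    have V: "vol x (2 * r) \<le> 1 / 2 * vol x R" unfolding R_def using r R by (intro T(2)) (auto simp: R_def)
    have "ennreal (ball_mean u x R * vol x R) = (\<integral>\<^sup>+ y \<in> ball x R. ennreal (u y) \<partial>N)" by (rule ball_mean_mult_vol[OF u(1) R, symmetric])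
    also have "\<dots> \<le> (\<integral>\<^sup>+ y \<in> ball x (2 * r). 1 \<partial>N)"
      using u(3) test_pairD(3)[OF u(1)] by (intro nn_integral_mono) (auto simp: indicator_def)
    also have "\<dots> = ennreal (vol x (2 * r))" using r by (simp add: emeasure_ball_eq)
    also have "\<dots> \<le> ennreal (1 / 2 * vol x R)" by (rule ennreal_leI[OF V])
    finally have "ball_mean u x R * vol x R \<le> 1 / 2 * vol x R" by (subst (asm) ennreal_le_iff) auto
    then have ball_mean: "ball_mean u x R \<le> 1 / 2" using vol_pos[OF R, of x] by (simp only: mult_le_cancel_right_pos)
    have "ennreal ((1 / 2) powr p * vol x r) = p_integral (\<lambda>_. 1 / 2) (ball x r)"
      unfolding p_integral_def using r by (simp add: nn_integral_cmult_indicator emeasure_ball_eq ennreal_mult)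
    also have "\<dots> \<le> p_integral (\<lambda>y. \<bar>u y - ball_mean u x R\<bar>) (ball x R)"
      using ball_mean u(2) \<open>2 * r \<le> R\<close> r by (intro p_integral_mono) auto
    also have "\<dots> \<le> ennreal (C * R powr p) * energy g (ball x (2 * lam * R))" by (rule C(2)[OF u(1) R])
    also have "\<dots> \<le> ennreal (C * R powr p) * energy g UNIV" by (intro mult_left_mono energy_mono) auto
    finally have le: "ennreal ((1 / 2) powr p * vol x r) \<le> ennreal (C * R powr p) * energy g UNIV" .
    have CR: "0 < C * R powr p" using C R by simp
    have "ennreal (c * (vol x r / r powr p)) = ennreal (1 / (C * R powr p)) * ennreal ((1 / 2) powr p * vol x r)"
      using r T by (subst ennreal_mult[symmetric]) (auto simp: c_def R_def powr_mult powr_divide mult_ac C(1) less_imp_le)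
    also have "\<dots> \<le> ennreal (1 / (C * R powr p)) * (ennreal (C * R powr p) * energy g UNIV)"
      by (intro mult_left_mono le) auto
    also have "\<dots> = energy g UNIV"
      using C(1) R by (simp add: mult.assoc[symmetric] ennreal_mult[symmetric])
    finally show "ennreal (c * (vol x r / r powr p)) \<le> energy g UNIV" .
  qed
qed

text \<open>
  Maz'ya's inequality: where \<open>v\<close> vanishes on a set of large capacity, its mean \<open>m\<close> over a ball is
  controlled by the energy, since \<open>1 - v / m\<close>, cut off, is a test function for that set.
\<close>

lemma mazya_inequality:
  assumes cF: "0 < cF" and fat: "\<And>x r. x \<in> Z \<Longrightarrow> 0 < r \<Longrightarrow>
    ennreal cF * cap M p (ball x r) (ball x (2 * r)) \<le> cap M p (Z \<inter> ball x r) (ball x (2 * r))"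
  shows "\<exists>C>0. \<forall>g v x r. test_pair g v \<longrightarrow> (\<forall>y\<in>Z. v y = 0) \<longrightarrow> x \<in> Z \<longrightarrow> 0 < r \<longrightarrow>
    p_integral v (ball x r) \<le> ennreal (C * r powr p) * energy g (ball x (4 * lam * r))"
proof -
  obtain C where C: "0 < C" "\<And>f g x0 r. test_pair g f \<Longrightarrow> 0 < r \<Longrightarrow>
     p_integral (\<lambda>y. \<bar>f y - ball_mean f x0 r\<bar>) (ball x0 r) \<le> ennreal (C * r powr p) * energy g (ball x0 (2 * lam * r))"
    using poincare_strong unfolding p_integral_def by blast
  obtain c where c: "0 < c" "\<And>x r. 0 < r \<Longrightarrow> ennreal (c * (vol x r / r powr p)) \<le> cap M p (ball x r) (ball x (2 * r))"
    using cap_ball_ge by blast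
  define C1 where "C1 = 2 powr p * (1 + 2 powr p * C * 2 powr p)"
  define C2 where "C2 = C1 / (cF * c)"
  have C1: "0 < C1" using C by (simp add: C1_def add_pos_pos)
  have C2: "0 < C2" using C1 cF c by (simp add: C2_def)
  define C3 where "C3 = 2 powr p * (C * 2 powr p + C2)"
  have C3: "0 < C3" using C C2 by (simp add: C3_def add_pos_pos)
  have main: "p_integral v (ball x r) \<le> ennreal (C3 * r powr p) * energy g (ball x (4 * lam * r))"
    if v: "test_pair g v" and v0: "\<forall>y\<in>Z. v y = 0" and x: "x \<in> Z" and r: "0 < r" for g v x r
  proof (cases "energy g (ball x (4 * lam * r)) = \<infinity>")
    case True
    then show ?thesis using C3 r by (simp add: ennreal_mult_top)
  next
    case False
    then obtain E where E: "energy g (ball x (4 * lam * r)) = ennreal E" "0 \<le> E"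
      by (cases "energy g (ball x (4 * lam * r))") auto
    note [measurable] = test_pairD(1,6)[OF v]
    define m where "m = ball_mean v x (2 * r)"
    have m0: "0 \<le> m" unfolding m_def by (rule ball_mean_bounds[OF v]) (use r in simp)
    have P: "p_integral (\<lambda>y. \<bar>v y - m\<bar>) (ball x (2 * r)) \<le> ennreal (C * 2 powr p * r powr p * E)"
      using C(2)[OF v, of "2 * r" x] r C(1) E by (simp add: m_def powr_mult ennreal_mult mult.assoc)
    have mean: "m powr p * vol x r \<le> C2 * r powr p * E"
    proof (cases "m = 0")
      case True then show ?thesis using C2 E by simp
    next
      case False
      then have m: "0 < m" using m0 by simp
      define f where "f y = max 0 (1 - v y / m)" for y
      have lip: "\<bar>max 0 (1 - a / m) - max 0 (1 - b / m)\<bar> \<le> 1 / m * \<bar>a - b\<bar>" for a b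
      proof -
        have "\<bar>max 0 (1 - a / m) - max 0 (1 - b / m)\<bar> \<le> \<bar>(1 - a / m) - (1 - b / m)\<bar>" by linarith
        also have "\<dots> = \<bar>b - a\<bar> / m" using m by (simp add: diff_divide_distrib[symmetric] abs_divide)
        finally show ?thesis by (simp add: abs_minus_commute)
      qed
      have "curve_gradient (\<lambda>y. ennreal (1 / m) * g y) f"
        unfolding f_def by (rule curve_gradient_Lipschitz_comp[OF test_pairD(4)[OF v] lip]) (use m in simp)
      moreover have [measurable]: "f \<in> borel_measurable N" unfolding f_def by measurable
      moreover have "f y \<le> 1" for y using m test_pairD(2)[OF v, of y] by (simp add: f_def)
      moreover have f0: "0 \<le> f y" for y by (simp add: f_def)
      ultimately have f: "test_pair (\<lambda>y. ennreal (1 / m) * g y) f" by (simp add: test_pair_def)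
      obtain g' where g': "test_pair g' (\<lambda>y. f y * ball_cutoff x r y)"
        "energy g' UNIV \<le> ennreal (2 powr p) * (energy (\<lambda>y. ennreal (1 / m) * g y) (ball x (2 * r)) + ennreal ((2 / r) powr p) * p_integral f (ball x (2 * r)))"
        by (rule test_pair_ball_cutoff[OF f r])
      have "energy (\<lambda>y. ennreal (1 / m) * g y) (ball x (2 * r)) = ennreal ((1 / m) powr p) * energy g (ball x (2 * r))"
        unfolding energy_def using m p
        by (subst nn_integral_cmult[symmetric]) (auto simp: epow_mult_ennreal mult.assoc)
      also have "\<dots> \<le> ennreal ((1 / m) powr p) * ennreal E"
        unfolding E(1)[symmetric]
      proof (intro mult_left_mono energy_mono subset_ball)
        have "2 * 1 * r \<le> 4 * lam * r" using lam r by (intro mult_right_mono mult_mono) auto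
        then show "2 * r \<le> 4 * lam * r" by simp
      qed simp
      finally have e1: "energy (\<lambda>y. ennreal (1 / m) * g y) (ball x (2 * r)) \<le> ennreal ((1 / m) powr p * E)"
        using E by (simp add: ennreal_mult)
      have "p_integral f (ball x (2 * r)) \<le> p_integral (\<lambda>y. 1 / m * \<bar>v y - m\<bar>) (ball x (2 * r))"
      proof (rule p_integral_mono)
        fix y
        have "1 - v y / m = (m - v y) / m" using m by (simp add: field_simps)
        also have "\<dots> \<le> \<bar>v y - m\<bar> / m" using m by (intro divide_right_mono) auto
        finally show "0 \<le> f y \<and> f y \<le> 1 / m * \<bar>v y - m\<bar>" using m by (simp add: f_def)
      qed simp
      also have "\<dots> = ennreal ((1 / m) powr p) * p_integral (\<lambda>y. \<bar>v y - m\<bar>) (ball x (2 * r))"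
        using m by (intro p_integral_cmult) auto
      also have "\<dots> \<le> ennreal ((1 / m) powr p) * ennreal (C * 2 powr p * r powr p * E)"
        by (intro mult_left_mono P) auto
      finally have e2: "p_integral f (ball x (2 * r)) \<le> ennreal ((1 / m) powr p * (C * 2 powr p * r powr p * E))"
        using C E by (simp add: ennreal_mult)
      have "energy g' UNIV \<le> ennreal (2 powr p) * (ennreal ((1 / m) powr p * E) +
          ennreal ((2 / r) powr p) * ennreal ((1 / m) powr p * (C * 2 powr p * r powr p * E)))"
        by (rule order_trans[OF g'(2)]) (intro mult_left_mono add_mono e1 e2, auto)
      also have "\<dots> = ennreal (2 powr p * ((1 / m) powr p * E + (2 / r) powr p * ((1 / m) powr p * (C * 2 powr p * r powr p * E))))"
        using C E by (simp add: ennreal_mult ennreal_plus)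
      also have "2 powr p * ((1 / m) powr p * E + (2 / r) powr p * ((1 / m) powr p * (C * 2 powr p * r powr p * E))) = C1 * E / m powr p"
        using r m by (simp add: C1_def powr_divide field_simps)
      finally have en: "energy g' UNIV \<le> ennreal (C1 * E / m powr p)" .
      have "ennreal (cF * (c * (vol x r / r powr p))) = ennreal cF * ennreal (c * (vol x r / r powr p))"
        by (subst ennreal_mult[symmetric]) (use cF c(1) in auto)
      also have "\<dots> \<le> ennreal cF * cap M p (ball x r) (ball x (2 * r))" by (intro mult_left_mono c(2) r) simp
      also have "\<dots> \<le> cap M p (Z \<inter> ball x r) (ball x (2 * r))" by (rule fat[OF x r])
      also have "\<dots> \<le> energy g' UNIV"
      proof (rule cap_le_energy[OF g'(1)])
        show "f y * ball_cutoff x r y = 1" if "y \<in> Z \<inter> ball x r" for y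
          using that v0 ball_cutoff_simps(3)[OF r, of y x] by (simp add: f_def)
        show off: "f y * ball_cutoff x r y = 0" if "y \<notin> ball x (2 * r)" for y
          using that ball_cutoff_simps(4)[OF r, of x y] r by auto
        have "p_integral (\<lambda>y. f y * ball_cutoff x r y) UNIV \<le> (\<integral>\<^sup>+ y \<in> ball x (2 * r). 1 \<partial>N)"
          unfolding p_integral_def
        proof (rule nn_integral_mono)
          fix y
          have "0 \<le> f y * ball_cutoff x r y" "f y * ball_cutoff x r y \<le> 1" using test_pairD(2,3)[OF g'(1), of y] by auto
          then have "(f y * ball_cutoff x r y) powr p \<le> 1 powr p" using p by (intro powr_mono2) auto
          then have "ennreal ((f y * ball_cutoff x r y) powr p) \<le> 1" by (simp add: ennreal_le_1)
          then show "ennreal ((f y * ball_cutoff x r y) powr p) * indicator UNIV y \<le> 1 * indicator (ball x (2 * r)) y"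
            using off[of y] by (cases "y \<in> ball x (2 * r)") auto
        qed
        also have "\<dots> < \<infinity>" using r by (simp add: emeasure_ball_eq)
        finally show "p_integral (\<lambda>y. f y * ball_cutoff x r y) UNIV < \<infinity>" .
      qed
      also note en
      finally have "cF * (c * (vol x r / r powr p)) \<le> C1 * E / m powr p"
        using C1 E by (subst (asm) ennreal_le_iff) auto
      then show ?thesis using m r cF c by (simp add: C2_def field_simps)
    qed
    have "p_integral v (ball x r) \<le> p_integral (\<lambda>y. \<bar>v y - m\<bar> + m) (ball x r)"
      using m0 test_pairD(2)[OF v] by (intro p_integral_mono) auto
    also have "\<dots> \<le> ennreal (2 powr p) * (p_integral (\<lambda>y. \<bar>v y - m\<bar>) (ball x r) + p_integral (\<lambda>y. m) (ball x r))"
      using m0 by (intro p_integral_add_le) auto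
    also have "\<dots> \<le> ennreal (2 powr p) * (ennreal (C * 2 powr p * r powr p * E) + ennreal (C2 * r powr p * E))"
    proof (intro mult_left_mono add_mono)
      show "p_integral (\<lambda>y. \<bar>v y - m\<bar>) (ball x r) \<le> ennreal (C * 2 powr p * r powr p * E)"
        by (rule order_trans[OF p_integral_mono P]) (use r in \<open>auto intro!: subset_ball\<close>)
      have "p_integral (\<lambda>y. m) (ball x r) = ennreal (m powr p * vol x r)"
        unfolding p_integral_def using r by (simp add: nn_integral_cmult_indicator emeasure_ball_eq ennreal_mult)
      then show "p_integral (\<lambda>y. m) (ball x r) \<le> ennreal (C2 * r powr p * E)" using ennreal_leI[OF mean] by simp
    qed simp
    also have "\<dots> = ennreal (C3 * r powr p) * energy g (ball x (4 * lam * r))"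
      unfolding E(1) using C C2 E(2) by (simp add: C3_def ennreal_plus[symmetric] ennreal_mult[symmetric] algebra_simps del: ennreal_plus)
    finally show ?thesis .
  qed
  show ?thesis using C3 main by blast
qed

lemma infdist_borel [measurable]: "{y. infdist y Z < r} \<in> sets borel"
  by (intro borel_open open_Collect_less continuous_intros)

lemma infdist_lt_obtain:
  assumes "Z \<noteq> {}" "infdist y Z < r"
  obtains z where "z \<in> Z" "dist y z < r"
proof -
  have "(INF z\<in>Z. dist y z) < r" using assms by (simp add: infdist_notempty)
  then show thesis using that cINF_less_iff[OF assms(1) bdd_below_image_dist] assms by auto
qed

text \<open>
  The layer is covered by balls of radius \<open>2 r\<close> centred at a net of \<open>Z\<close>, and Maz'ya's inequality is
  summed over them.
\<close>

lemma layer_estimate: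
  assumes cF: "0 < cF" and fat: "\<And>x r. x \<in> Z \<Longrightarrow> 0 < r \<Longrightarrow>
    ennreal cF * cap M p (ball x r) (ball x (2 * r)) \<le> cap M p (Z \<inter> ball x r) (ball x (2 * r))"
    and Z: "Z \<noteq> {}"
  shows "\<exists>C>0. \<forall>g v r. test_pair g v \<longrightarrow> (\<forall>y\<in>Z. v y = 0) \<longrightarrow> 0 < r \<longrightarrow>
    p_integral v {y. infdist y Z < r} \<le> ennreal (C * r powr p) * energy g {y. infdist y Z < 8 * lam * r}"
proof -
  obtain C where C: "0 < C" "\<And>g v x r. test_pair g v \<Longrightarrow> (\<forall>y\<in>Z. v y = 0) \<Longrightarrow> x \<in> Z \<Longrightarrow> 0 < r \<Longrightarrow>
    p_integral v (ball x r) \<le> ennreal (C * r powr p) * energy g (ball x (4 * lam * r))"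
    using mazya_inequality[OF cF fat] by blast
  obtain n :: nat where n: "\<And>(Z :: 'a set) r. 0 < r \<Longrightarrow> (\<exists>S\<subseteq>Z. Z \<subseteq> (\<Union>x\<in>S. ball x r) \<and> (\<forall>x R. finite (S \<inter> ball x R)) \<and>
     (\<forall>y. finite {x\<in>S. y \<in> ball x (8 * lam * r)} \<and> card {x\<in>S. y \<in> ball x (8 * lam * r)} \<le> n))"
    using exists_net[of "8 * lam"] by blast
  define C1 where "C1 = C * 2 powr p * Suc n"
  have C1: "0 < C1" using C by (simp add: C1_def)
  have main: "p_integral v {y. infdist y Z < r} \<le> ennreal (C1 * r powr p) * energy g {y. infdist y Z < 8 * lam * r}"
    if v: "test_pair g v" and v0: "\<forall>y\<in>Z. v y = 0" and r: "0 < r" for g v r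
  proof -
    note [measurable] = test_pairD(1)[OF v]
    obtain S where S: "S \<subseteq> Z" "Z \<subseteq> (\<Union>x\<in>S. ball x r)" "\<And>x R. finite (S \<inter> ball x R)"
      "\<And>y. finite {x\<in>S. y \<in> ball x (8 * lam * r)}" "\<And>y. card {x\<in>S. y \<in> ball x (8 * lam * r)} \<le> n"
      using n[OF r, of Z] by blast
    obtain x0 where "x0 \<in> Z" using Z by auto
    have fin: "p_integral v ({y. infdist y Z < r} \<inter> ball x0 (real k)) \<le> ennreal (C1 * r powr p) * energy g {y. infdist y Z < 8 * lam * r}" for k :: nat
    proof -
      define J where "J = S \<inter> ball x0 (k + 2 * r)"
      have J: "finite J" "J \<subseteq> Z" using S by (auto simp: J_def)
      have cover: "{y. infdist y Z < r} \<inter> ball x0 (real k) \<subseteq> (\<Union>x\<in>J. ball x (2 * r))"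
      proof
        fix y assume y: "y \<in> {y. infdist y Z < r} \<inter> ball x0 (real k)"
        then obtain z where z: "z \<in> Z" "dist y z < r"
          using infdist_lt_obtain[OF Z, of y r] by auto
        then obtain x where x: "x \<in> S" "dist x z < r" using S(2) by auto
        have d: "dist x y < 2 * r" using x z dist_triangle[of x y z] by (auto simp: dist_commute)
        moreover have "dist x0 x < k + 2 * r" using d y dist_triangle[of x0 x y] by (auto simp: dist_commute)
        ultimately show "y \<in> (\<Union>x\<in>J. ball x (2 * r))" using x by (auto simp: J_def)
      qed
      have "p_integral v ({y. infdist y Z < r} \<inter> ball x0 (real k)) \<le> (\<Sum>x\<in>J. p_integral v (ball x (2 * r)))"
        unfolding p_integral_def by (rule nn_integral_subcover_le[OF J(1) _ cover]) auto
      also have "\<dots> \<le> (\<Sum>x\<in>J. ennreal (C * (2 * r) powr p) * energy g (ball x (8 * lam * r)))"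
      proof (rule sum_mono)
        fix x assume "x \<in> J"
        then show "p_integral v (ball x (2 * r)) \<le> ennreal (C * (2 * r) powr p) * energy g (ball x (8 * lam * r))"
          using C(2)[OF v v0, of x "2 * r"] J r by (auto simp: mult_ac)
      qed
      also have "\<dots> = ennreal (C * (2 * r) powr p) * (\<Sum>x\<in>J. energy g (ball x (8 * lam * r)))"
        by (simp add: sum_distrib_left)
      also have "\<dots> \<le> ennreal (C * (2 * r) powr p) * (of_nat (Suc n) * energy g {y. infdist y Z < 8 * lam * r})"
      proof (intro mult_left_mono energy_overlap_le J(1))
        show "ball x (8 * lam * r) \<subseteq> {y. infdist y Z < 8 * lam * r}" if "x \<in> J" for x
        proof
          fix y assume "y \<in> ball x (8 * lam * r)"
          moreover have "infdist y Z \<le> dist y x" using that J by (intro infdist_le) auto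
          ultimately show "y \<in> {y. infdist y Z < 8 * lam * r}" by (simp add: dist_commute)
        qed
        have "card {x \<in> J. y \<in> ball x (8 * lam * r)} \<le> card {x \<in> S. y \<in> ball x (8 * lam * r)}" for y
          using S(4) by (intro card_mono) (auto simp: J_def)
        then show "card {x \<in> J. y \<in> ball x (8 * lam * r)} \<le> Suc n" for y using S(5)[of y] by (meson le_SucI le_trans)
      qed (use test_pairD(5)[OF v] infdist_borel in auto)
      also have "\<dots> = ennreal (C1 * r powr p) * energy g {y. infdist y Z < 8 * lam * r}"
        using C r by (simp add: C1_def powr_mult ennreal_mult mult_ac ennreal_of_nat_eq_real_of_nat del: of_nat_Suc)
      finally show ?thesis .
    qed
    show ?thesis
      unfolding p_integral_def
    proof (rule nn_integral_exhaust_le[where B = "\<lambda>k. ball x0 (real k)"])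
      show "incseq (\<lambda>k. ball x0 (real k))" by (auto simp: incseq_def)
      show "{y. infdist y Z < r} \<subseteq> (\<Union>k. ball x0 (real k))" using reals_Archimedean2 by auto
    qed (use fin in \<open>auto simp: p_integral_def\<close>)
  qed
  show ?thesis using C1 main by blast
qed

end

section \<open>The Hardy inequality for a uniformly fat complement\<close>

lemma powr_diff_le:
  fixes a b s :: real
  assumes "0 < a" "a \<le> b" "0 < s" "s < 1"
  shows "b powr s - a powr s \<le> s * a powr (s - 1) * (b - a)"
proof (cases "a = b")
  case False
  then have "a < b" using assms by simp
  have "\<exists>z>a. z < b \<and> b powr s - a powr s = (b - a) * (s * z powr (s - 1))"
  proof (rule MVT2[OF \<open>a < b\<close>])
    fix x assume "a \<le> x" "x \<le> b"
    then show "((\<lambda>x. x powr s) has_real_derivative s * x powr (s - 1)) (at x)"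
      using assms by (intro has_real_derivative_powr) auto
  qed
  then obtain z where z: "a < z" "b powr s - a powr s = (b - a) * (s * z powr (s - 1))" by blast
  have "z powr (s - 1) \<le> a powr (s - 1)" using z assms by (intro powr_mono2') auto
  then have "(b - a) * (s * z powr (s - 1)) \<le> (b - a) * (s * a powr (s - 1))"
    using assms by (intro mult_left_mono) auto
  then show ?thesis using z by (simp add: mult_ac)
qed simp

lemma one_minus_two_powr_ge:
  fixes \<beta> :: real
  assumes "0 < \<beta>" "\<beta> \<le> 1"
  shows "\<beta> * (ln 2 / 2) \<le> 1 - 2 powr - \<beta>"
proof -
  let ?t = "\<beta> * ln 2"
  have l: "0 < ln (2::real)" "ln (2::real) \<le> 1" using ln_le_minus_one[of "2::real"] by auto
  have t: "0 < ?t" "?t \<le> 1" using assms l by (auto simp: mult_le_one)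
  have "2 powr - \<beta> = exp (- ?t)" by (simp add: powr_def)
  also have "\<dots> = inverse (exp ?t)" by (rule exp_minus)
  also have "\<dots> \<le> inverse (1 + ?t)" using t exp_ge_add_one_self[of ?t] by (intro le_imp_inverse_le) auto
  also have "\<dots> \<le> 1 - ?t / 2"
  proof -
    have "1 \<le> (1 - ?t / 2) * (1 + ?t)" using t mult_left_mono[of ?t 1 ?t] by (simp add: algebra_simps)
    then show ?thesis using t by (simp add: field_simps)
  qed
  finally show ?thesis by simp
qed

text \<open>
  The powers of the scales \<open>R / 2\<^sup>k\<close> form a geometric sequence, whose sum is dominated by the term
  of the smallest admitted scale.
\<close>

lemma geometric_scale_sum:
  fixes R \<beta> w :: real
  assumes "0 < R" "0 < \<beta>" "0 < w" "finite A" and A: "\<And>k. k \<in> A \<Longrightarrow> w \<le> R / 2 ^ k"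
  shows "(\<Sum>k\<in>A. (R / 2 ^ k) powr - \<beta>) \<le> w powr - \<beta> / (1 - 2 powr - \<beta>)"
proof (cases "A = {}")
  case True
  have "2 powr - \<beta> < 1" using assms by (simp add: powr_less_one)
  then show ?thesis using True by simp
next
  case False
  define m where "m = Max A"
  have m: "m \<in> A" "\<And>k. k \<in> A \<Longrightarrow> k \<le> m" using False assms by (auto simp: m_def)
  let ?q = "2 powr - \<beta>"
  have q: "0 < ?q" "?q < 1" using assms by (auto simp: powr_less_one)
  have eq: "(R / 2 ^ k) powr - \<beta> = (R / 2 ^ m) powr - \<beta> * ?q ^ (m - k)" if "k \<le> m" for k
  proof -
    have "R / 2 ^ k = (R / 2 ^ m) * 2 ^ (m - k)" using that by (simp add: power_diff)
    then have "(R / 2 ^ k) powr - \<beta> = (R / 2 ^ m) powr - \<beta> * (2 ^ (m - k)) powr - \<beta>"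
      using assms powr_mult[of "R / 2 ^ m" "2 ^ (m - k)" "- \<beta>"] by (simp only:)
    also have "(2 ^ (m - k)) powr - \<beta> = ?q ^ (m - k)"
      by (simp add: powr_realpow[symmetric] powr_powr powr_power mult.commute)
    finally show ?thesis .
  qed
  have "(\<Sum>k\<in>A. (R / 2 ^ k) powr - \<beta>) \<le> (\<Sum>k\<in>{..m}. (R / 2 ^ k) powr - \<beta>)"
    using m by (intro sum_mono2) auto
  also have "\<dots> = (\<Sum>k\<in>{..m}. (R / 2 ^ m) powr - \<beta> * ?q ^ (m - k))"
    by (rule sum.cong[OF refl], rule eq) simp
  also have "\<dots> = (R / 2 ^ m) powr - \<beta> * (\<Sum>k\<in>{..m}. ?q ^ k)"
    unfolding sum_distrib_left[symmetric]
    by (intro arg_cong[where f = "(*) _"] sum.reindex_bij_witness[of _ "\<lambda>k. m - k" "\<lambda>k. m - k"]) auto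
  also have "\<dots> \<le> w powr - \<beta> * (1 / (1 - ?q))"
  proof (intro mult_mono)
    show "(R / 2 ^ m) powr - \<beta> \<le> w powr - \<beta>" using A[OF m(1)] assms by (intro powr_mono2') auto
    have "(\<Sum>k\<in>{..m}. ?q ^ k) \<le> (\<Sum>k. ?q ^ k)" using q by (intro sum_le_suminf summable_geometric) auto
    then show "(\<Sum>k\<in>{..m}. ?q ^ k) \<le> 1 / (1 - ?q)" using q by (simp add: suminf_geometric)
  qed (auto intro: sum_nonneg)
  finally show ?thesis by simp
qed

context growing_poincare_space begin

text \<open>
  A power of a 1-Lipschitz function is Lipschitz with the constant given by its derivative at any
  nearby point, up to a factor \<open>2\<close>. The lower bound \<open>\<epsilon>\<close> makes "nearby" uniform.
\<close>

lemma hardy_weight_lipschitz: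
  fixes c :: "'b::metric_space \<Rightarrow> real"
  assumes c: "\<And>x y. \<bar>c x - c y\<bar> \<le> dist x y" "\<And>x. \<epsilon> \<le> c x" and "0 < \<epsilon>" "0 < s" "s < 1"
    and d: "dist x y < \<epsilon> / 2" "dist x z < \<epsilon> / 2"
  shows "\<bar>c x powr s - c y powr s\<bar> \<le> 2 * s * c z powr (s - 1) * dist x y" "c x powr s \<le> 2 * c z powr s"
proof -
  have pos: "0 < c w" for w using c(2)[of w] assms(3) by linarith
  have "dist y z < \<epsilon>" using d dist_triangle[of y z x] by (simp add: dist_commute)
  then have z: "c z \<le> 2 * c x" "c z \<le> 2 * c y" "c x \<le> 2 * c z"
    using c(1)[of x z] c(1)[of y z] c(2)[of x] c(2)[of y] c(2)[of z] d by (auto simp: abs_le_iff)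
  have half: "a powr (s - 1) \<le> 2 * c z powr (s - 1)" if "0 < a" "c z \<le> 2 * a" for a
  proof -
    have "a powr (s - 1) \<le> (c z / 2) powr (s - 1)" using that pos[of z] assms by (intro powr_mono2') auto
    also have "\<dots> = c z powr (s - 1) * 2 powr (1 - s)"
      using pos[of z] by (simp add: powr_divide powr_minus_divide[symmetric] field_simps powr_diff)
    also have "\<dots> \<le> c z powr (s - 1) * 2 powr 1" using assms by (intro mult_left_mono powr_mono) auto
    finally show ?thesis by simp
  qed
  have one: "b powr s - a powr s \<le> 2 * s * c z powr (s - 1) * dist x y"
    if "0 < a" "a \<le> b" "c z \<le> 2 * a" "b - a \<le> dist x y" for a b
  proof -
    have "b powr s - a powr s \<le> s * a powr (s - 1) * (b - a)" using that assms by (intro powr_diff_le) auto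
    also have "\<dots> \<le> s * (2 * c z powr (s - 1)) * dist x y"
      using that assms half[of a] by (intro mult_mono) auto
    finally show ?thesis by (simp add: mult_ac)
  qed
  show "\<bar>c x powr s - c y powr s\<bar> \<le> 2 * s * c z powr (s - 1) * dist x y"
  proof (cases "c x \<le> c y")
    case True
    then have "c x powr s \<le> c y powr s" using pos[of x] assms by (intro powr_mono2) auto
    then show ?thesis using one[of "c x" "c y"] True pos z c(1)[of y x] by (simp add: abs_le_iff dist_commute)
  next
    case False
    then have "c y powr s \<le> c x powr s" using pos[of y] assms by (intro powr_mono2) auto
    then show ?thesis using one[of "c y" "c x"] False pos z c(1)[of x y] by (simp add: abs_le_iff)
  qed
  have "c x powr s \<le> (2 * c z) powr s" using z pos[of x] assms by (intro powr_mono2) auto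
  also have "\<dots> = 2 powr s * c z powr s" using pos[of z] by (simp add: powr_mult)
  also have "\<dots> \<le> 2 powr 1 * c z powr s" using assms by (intro mult_right_mono powr_mono) auto
  finally show "c x powr s \<le> 2 * c z powr s" by simp
qed

text \<open>
  The left-hand side is of order \<open>\<beta>\<^sup>p\<^sup>-\<^sup>1\<close>, as \<open>1 - 2\<^sup>-\<^sup>\<beta>\<close> is of order \<open>\<beta>\<close>.
\<close>

lemma wannebo_parameter:
  assumes C0: "0 < C0" and K: "1 \<le> K"
  shows "\<exists>\<beta>>0. \<beta> \<le> 1 \<and> C0 * 2 powr (p + \<beta>) * K powr \<beta> / (1 - 2 powr - \<beta>) * 2 powr p * (2 * (\<beta> / p)) powr p \<le> 1 / 2"
proof -
  define B where "B = C0 * 2 powr (p + 1) * K * (2 / ln 2) * 2 powr p * (2 / p) powr p"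
  have B: "0 < B" using C0 K p by (simp add: B_def)
  define \<beta> where "\<beta> = min 1 ((1 / (2 * B)) powr (1 / (p - 1)))"
  have \<beta>: "0 < \<beta>" "\<beta> \<le> 1" using B by (auto simp: \<beta>_def)
  have "\<beta> powr (p - 1) \<le> ((1 / (2 * B)) powr (1 / (p - 1))) powr (p - 1)"
    using p \<beta> by (intro powr_mono2) (auto simp: \<beta>_def)
  also have "\<dots> = 1 / (2 * B)" using p B by (simp add: powr_powr)
  finally have small: "\<beta> powr (p - 1) \<le> 1 / (2 * B)" .
  have l2: "0 < \<beta> * (ln 2 / 2)" using \<beta> by simp
  have "1 / (1 - 2 powr - \<beta>) \<le> 1 / (\<beta> * (ln 2 / 2))"
    by (rule frac_le[OF _ order_refl l2 one_minus_two_powr_ge[OF \<beta>]]) simp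
  also have "\<dots> = (2 / ln 2) / \<beta>" by simp
  finally have G: "1 / (1 - 2 powr - \<beta>) \<le> (2 / ln 2) / \<beta>" .
  have Gpos: "0 < 1 - 2 powr - \<beta>" using one_minus_two_powr_ge[OF \<beta>] l2 by linarith
  have aux: "X / d * t1 * t2 \<le> Y * t1 * t2" if "X * (1 / d) \<le> Y" "0 \<le> t1" "0 \<le> t2" for X d Y t1 t2 :: real
    using that by (intro mult_right_mono) auto
  have k1: "K powr 1 = K" using K by simp
  have "C0 * 2 powr (p + \<beta>) * K powr \<beta> * (1 / (1 - 2 powr - \<beta>)) \<le> C0 * 2 powr (p + 1) * K powr 1 * ((2 / ln 2) / \<beta>)"
  proof (rule mult_mono[OF mult_mono[OF mult_left_mono] G])
    show "2 powr (p + \<beta>) \<le> 2 powr (p + 1)" using \<beta> by (intro powr_mono) auto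
    show "K powr \<beta> \<le> K powr 1" using \<beta> K by (intro powr_mono) auto
    show "0 \<le> 1 / (1 - 2 powr - \<beta>)" using Gpos by simp
  qed (use C0 K in auto)
  then have "C0 * 2 powr (p + \<beta>) * K powr \<beta> / (1 - 2 powr - \<beta>) * 2 powr p * (2 * (\<beta> / p)) powr p \<le>
    C0 * 2 powr (p + 1) * K * ((2 / ln 2) / \<beta>) * 2 powr p * (2 * (\<beta> / p)) powr p"
    unfolding k1 by (rule aux) simp_all
  also have "\<dots> = B * \<beta> powr (p - 1)"
  proof -
    have "(2 * (\<beta> / p)) powr p = (2 / p) powr p * (\<beta> * \<beta> powr (p - 1))"
      using \<beta> p powr_mult[of "2 / p" \<beta> p] powr_add[of \<beta> 1 "p - 1"] by simp
    then show ?thesis using \<beta> by (simp add: B_def)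
  qed
  also have "\<dots> \<le> B * (1 / (2 * B))" using B by (intro mult_left_mono small) auto
  also have "\<dots> = 1 / 2" using B by simp
  finally show ?thesis using \<beta> by (intro exI[of _ \<beta>] conjI)
qed

text \<open>
  Wannebo's argument. Summing the layer estimates with weights \<open>r\<^sup>-\<^sup>p\<^sup>-\<^sup>\<beta>\<close> gives a Hardy inequality
  with extra weight \<open>d\<^sup>-\<^sup>\<beta>\<close> and a constant of order \<open>1 / \<beta>\<close>. Applied to \<open>u d\<^sup>\<beta>\<^sup>/\<^sup>p\<close> it removes the
  weight, and the gradient of the factor costs \<open>(\<beta> / p)\<^sup>p\<close> times the left-hand side. As \<open>p > 1\<close>, this
  is absorbed for small \<open>\<beta>\<close>. The distance is truncated at \<open>R\<close> and \<open>R / 2\<^sup>n\<close> so that the absorbed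
  term is finite.
\<close>

lemma fat_hardy_truncated:
  assumes C0: "0 < C0" and layer: "\<And>g v r. test_pair g v \<Longrightarrow> (\<forall>y\<in>Z. v y = 0) \<Longrightarrow> 0 < r \<Longrightarrow>
    p_integral v {y. infdist y Z < r} \<le> ennreal (C0 * r powr p) * energy g {y. infdist y Z < K * r}"
    and K: "1 \<le> K" and \<beta>: "0 < \<beta>" "\<beta> \<le> 1"
    and \<Gamma>: "\<Gamma> = C0 * 2 powr (p + \<beta>) * K powr \<beta> / (1 - 2 powr - \<beta>) * 2 powr p" "\<Gamma> * (2 * (\<beta> / p)) powr p \<le> 1 / 2"
    and u: "test_pair g u" "\<forall>y\<in>Z. u y = 0" and P: "p_integral u UNIV = ennreal P" "0 \<le> P" and E: "energy g UNIV = ennreal E" "0 \<le> E"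
    and R: "0 < R"
  shows "p_integral (\<lambda>y. u y / max (infdist y Z) (R / 2 ^ n)) {y. infdist y Z < R} \<le> ennreal (2 * \<Gamma> * 2 powr p * E + R powr - p * P)"
proof -
  note [measurable] = test_pairD(1,6)[OF u(1)]
  define s where "s = \<beta> / p"
  have s: "0 < s" "s < 1" "s * p = \<beta>" using \<beta> p by (auto simp: s_def)
  have q: "2 powr - \<beta> < 1" using \<beta> by (simp add: powr_less_one)
  have \<Gamma>0: "0 < \<Gamma>" unfolding \<Gamma> using C0 K q by simp
  define r where "r k = R / 2 ^ k" for k :: nat
  define e where "e = r n"
  have r: "0 < r k" "r (Suc k) = r k / 2" "r 0 = R" for k using R by (auto simp: r_def)
  have re: "e \<le> r k" if "k \<le> n" for k
    unfolding e_def r_def using that R by (intro divide_left_mono power_increasing) auto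
  have e: "0 < e" "e \<le> R" using r(1)[of n] re[of 0] r(3) by (auto simp: e_def)
  define W where "W y = max (infdist y Z) e" for y
  define c where "c y = min (W y) R" for y
  have W: "e \<le> W y" "0 < W y" "infdist y Z \<le> W y" for y using e by (auto simp: W_def less_max_iff_disj)
  have c: "e \<le> c y" "0 < c y" "c y \<le> R" "c y \<le> W y" for y using e W[of y] R by (auto simp: c_def)
  have cW: "c y = W y" if "infdist y Z < R" for y using that e by (auto simp: c_def W_def)
  have cR: "c y = R" if "\<not> infdist y Z < R" for y using that by (auto simp: c_def W_def)
  have clip: "\<bar>c x - c y\<bar> \<le> dist x y" for x y
    using infdist_triangle_abs[of x Z y] unfolding c_def W_def by linarith
  have [measurable]: "W \<in> borel_measurable borel" "c \<in> borel_measurable borel"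
    unfolding W_def c_def by measurable
  have [measurable]: "W \<in> borel_measurable N" "c \<in> borel_measurable N" by measurable
  \<comment> \<open>The factor \<open>(d / R)\<^sup>s\<close> with \<open>s = \<beta> / p\<close>, for the distance \<open>c\<close> truncated at \<open>e\<close> and \<open>R\<close>, and its gradient.\<close>
  define \<phi> where "\<phi> y = c y powr s * R powr - s" for y
  define l where "l y = 2 * s * R powr - s * c y powr (s - 1)" for y
  have R1: "R powr s * R powr - s = 1" using R by (simp add: powr_add[symmetric])
  have \<phi>0: "0 < \<phi> y" for y using c[of y] R by (simp add: \<phi>_def)
  have \<phi>1: "\<phi> y \<le> 1" for y
  proof -
    have "c y powr s \<le> R powr s" using c[of y] s by (intro powr_mono2) auto
    then have "\<phi> y \<le> R powr s * R powr - s" unfolding \<phi>_def by (intro mult_right_mono) auto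
    then show ?thesis using R1 by simp
  qed
  obtain g' where g': "test_pair g' (\<lambda>y. u y * \<phi> y)"
    "AE y in N. epow (g' y) p \<le> ennreal (2 powr p) * (epow (g y) p * ennreal ((2 * \<phi> y) powr p) + ennreal ((u y * l y) powr p))"
  proof (rule test_pair_product[OF u(1), of \<phi> l "2 * s * R powr - s * e powr (s - 1)" "\<lambda>y. 2 * \<phi> y" "e / 2" "e powr s * R powr - s"])
    show "\<phi> \<in> borel_measurable borel" "l \<in> borel_measurable borel" "(\<lambda>y. 2 * \<phi> y) \<in> borel_measurable borel"
      unfolding \<phi>_def l_def by measurable
    show "l y \<le> 2 * s * R powr - s * e powr (s - 1)" for y
      unfolding l_def using c[of y] s e by (intro mult_left_mono powr_mono2') auto
    show "0 \<le> l y" for y using s by (simp add: l_def)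
    show "0 < e / 2" "0 < e powr s * R powr - s" using e R by auto
    fix x y z
    show "\<phi> x \<le> 2 * \<phi> z \<and> e powr s * R powr - s \<le> 2 * \<phi> z" if "dist x z < e / 2"
    proof
      have "c x powr s \<le> 2 * c z powr s"
        using hardy_weight_lipschitz(2)[of c e s x x z] clip c e s that by auto
      then have "c x powr s * R powr - s \<le> 2 * c z powr s * R powr - s" by (intro mult_right_mono) auto
      then show "\<phi> x \<le> 2 * \<phi> z" by (simp add: \<phi>_def)
      have "e powr s * R powr - s \<le> \<phi> z" unfolding \<phi>_def using c[of z] e s by (intro mult_right_mono powr_mono2) auto
      then show "e powr s * R powr - s \<le> 2 * \<phi> z" using \<phi>0[of z] by linarith
    qed
    assume d: "dist x y < e / 2" "dist x z < e / 2"
    have "\<bar>c x powr s - c y powr s\<bar> * R powr - s \<le> 2 * s * c z powr (s - 1) * dist x y * R powr - s"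
      using clip c e s d by (intro mult_right_mono hardy_weight_lipschitz(1)[where \<epsilon> = e]) auto
    also have "\<bar>c x powr s - c y powr s\<bar> * R powr - s = \<bar>\<phi> x - \<phi> y\<bar>"
      unfolding \<phi>_def left_diff_distrib[symmetric] abs_mult by simp
    finally show "\<bar>\<phi> x - \<phi> y\<bar> \<le> l z * dist x y" by (simp add: l_def mult_ac)
  qed (use \<phi>1 less_imp_le[OF \<phi>0] in auto)
  have \<phi>p: "\<phi> y powr p = c y powr \<beta> * R powr - \<beta>" for y
    using c[of y] R s by (simp add: \<phi>_def powr_mult powr_powr)
  note [measurable] = test_pairD(1,5,6)[OF g'(1)]
  define J where "J = p_integral (\<lambda>y. u y / W y) {y. infdist y Z < R}"
  define a where "a k = 2 powr (p + \<beta>) * R powr \<beta> * r k powr (- p - \<beta>)" for k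
  have a0: "0 \<le> a k" for k by (simp add: a_def)
  have setm [measurable]: "{y. infdist y Z < t} \<in> sets N" for t by measurable
  have J1: "J \<le> (\<Sum>k\<le>n. ennreal (a k) * p_integral (\<lambda>y. u y * \<phi> y) {y. infdist y Z < r k})"
  proof -
    have "J \<le> (\<integral>\<^sup>+ y. (\<Sum>k\<le>n. ennreal (a k) * (ennreal ((u y * \<phi> y) powr p) * indicator {y. infdist y Z < r k} y)) \<partial>N)"
      unfolding J_def p_integral_def
    proof (rule nn_integral_mono)
      fix y
      show "ennreal ((u y / W y) powr p) * indicator {y. infdist y Z < R} y \<le>
        (\<Sum>k\<le>n. ennreal (a k) * (ennreal ((u y * \<phi> y) powr p) * indicator {y. infdist y Z < r k} y))"
      proof (cases "infdist y Z < R")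
        case True
        define A where "A = {k \<in> {..n}. infdist y Z < r k}"
        have A: "finite A" "0 \<in> A" using True r(3) by (auto simp: A_def)
        define k where "k = Max A"
        have k: "k \<in> A" "\<And>j. j \<in> A \<Longrightarrow> j \<le> k" unfolding k_def using A by (auto intro: Max_in)
        \<comment> \<open>The smallest scale above the distance of \<open>y\<close> is comparable to it.\<close>
        have "r k \<le> 2 * W y"
        proof (cases "k = n")
          case True then show ?thesis using W[of y] e by (simp add: e_def)
        next
          case False
          then have "Suc k \<le> n" using k(1) by (auto simp: A_def)
          then have "\<not> infdist y Z < r (Suc k)" using k(2)[of "Suc k"] by (auto simp: A_def)
          then show ?thesis using r(2)[of k] W(3)[of y] by linarith
        qed
        then have "(2 * W y) powr (- p - \<beta>) \<le> r k powr (- p - \<beta>)" using r(1) p \<beta> by (intro powr_mono2') auto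
        then have "2 powr (p + \<beta>) * R powr \<beta> * (2 * W y) powr (- p - \<beta>) * (u y powr p * (W y powr \<beta> * R powr - \<beta>))
            \<le> a k * (u y powr p * (W y powr \<beta> * R powr - \<beta>))"
          unfolding a_def by (intro mult_right_mono mult_left_mono) auto
        moreover have "2 powr (p + \<beta>) * R powr \<beta> * (2 * W y) powr (- p - \<beta>) * (u y powr p * (W y powr \<beta> * R powr - \<beta>)) = (u y / W y) powr p"
        proof -
          have "(2 * W y) powr (- p - \<beta>) = 2 powr (- p - \<beta>) * W y powr (- p - \<beta>)" using W[of y] by (simp add: powr_mult)
          moreover have "2 powr (p + \<beta>) * 2 powr (- p - \<beta>) = (1 :: real)" by (simp add: powr_add[symmetric])
          moreover have "R powr \<beta> * R powr - \<beta> = 1" using R by (simp add: powr_add[symmetric])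
          moreover have "W y powr (- p - \<beta>) * W y powr \<beta> = W y powr - p" by (simp add: powr_add[symmetric])
          moreover have "(u y / W y) powr p = u y powr p * W y powr - p"
            using test_pairD(2)[OF u(1), of y] W[of y] by (simp add: powr_divide powr_minus_divide)
          ultimately show ?thesis by algebra
        qed
        moreover have "(u y * \<phi> y) powr p = u y powr p * (W y powr \<beta> * R powr - \<beta>)"
          using test_pairD(2)[OF u(1), of y] \<phi>0[of y] \<phi>p[of y] cW[OF True] by (simp add: powr_mult)
        ultimately have "(u y / W y) powr p \<le> a k * (u y * \<phi> y) powr p" by simp
        then have "ennreal ((u y / W y) powr p) * indicator {y. infdist y Z < R} y \<le>
          ennreal (a k) * (ennreal ((u y * \<phi> y) powr p) * indicator {y. infdist y Z < r k} y)"
          using True k(1) a0[of k] by (simp add: A_def ennreal_mult[symmetric] ennreal_leI)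
        also have "\<dots> \<le> (\<Sum>k\<le>n. ennreal (a k) * (ennreal ((u y * \<phi> y) powr p) * indicator {y. infdist y Z < r k} y))"
          using k(1) by (intro member_le_sum) (auto simp: A_def)
        finally show ?thesis .
      qed simp
    qed
    also have "\<dots> = (\<Sum>k\<le>n. ennreal (a k) * p_integral (\<lambda>y. u y * \<phi> y) {y. infdist y Z < r k})"
      unfolding p_integral_def by (simp add: nn_integral_sum nn_integral_cmult)
    finally show ?thesis .
  qed
  define b where "b k = a k * (C0 * r k powr p)" for k
  have b: "b k = C0 * 2 powr (p + \<beta>) * R powr \<beta> * r k powr - \<beta>" for k
    unfolding b_def a_def using powr_add[of "r k" "- p - \<beta>" p] by simp
  have b0: "0 \<le> b k" for k using C0 by (simp add: b)
  let ?h = "\<lambda>y. ennreal (\<Gamma> / 2 powr p * R powr \<beta> * W y powr - \<beta>)"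
  have "J \<le> (\<Sum>k\<le>n. ennreal (a k) * (ennreal (C0 * r k powr p) * energy g' {y. infdist y Z < K * r k}))"
    using u(2) by (intro order_trans[OF J1] sum_mono mult_left_mono layer[OF g'(1)] r) auto
  also have "\<dots> = (\<Sum>k\<le>n. ennreal (b k) * energy g' {y. infdist y Z < K * r k})"
    using a0 C0 by (intro sum.cong) (auto simp: b_def ennreal_mult mult.assoc)
  also have "\<dots> = (\<integral>\<^sup>+ y. epow (g' y) p * (\<Sum>k\<le>n. ennreal (b k) * indicator {y. infdist y Z < K * r k} y) \<partial>N)"
  proof -
    have "(\<Sum>k\<le>n. ennreal (b k) * energy g' {y. infdist y Z < K * r k}) =
      (\<integral>\<^sup>+ y. (\<Sum>k\<le>n. ennreal (b k) * (epow (g' y) p * indicator {y. infdist y Z < K * r k} y)) \<partial>N)"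
      unfolding energy_def by (subst nn_integral_sum) (auto simp: nn_integral_cmult)
    also have "\<dots> = (\<integral>\<^sup>+ y. epow (g' y) p * (\<Sum>k\<le>n. ennreal (b k) * indicator {y. infdist y Z < K * r k} y) \<partial>N)"
      by (simp only: sum_distrib_left mult.left_commute)
    finally show ?thesis .
  qed
  also have "\<dots> \<le> (\<integral>\<^sup>+ y. epow (g' y) p * ?h y \<partial>N)"
  proof (intro nn_integral_mono mult_left_mono)
    fix y
    define A where "A = {k \<in> {..n}. infdist y Z < K * r k}"
    have "(\<Sum>k\<le>n. ennreal (b k) * indicator {y. infdist y Z < K * r k} y) = (\<Sum>k\<in>A. ennreal (b k))"
      by (rule sum.mono_neutral_cong_right) (auto simp: A_def)
    also have "\<dots> = ennreal (C0 * 2 powr (p + \<beta>) * R powr \<beta> * (\<Sum>k\<in>A. r k powr - \<beta>))"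
      using b0 by (simp add: b sum_ennreal sum_distrib_left)
    also have "\<dots> \<le> ?h y"
    proof (rule ennreal_leI)
      have "(\<Sum>k\<in>A. r k powr - \<beta>) \<le> (W y / K) powr - \<beta> / (1 - 2 powr - \<beta>)"
        unfolding r_def
      proof (rule geometric_scale_sum[OF R \<beta>(1)])
        show "0 < W y / K" using W[of y] K by simp
        show "W y / K \<le> R / 2 ^ k" if "k \<in> A" for k
        proof -
          have "e \<le> r k" "infdist y Z < K * r k" using that re by (auto simp: A_def)
          moreover have "1 * r k \<le> K * r k" using K r(1)[of k] by (intro mult_right_mono) auto
          ultimately have "W y \<le> K * r k" by (auto simp: W_def)
          then show ?thesis using K by (simp add: r_def field_simps)
        qed
      qed (auto simp: A_def)
      also have "(W y / K) powr - \<beta> = K powr \<beta> * W y powr - \<beta>"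
        using W[of y] K by (simp add: powr_divide powr_minus_divide)
      finally have "C0 * 2 powr (p + \<beta>) * R powr \<beta> * (\<Sum>k\<in>A. r k powr - \<beta>) \<le>
        C0 * 2 powr (p + \<beta>) * R powr \<beta> * (K powr \<beta> * W y powr - \<beta> / (1 - 2 powr - \<beta>))"
        using C0 by (intro mult_left_mono) auto
      also have "\<dots> = \<Gamma> / 2 powr p * R powr \<beta> * W y powr - \<beta>" unfolding \<Gamma> by simp
      finally show "C0 * 2 powr (p + \<beta>) * R powr \<beta> * (\<Sum>k\<in>A. r k powr - \<beta>) \<le> \<Gamma> / 2 powr p * R powr \<beta> * W y powr - \<beta>" .
    qed
    finally show "(\<Sum>k\<le>n. ennreal (b k) * indicator {y. infdist y Z < K * r k} y) \<le> ?h y" .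
  qed simp
  also have "\<dots> \<le> (\<integral>\<^sup>+ y. ennreal (\<Gamma> * 2 powr p) * epow (g y) p + ennreal (\<Gamma> * (2 * s) powr p) * ennreal ((u y / c y) powr p) \<partial>N)"
  proof (rule nn_integral_mono_AE, use g'(2) in eventually_elim)
    case (elim y)
    have k1: "R powr \<beta> * W y powr - \<beta> * (c y powr \<beta> * R powr - \<beta>) \<le> 1"
    proof -
      have "c y powr \<beta> * W y powr - \<beta> \<le> W y powr \<beta> * W y powr - \<beta>"
        using c[of y] \<beta> by (intro mult_right_mono powr_mono2) auto
      also have "\<dots> = 1" using W[of y] by (simp add: powr_add[symmetric])
      finally have "c y powr \<beta> * W y powr - \<beta> \<le> 1" .
      moreover have "R powr \<beta> * R powr - \<beta> = 1" using R by (simp add: powr_add[symmetric])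
      ultimately show ?thesis by (metis (no_types, opaque_lifting) mult.assoc mult.commute mult_1)
    qed
    have k2: "R powr \<beta> * W y powr - \<beta> * (2 * \<phi> y) powr p \<le> 2 powr p"
      using mult_left_mono[OF k1, of "2 powr p"] \<phi>0[of y] by (simp add: powr_mult \<phi>p mult_ac)
    have lp: "l y powr p = (2 * s) powr p * (R powr - \<beta> * c y powr \<beta>) * c y powr - p"
    proof -
      have "l y powr p = (2 * s) powr p * (R powr (- s * p)) * c y powr ((s - 1) * p)"
        using s c[of y] R by (simp add: l_def powr_mult powr_powr)
      moreover have "- s * p = - \<beta>" "(s - 1) * p = \<beta> + - p" using s(3) by (auto simp: algebra_simps)
      ultimately show ?thesis by (simp only: powr_add mult.assoc)
    qed
    have k3: "R powr \<beta> * W y powr - \<beta> * (u y * l y) powr p \<le> (2 * s) powr p * (u y / c y) powr p"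
    proof -
      have "(u y / c y) powr p = u y powr p * c y powr - p"
        using test_pairD(2)[OF u(1), of y] c[of y] by (simp add: powr_divide powr_minus_divide)
      moreover have "(u y * l y) powr p = u y powr p * l y powr p"
        using test_pairD(2)[OF u(1), of y] s by (simp add: powr_mult l_def)
      moreover have "R powr \<beta> * W y powr - \<beta> * (c y powr \<beta> * R powr - \<beta>) * ((2 * s) powr p * (u y powr p * c y powr - p)) \<le>
          1 * ((2 * s) powr p * (u y powr p * c y powr - p))"
        by (intro mult_right_mono k1) auto
      ultimately show ?thesis unfolding lp by (simp add: mult_ac)
    qed
    have "epow (g' y) p * ?h y \<le> ennreal (2 powr p) * (epow (g y) p * ennreal ((2 * \<phi> y) powr p) + ennreal ((u y * l y) powr p)) * ?h y"
      by (intro mult_right_mono elim) simp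
    also have "\<dots> = epow (g y) p * ennreal (\<Gamma> * (R powr \<beta> * W y powr - \<beta> * (2 * \<phi> y) powr p)) + ennreal (\<Gamma> * (R powr \<beta> * W y powr - \<beta> * (u y * l y) powr p))"
    proof -
      have x: "ennreal (2 powr p) * ?h y = ennreal (\<Gamma> * (R powr \<beta> * W y powr - \<beta>))"
        using \<Gamma>0 by (subst ennreal_mult[symmetric]) (auto simp: mult_ac)
      have y: "ennreal (\<Gamma> * (R powr \<beta> * W y powr - \<beta>)) * ennreal t = ennreal (\<Gamma> * (R powr \<beta> * W y powr - \<beta> * t))" if "0 \<le> t" for t
        using \<Gamma>0 that by (subst ennreal_mult[symmetric]) (auto simp: mult_ac)
      have "ennreal (2 powr p) * (epow (g y) p * ennreal ((2 * \<phi> y) powr p) + ennreal ((u y * l y) powr p)) * ?h y =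
        epow (g y) p * ((ennreal (2 powr p) * ?h y) * ennreal ((2 * \<phi> y) powr p)) + (ennreal (2 powr p) * ?h y) * ennreal ((u y * l y) powr p)"
        by (simp add: distrib_left distrib_right mult_ac)
      then show ?thesis unfolding x by (simp add: y)
    qed
    also have "\<dots> \<le> epow (g y) p * ennreal (\<Gamma> * 2 powr p) + ennreal (\<Gamma> * ((2 * s) powr p * (u y / c y) powr p))"
      using \<Gamma>0 by (intro add_mono mult_left_mono ennreal_leI k2 k3) auto
    also have "ennreal (\<Gamma> * ((2 * s) powr p * (u y / c y) powr p)) = ennreal (\<Gamma> * (2 * s) powr p) * ennreal ((u y / c y) powr p)"
      using \<Gamma>0 by (subst ennreal_mult[symmetric]) (auto simp: mult_ac)
    finally show ?case by (simp add: mult.commute)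
  qed
  also have "\<dots> = ennreal (\<Gamma> * 2 powr p) * energy g UNIV + ennreal (\<Gamma> * (2 * s) powr p) * p_integral (\<lambda>y. u y / c y) UNIV"
    unfolding energy_def p_integral_def by (simp add: nn_integral_add nn_integral_cmult)
  also have "\<dots> \<le> ennreal (\<Gamma> * 2 powr p) * energy g UNIV + ennreal (1 / 2) * (J + ennreal (R powr - p) * p_integral u UNIV)"
  proof (intro add_mono mult_mono ennreal_leI)
    show "\<Gamma> * (2 * s) powr p \<le> 1 / 2" using \<Gamma>(2) by (simp add: s_def)
    have "p_integral (\<lambda>y. u y / c y) UNIV \<le> (\<integral>\<^sup>+ y. ennreal ((u y / W y) powr p) * indicator {y. infdist y Z < R} y + ennreal (R powr - p) * ennreal (u y powr p) \<partial>N)"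
      unfolding p_integral_def
    proof (rule nn_integral_mono)
      fix y
      show "ennreal ((u y / c y) powr p) * indicator UNIV y \<le>
        ennreal ((u y / W y) powr p) * indicator {y. infdist y Z < R} y + ennreal (R powr - p) * ennreal (u y powr p)"
      proof (cases "infdist y Z < R")
        case True then show ?thesis using cW[OF True] by (simp add: add_increasing2)
      next
        case False
        have "(u y / R) powr p = R powr - p * u y powr p"
          using test_pairD(2)[OF u(1), of y] R by (simp add: powr_divide powr_minus_divide)
        then show ?thesis using cR[OF False] False by (simp add: ennreal_mult)
      qed
    qed
    also have "\<dots> = J + ennreal (R powr - p) * p_integral u UNIV"
      unfolding J_def p_integral_def by (simp add: nn_integral_add nn_integral_cmult)
    finally show "p_integral (\<lambda>y. u y / c y) UNIV \<le> J + ennreal (R powr - p) * p_integral u UNIV" .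
  qed (use \<Gamma>0 in auto)
  finally have J2: "J \<le> ennreal (\<Gamma> * 2 powr p * E) + ennreal (1 / 2) * (J + ennreal (R powr - p * P))"
    using E P \<Gamma>0 by (simp add: ennreal_mult)
  have "J \<le> p_integral (\<lambda>y. 1 / e * u y) UNIV"
    unfolding J_def
  proof (rule p_integral_mono)
    fix y
    have "u y / W y \<le> u y / e" using W[of y] e test_pairD(2)[OF u(1), of y] by (intro divide_left_mono) auto
    then show "0 \<le> u y / W y \<and> u y / W y \<le> 1 / e * u y" using W[of y] test_pairD(2)[OF u(1), of y] by simp
  qed simp
  also have "\<dots> = ennreal ((1 / e) powr p) * ennreal P"
    unfolding P(1)[symmetric] using e test_pairD(2)[OF u(1)] by (intro p_integral_cmult) auto
  also have "\<dots> < \<infinity>" by (simp add: ennreal_mult_less_top)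
  finally obtain j where j: "J = ennreal j" "0 \<le> j" by (cases J) auto
  have nn: "0 \<le> R powr - p * P" "0 \<le> \<Gamma> * 2 powr p * E" using P E \<Gamma>0 by auto
  have "ennreal j \<le> ennreal (\<Gamma> * 2 powr p * E + 1 / 2 * (j + R powr - p * P))"
    using J2 nn j by (simp only: j(1) ennreal_plus[symmetric] ennreal_mult[symmetric]) (simp add: ennreal_plus ennreal_mult)
  then have "j \<le> \<Gamma> * 2 powr p * E + 1 / 2 * (j + R powr - p * P)"
    using nn j by (subst (asm) ennreal_le_iff) auto
  then have "j \<le> 2 * \<Gamma> * 2 powr p * E + R powr - p * P" by (simp add: algebra_simps)
  then show ?thesis using j(1) unfolding J_def W_def e_def r_def by (simp add: ennreal_leI)
qed

text \<open>
  The truncations are removed by monotone convergence: \<open>n\<close> tends to infinity first, and then \<open>R\<close>. The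
  term \<open>R\<^sup>-\<^sup>p P\<close> disappears because \<open>u\<close> is in \<open>L\<^sup>p\<close>.
\<close>

lemma fat_hardy:
  assumes cF: "0 < cF" and fat: "\<And>x r. x \<in> Z \<Longrightarrow> 0 < r \<Longrightarrow>
    ennreal cF * cap M p (ball x r) (ball x (2 * r)) \<le> cap M p (Z \<inter> ball x r) (ball x (2 * r))"
    and Z: "Z \<noteq> {}"
  shows "\<exists>C>0. \<forall>g u. test_pair g u \<longrightarrow> (\<forall>y\<in>Z. u y = 0) \<longrightarrow> p_integral u UNIV < \<infinity> \<longrightarrow>
    p_integral (\<lambda>y. u y / infdist y Z) UNIV \<le> ennreal C * energy g UNIV"
proof -
  obtain C0 where C0: "0 < C0" "\<And>g v r. test_pair g v \<Longrightarrow> (\<forall>y\<in>Z. v y = 0) \<Longrightarrow> 0 < r \<Longrightarrow>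
    p_integral v {y. infdist y Z < r} \<le> ennreal (C0 * r powr p) * energy g {y. infdist y Z < 8 * lam * r}"
    using layer_estimate[OF cF fat Z] by blast
  have K: "1 \<le> 8 * lam" using lam by simp
  obtain \<beta> where \<beta>: "0 < \<beta>" "\<beta> \<le> 1" 
    "C0 * 2 powr (p + \<beta>) * (8 * lam) powr \<beta> / (1 - 2 powr - \<beta>) * 2 powr p * (2 * (\<beta> / p)) powr p \<le> 1 / 2"
    using wannebo_parameter[OF C0(1) K] by blast
  define \<Gamma> where "\<Gamma> = C0 * 2 powr (p + \<beta>) * (8 * lam) powr \<beta> / (1 - 2 powr - \<beta>) * 2 powr p"
  have \<Gamma>: "\<Gamma> * (2 * (\<beta> / p)) powr p \<le> 1 / 2" using \<beta>(3) by (simp add: \<Gamma>_def)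
  have "2 powr - \<beta> < 1" using \<beta> by (simp add: powr_less_one)
  then have \<Gamma>0: "0 < \<Gamma>" unfolding \<Gamma>_def using C0(1) lam by simp
  define CH where "CH = 2 * \<Gamma> * 2 powr p"
  have CH: "0 < CH" using \<Gamma>0 by (simp add: CH_def)
  have main: "p_integral (\<lambda>y. u y / infdist y Z) UNIV \<le> ennreal CH * energy g UNIV"
    if u: "test_pair g u" "\<forall>y\<in>Z. u y = 0" "p_integral u UNIV < \<infinity>" for g u
  proof (cases "energy g UNIV = \<infinity>")
    case True then show ?thesis using CH by (simp add: ennreal_mult_top)
  next
    case False
    obtain E where E: "energy g UNIV = ennreal E" "0 \<le> E" using False by (cases "energy g UNIV") auto
    obtain P where P: "p_integral u UNIV = ennreal P" "0 \<le> P" using u(3) by (cases "p_integral u UNIV") auto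
    note [measurable] = test_pairD(1)[OF u(1)]
    have bound: "p_integral (\<lambda>y. u y / infdist y Z) {y. infdist y Z < R} \<le> ennreal (CH * E + R powr - p * P)" if R: "0 < R" for R
      unfolding p_integral_def
    proof (rule nn_integral_exhaust_le[where B = "\<lambda>n. {y. infdist y Z = 0 \<or> R / 2 ^ n \<le> infdist y Z}"])
      show "incseq (\<lambda>n. {y. infdist y Z = 0 \<or> R / 2 ^ n \<le> infdist y Z})"
      proof (rule monoI)
        fix m n :: nat assume "m \<le> n"
        then have "R / 2 ^ n \<le> R / 2 ^ m" using R by (intro divide_left_mono power_increasing) auto
        then show "{y. infdist y Z = 0 \<or> R / 2 ^ m \<le> infdist y Z} \<subseteq> {y. infdist y Z = 0 \<or> R / 2 ^ n \<le> infdist y Z}"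
          by auto
      qed
      show "{y. infdist y Z < R} \<subseteq> (\<Union>n. {y. infdist y Z = 0 \<or> R / 2 ^ n \<le> infdist y Z})"
      proof
        fix y
        show "y \<in> (\<Union>n. {y. infdist y Z = 0 \<or> R / 2 ^ n \<le> infdist y Z})"
        proof (cases "infdist y Z = 0")
          case False
          then have d: "0 < infdist y Z" using infdist_nonneg[of y Z] by simp
          obtain n where "R / infdist y Z < 2 ^ n" using real_arch_pow[of 2] by auto
          then have "R / 2 ^ n \<le> infdist y Z" using d by (simp add: field_simps)
          then show ?thesis by blast
        qed auto
      qed
      fix n
      have "(\<integral>\<^sup>+ y \<in> {y. infdist y Z < R} \<inter> {y. infdist y Z = 0 \<or> R / 2 ^ n \<le> infdist y Z}. ennreal ((u y / infdist y Z) powr p) \<partial>N) \<le>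
        p_integral (\<lambda>y. u y / max (infdist y Z) (R / 2 ^ n)) {y. infdist y Z < R}"
        unfolding p_integral_def
      proof (rule nn_integral_mono)
        fix y
        show "ennreal ((u y / infdist y Z) powr p) * indicator ({y. infdist y Z < R} \<inter> {y. infdist y Z = 0 \<or> R / 2 ^ n \<le> infdist y Z}) y \<le>
          ennreal ((u y / max (infdist y Z) (R / 2 ^ n)) powr p) * indicator {y. infdist y Z < R} y"
          by (cases "R / 2 ^ n \<le> infdist y Z") (auto simp: indicator_def max_absorb1)
      qed
      also have "\<dots> \<le> ennreal (CH * E + R powr - p * P)"
        unfolding CH_def by (rule fat_hardy_truncated[OF C0 K \<beta>(1,2) \<Gamma>_def \<Gamma> u(1,2) P E R])
      finally show "(\<integral>\<^sup>+ y \<in> {y. infdist y Z < R} \<inter> {y. infdist y Z = 0 \<or> R / 2 ^ n \<le> infdist y Z}. ennreal ((u y / infdist y Z) powr p) \<partial>N) \<le>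
        ennreal (CH * E + R powr - p * P)" .
    qed measurable
    show ?thesis
    proof (rule ennreal_le_epsilon)
      fix \<epsilon> :: real assume \<epsilon>: "0 < \<epsilon>"
      have "((\<lambda>R. R powr - p * P) \<longlongrightarrow> 0 * P) at_top"
        using p by (intro tendsto_mult tendsto_const tendsto_neg_powr filterlim_ident) auto
      then have "\<forall>\<^sub>F R in at_top. R powr - p * P < \<epsilon>" using order_tendstoD(2)[of _ "0 * P" at_top \<epsilon>] \<epsilon> by simp
      then obtain R0 where R0: "\<And>R. R0 \<le> R \<Longrightarrow> R powr - p * P < \<epsilon>" by (auto simp: eventually_at_top_linorder)
      define R1 where "R1 = max 1 R0"
      have "p_integral (\<lambda>y. u y / infdist y Z) UNIV \<le> ennreal (CH * E + \<epsilon>)"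
        unfolding p_integral_def
      proof (rule nn_integral_exhaust_le[where B = "\<lambda>n. {y. infdist y Z < R1 + real n}"])
        show "incseq (\<lambda>n. {y. infdist y Z < R1 + real n})" by (auto simp: incseq_def)
        show "UNIV \<subseteq> (\<Union>n. {y. infdist y Z < R1 + real n})"
        proof
          fix y
          obtain n where "infdist y Z < real n" using reals_Archimedean2 by blast
          then have "infdist y Z < R1 + real n" by (simp add: R1_def)
          then show "y \<in> (\<Union>n. {y. infdist y Z < R1 + real n})" by blast
        qed
        fix n
        have R: "0 < R1 + real n" "R0 \<le> R1 + real n" by (auto simp: R1_def)
        show "(\<integral>\<^sup>+ y \<in> UNIV \<inter> {y. infdist y Z < R1 + real n}. ennreal ((u y / infdist y Z) powr p) \<partial>N) \<le> ennreal (CH * E + \<epsilon>)"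
          using order_trans[OF bound[OF R(1)] ennreal_leI[of _ "CH * E + \<epsilon>"]] R0[OF R(2)] by (simp add: p_integral_def)
      qed measurable
      also have "\<dots> = ennreal CH * energy g UNIV + ennreal \<epsilon>"
        unfolding E(1) using CH E \<epsilon> by (simp add: ennreal_mult)
      finally show "p_integral (\<lambda>y. u y / infdist y Z) UNIV \<le> ennreal CH * energy g UNIV + ennreal \<epsilon>" .
    qed
  qed
  show ?thesis using CH main by blast
qed

end

lemma le_suminf_term:
  fixes f :: "nat \<Rightarrow> ennreal"
  shows "f k \<le> (\<Sum>i. f i)"
  using sum_le_suminf[of f "{k}"] by simp

section \<open>Overlap of Whitney balls\<close>

context doubling_space begin

text \<open>
  All enlarged balls that contain a given point \<open>y\<close> have radii comparable to the distance of \<open>y\<close> to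
  the boundary. The Whitney balls in them lie in one ball of comparable volume, where their bounded
  overlap limits their number.
\<close>

lemma whitney_overlap:
  assumes c: "0 < c" "c \<le> 1" and \<theta>: "0 < \<theta>" "\<theta> < 1"
  shows "\<exists>n. \<forall>F I (z :: 'i \<Rightarrow> 'a). (\<forall>i\<in>I. 0 < infdist (z i) F) \<longrightarrow>
    (\<forall>x. finite {i \<in> I. x \<in> ball (z i) (c * infdist (z i) F)} \<and> card {i \<in> I. x \<in> ball (z i) (c * infdist (z i) F)} \<le> n0) \<longrightarrow>
    (\<forall>x. finite {i \<in> I. x \<in> ball (z i) (\<theta> * infdist (z i) F)} \<and> card {i \<in> I. x \<in> ball (z i) (\<theta> * infdist (z i) F)} \<le> n)"
proof -
  define t where "t = (2 * (1 + \<theta>) / (1 - \<theta>) + \<theta>) / c"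
  obtain K where K: "1 \<le> K" "\<And>x y r s. 0 < r \<Longrightarrow> s + dist x y \<le> t * r \<Longrightarrow> vol y s \<le> K * vol x r"
    using vol_comparable[of t] by auto
  show ?thesis
  proof (intro exI[of _ "nat \<lceil>n0 * K\<rceil>"] allI impI)
    fix F I and z :: "'i \<Rightarrow> 'a" and y
    assume pos: "\<forall>i\<in>I. 0 < infdist (z i) F"
    assume ov: "\<forall>x. finite {i \<in> I. x \<in> ball (z i) (c * infdist (z i) F)} \<and> card {i \<in> I. x \<in> ball (z i) (c * infdist (z i) F)} \<le> n0"
    let ?S = "{i \<in> I. y \<in> ball (z i) (\<theta> * infdist (z i) F)}"
    have "card T \<le> nat \<lceil>n0 * K\<rceil>" if T: "finite T" "T \<subseteq> ?S" for T
    proof (cases "T = {}")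
      case False
      define \<delta> where "\<delta> = infdist y F"
      define R where "R = 2 * \<delta> / (1 - \<theta>)"
      have d: "0 < infdist (z i) F" "dist (z i) y < \<theta> * infdist (z i) F" "(1 - \<theta>) * infdist (z i) F < \<delta>" "\<delta> < (1 + \<theta>) * infdist (z i) F"
        if "i \<in> T" for i
      proof -
        show 1: "0 < infdist (z i) F" "dist (z i) y < \<theta> * infdist (z i) F" using T that pos by auto
        have "\<bar>infdist (z i) F - \<delta>\<bar> \<le> dist (z i) y" unfolding \<delta>_def by (rule infdist_triangle_abs)
        then show "(1 - \<theta>) * infdist (z i) F < \<delta>" "\<delta> < (1 + \<theta>) * infdist (z i) F"
          using 1 by (auto simp: algebra_simps)
      qed
      obtain i0 where "i0 \<in> T" using False by blast
      then have "0 < (1 - \<theta>) * infdist (z i0) F" using d(1) \<theta> by simp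
      then have "0 < \<delta>" using d(3)[OF \<open>i0 \<in> T\<close>] by linarith
      then have R: "0 < R" using \<theta> by (simp add: R_def)
      have V: "0 < vol y R" by (rule vol_pos[OF R])
      have "real (card T) * (vol y R / K) = (\<Sum>i\<in>T. vol y R / K)" by simp
      also have "\<dots> \<le> (\<Sum>i\<in>T. vol (z i) (c * infdist (z i) F))"
      proof (rule sum_mono)
        fix i assume i: "i \<in> T"
        have "vol y R \<le> K * vol (z i) (c * infdist (z i) F)"
        proof (rule K(2))
          show "0 < c * infdist (z i) F" using d(1)[OF i] c by simp
          have "R \<le> 2 * ((1 + \<theta>) * infdist (z i) F) / (1 - \<theta>)"
            unfolding R_def using d(4)[OF i] \<theta> by (intro divide_right_mono mult_left_mono) auto
          then have "R + dist (z i) y \<le> 2 * ((1 + \<theta>) * infdist (z i) F) / (1 - \<theta>) + \<theta> * infdist (z i) F"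
            using d(2)[OF i] by linarith
          also have "\<dots> = (2 * (1 + \<theta>) / (1 - \<theta>) + \<theta>) * infdist (z i) F" by (simp add: distrib_right)
          also have "2 * (1 + \<theta>) / (1 - \<theta>) + \<theta> = t * c" using c by (simp add: t_def)
          also have "t * c * infdist (z i) F = t * (c * infdist (z i) F)" by (rule mult.assoc)
          finally show "R + dist (z i) y \<le> t * (c * infdist (z i) F)" .
        qed
        then show "vol y R / K \<le> vol (z i) (c * infdist (z i) F)" using K(1) by (simp add: field_simps)
      qed
      also have "\<dots> \<le> n0 * vol y R"
      proof (rule sum_vol_overlap_le[OF T(1) _ _ _ R])
        show "0 < c * infdist (z i) F" if "i \<in> T" for i using d(1)[OF that] c by simp
        show "ball (z i) (c * infdist (z i) F) \<subseteq> ball y R" if "i \<in> T" for i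
        proof (rule ball_subset_ballI)
          have "c * infdist (z i) F + dist y (z i) \<le> 1 * infdist (z i) F + 1 * infdist (z i) F"
          proof (rule add_mono)
            show "c * infdist (z i) F \<le> 1 * infdist (z i) F" using c d(1)[OF that] by (intro mult_right_mono) auto
            have "\<theta> * infdist (z i) F \<le> 1 * infdist (z i) F" using \<theta> d(1)[OF that] by (intro mult_right_mono) auto
            then show "dist y (z i) \<le> 1 * infdist (z i) F" using d(2)[OF that] by (simp add: dist_commute)
          qed
          also have "\<dots> \<le> R" unfolding R_def using d(3)[OF that] \<theta> by (simp add: field_simps)
          finally show "c * infdist (z i) F + dist y (z i) \<le> R" .
        qed
        fix x
        have "card {i \<in> T. x \<in> ball (z i) (c * infdist (z i) F)} \<le> card {i \<in> I. x \<in> ball (z i) (c * infdist (z i) F)}"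
          by (rule card_mono) (use ov T in auto)
        then show "card {i \<in> T. x \<in> ball (z i) (c * infdist (z i) F)} \<le> n0" using ov by (meson le_trans)
      qed
      finally have "real (card T) \<le> n0 * K" using V K(1) by (simp add: field_simps)
      then show ?thesis by linarith
    qed simp
    then show "finite ?S \<and> card ?S \<le> nat \<lceil>n0 * K\<rceil>"
      using finite_if_finite_subsets_card_bdd[of ?S "nat \<lceil>n0 * K\<rceil>"] by blast
  qed
qed

end

section \<open>Integrals of negative powers of the distance\<close>

context growing_poincare_space begin

text \<open>
  In HOL the integrand is \<open>0\<close> on \<open>F\<close>, instead of infinite. So this integral is at most the one in
  the definition of the codimension, and it measures only what happens off \<open>F\<close>.
\<close>

definition dist_power :: "'a set \<Rightarrow> real \<Rightarrow> 'a set \<Rightarrow> ennreal" where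
  "dist_power F q A = (\<integral>\<^sup>+ y \<in> A. ennreal (infdist y F powr - q) \<partial>N)"

text \<open>
  The ball is split into the annuli between the radii \<open>R / 2\<^sup>k\<^sup>+\<^sup>1\<close> and \<open>R / 2\<^sup>k\<close>, which contribute at
  most a geometric series with ratio \<open>2\<^sup>q\<^sup>-\<^sup>Q\<close>.
\<close>

lemma point_integral_le:
  assumes q: "0 < q" "q < Q"
  shows "\<exists>C>0. \<forall>x R. 0 < R \<longrightarrow> dist_power {x} q (ball x R) \<le> ennreal (C * (R powr - q * vol x R))"
proof -
  define C1 where "C1 = max 1 Cq"
  define \<kappa> where "\<kappa> = 2 powr (q - Q)"
  have \<kappa>: "0 < \<kappa>" "\<kappa> < 1" using q by (auto simp: \<kappa>_def powr_less_one)
  define C where "C = C1 * 2 powr q * (1 / (1 - \<kappa>))"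
  have C: "0 < C" using \<kappa> by (simp add: C_def C1_def)
  have "dist_power {x} q (ball x R) \<le> ennreal (C * (R powr - q * vol x R))" if R: "0 < R" for x R
  proof -
    have grow: "vol x (R / 2 ^ k) \<le> C1 * (1 / 2 ^ k) powr Q * vol x R" for k
    proof (cases k)
      case 0 then show ?thesis using vol_pos[OF R, of x] by (simp add: C1_def)
    next
      case (Suc j)
      have "1 < (2::real) ^ k" using Suc by (intro one_less_power) auto
      then have "R / 2 ^ k < R" using R by (simp add: field_simps)
      then have "vol x (R / 2 ^ k) \<le> Cq * (R / 2 ^ k / R) powr Q * vol x R" using R by (intro growth) auto
      also have "\<dots> \<le> C1 * (R / 2 ^ k / R) powr Q * vol x R" by (intro mult_right_mono) (auto simp: C1_def)
      finally show ?thesis using R by simp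
    qed
    have "dist_power {x} q (ball x R) \<le> (\<integral>\<^sup>+ y. (\<Sum>k. ennreal ((R / 2 ^ Suc k) powr - q) * indicator (ball x (R / 2 ^ k)) y) \<partial>N)"
      unfolding dist_power_def
    proof (rule nn_integral_mono)
      fix y
      show "ennreal (infdist y {x} powr - q) * indicator (ball x R) y \<le> (\<Sum>k. ennreal ((R / 2 ^ Suc k) powr - q) * indicator (ball x (R / 2 ^ k)) y)"
      proof (cases "y \<in> ball x R \<and> y \<noteq> x")
        case False then show ?thesis by auto
      next
        case True
        then have d: "0 < dist x y" "dist x y < R" by auto
        define k where "k = (LEAST k. R / 2 ^ Suc k \<le> dist x y)"
        obtain k0 where "R / dist x y < 2 ^ k0" using real_arch_pow[of 2] by auto
        then have "R < dist x y * 2 ^ k0" "0 < dist x y * 2 ^ k0" using d by (simp_all add: field_simps)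
        then have "R \<le> dist x y * 2 ^ Suc k0" by simp
        then have "R / 2 ^ Suc k0 \<le> dist x y" by (simp add: pos_divide_le_eq del: power_Suc)
        then have k: "R / 2 ^ Suc k \<le> dist x y" unfolding k_def by (rule LeastI)
        have "dist x y < R / 2 ^ k"
        proof (cases k)
          case 0 then show ?thesis using d by simp
        next
          case (Suc j)
          then have "\<not> R / 2 ^ Suc j \<le> dist x y" unfolding k_def by (intro not_less_Least) auto
          then show ?thesis using Suc by simp
        qed
        then have "ennreal (infdist y {x} powr - q) * indicator (ball x R) y \<le> ennreal ((R / 2 ^ Suc k) powr - q) * indicator (ball x (R / 2 ^ k)) y"
          using True k R q by (simp add: dist_commute ennreal_leI powr_mono2' del: power_Suc)
        also have "\<dots> \<le> (\<Sum>k. ennreal ((R / 2 ^ Suc k) powr - q) * indicator (ball x (R / 2 ^ k)) y)"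
          by (rule le_suminf_term)
        finally show ?thesis .
      qed
    qed
    also have "\<dots> = (\<Sum>k. ennreal ((R / 2 ^ Suc k) powr - q) * ennreal (vol x (R / 2 ^ k)))"
      using R by (simp add: nn_integral_suminf nn_integral_cmult_indicator emeasure_ball_eq del: power_Suc)
    also have "\<dots> \<le> (\<Sum>k. ennreal (C1 * 2 powr q * (R powr - q * vol x R) * \<kappa> ^ k))"
    proof (intro suminf_le)
      fix k
      have 1: "(R / 2 ^ Suc k) powr - q = R powr - q * 2 powr q * (2 ^ k) powr q"
        using R by (simp add: powr_divide powr_mult powr_minus_divide)
      have 2: "(2 ^ k) powr q * (1 / 2 ^ k) powr Q = \<kappa> ^ k"
        by (simp add: \<kappa>_def powr_realpow[symmetric] powr_powr powr_power powr_divide powr_diff[symmetric] algebra_simps)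
      have "(R / 2 ^ Suc k) powr - q * (C1 * (1 / 2 ^ k) powr Q * vol x R) = C1 * 2 powr q * (R powr - q * vol x R) * ((2 ^ k) powr q * (1 / 2 ^ k) powr Q)"
        unfolding 1 by (simp only: mult_ac)
      then have eq: "(R / 2 ^ Suc k) powr - q * (C1 * (1 / 2 ^ k) powr Q * vol x R) = C1 * 2 powr q * (R powr - q * vol x R) * \<kappa> ^ k"
        unfolding 2 .
      have "(R / 2 ^ Suc k) powr - q * vol x (R / 2 ^ k) \<le> (R / 2 ^ Suc k) powr - q * (C1 * (1 / 2 ^ k) powr Q * vol x R)"
        by (intro mult_left_mono grow) auto
      then show "ennreal ((R / 2 ^ Suc k) powr - q) * ennreal (vol x (R / 2 ^ k)) \<le> ennreal (C1 * 2 powr q * (R powr - q * vol x R) * \<kappa> ^ k)"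
        unfolding eq by (simp add: ennreal_mult[symmetric] ennreal_leI del: power_Suc)
    qed auto
    also have "\<dots> = ennreal (\<Sum>k. C1 * 2 powr q * (R powr - q * vol x R) * \<kappa> ^ k)"
      using \<kappa> by (intro suminf_ennreal2 summable_mult summable_geometric) (auto simp: C1_def)
    also have "(\<Sum>k. C1 * 2 powr q * (R powr - q * vol x R) * \<kappa> ^ k) = C * (R powr - q * vol x R)"
      using \<kappa> by (subst suminf_mult) (auto simp: suminf_geometric summable_geometric C_def)
    finally show ?thesis .
  qed
  then show ?thesis using C by blast
qed

text \<open>
  An exponent from the codimension may be lowered below \<open>Q\<close>: on a ball of radius \<open>r\<close> centred in \<open>F\<close>
  the distance to \<open>F\<close> is at most \<open>r\<close>.
\<close>

lemma codim_small_radii: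
  assumes codim: "ereal p < codim_A M F" and Q: "p < Q"
  shows "\<exists>q C. p < q \<and> q < Q \<and> 0 < C \<and> (\<forall>x\<in>F. \<forall>r. 0 < r \<longrightarrow> ennreal r < ediam F \<longrightarrow>
    dist_power F q (ball x r) \<le> ennreal (C * (r powr - q * vol x r)))"
proof -
  obtain q0 C0 where q0: "p < q0" and H: "\<And>x r. x \<in> F \<Longrightarrow> 0 < r \<Longrightarrow> ennreal r < ediam F \<Longrightarrow>
       aikawa_integral M F q0 x r \<le> ennreal (C0 * r powr (- q0) * measure M (ball x r))"
    using codim unfolding codim_A_def less_SUP_iff by auto
  define q where "q = min q0 ((p + Q) / 2)"
  define C where "C = max 1 C0"
  have "q \<le> (p + Q) / 2" by (simp only: q_def min.cobounded2)
  then have "q < Q" using Q by (simp add: field_simps)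
  moreover have "p < q" "q \<le> q0" using q0 Q by (auto simp: q_def)
  ultimately have q: "p < q" "q < Q" "q \<le> q0" "0 < q" using p by auto
  have "dist_power F q (ball x r) \<le> ennreal (C * (r powr - q * vol x r))"
    if x: "x \<in> F" and r: "0 < r" "ennreal r < ediam F" for x r
  proof -
    have "dist_power F q (ball x r) \<le> (\<integral>\<^sup>+ y. ennreal (r powr (q0 - q)) * (dist_neg_pow F q0 y * indicator (ball x r) y) \<partial>N)"
      unfolding dist_power_def
    proof (rule nn_integral_mono)
      fix y
      show "ennreal (infdist y F powr - q) * indicator (ball x r) y \<le> ennreal (r powr (q0 - q)) * (dist_neg_pow F q0 y * indicator (ball x r) y)"
      proof (cases "y \<in> ball x r \<and> infdist y F \<noteq> 0")
        case True
        then have d: "0 < infdist y F" "infdist y F \<le> r"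
          using infdist_nonneg[of y F] infdist_le[OF x, of y] by (auto simp: dist_commute)
        have "infdist y F powr - q = infdist y F powr (q0 - q) * infdist y F powr - q0"
          by (simp add: powr_add[symmetric])
        also have "\<dots> \<le> r powr (q0 - q) * infdist y F powr - q0"
          using d q by (intro mult_right_mono powr_mono2) auto
        finally show ?thesis using True q0 p d by (simp add: dist_neg_pow_def ennreal_mult[symmetric] ennreal_leI)
      qed auto
    qed
    also have "\<dots> = ennreal (r powr (q0 - q)) * (\<integral>\<^sup>+ y \<in> ball x r. dist_neg_pow F q0 y \<partial>N)"
    proof (rule nn_integral_cmult)
      have "(\<lambda>y. dist_neg_pow F q0 y) \<in> borel_measurable N" unfolding dist_neg_pow_def by measurable
      then show "(\<lambda>y. dist_neg_pow F q0 y * indicator (ball x r) y) \<in> borel_measurable N" by measurable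
    qed
    also have "\<dots> \<le> ennreal (r powr (q0 - q)) * aikawa_integral M F q0 x r"
      by (intro mult_left_mono) (auto simp: aikawa_integral_def nn_integral_completion)
    also have "\<dots> \<le> ennreal (r powr (q0 - q)) * ennreal (C * r powr (- q0) * vol x r)"
      using r by (intro mult_left_mono order_trans[OF H[OF x]] ennreal_leI mult_right_mono) (auto simp: C_def)
    also have "\<dots> = ennreal (C * (r powr - q * vol x r))"
    proof -
      have "r powr (q0 - q) * r powr - q0 = r powr - q" by (simp add: powr_add[symmetric])
      moreover have "r powr (q0 - q) * (C * r powr (- q0) * vol x r) = C * ((r powr (q0 - q) * r powr - q0) * vol x r)"
        by (simp only: mult_ac)
      ultimately have "r powr (q0 - q) * (C * r powr (- q0) * vol x r) = C * (r powr - q * vol x r)" by (simp only:)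
      then show ?thesis by (subst ennreal_mult[symmetric]) (auto simp: C_def)
    qed
    finally show ?thesis .
  qed
  then show ?thesis using q(1,2) by (intro exI[of _ q] exI[of _ C]) (auto simp: C_def)
qed

text \<open>
  The codimension only restricts radii below the diameter of \<open>F\<close>. Seen from further away a bounded
  set \<open>F\<close> looks like a point, and the volume exponent exceeds \<open>p\<close>.
\<close>

lemma codim_all_radii:
  assumes codim: "ereal p < codim_A M F" and Q: "p < Q" and F: "F \<noteq> {}"
  shows "\<exists>q C. p < q \<and> 0 < C \<and> (\<forall>x\<in>F. \<forall>r. 0 < r \<longrightarrow>
    dist_power F q (ball x r) \<le> ennreal (C * (r powr - q * vol x r)))"
proof -
  obtain q C where q: "p < q" "q < Q" and C: "0 < C" and H: "\<And>x r. x \<in> F \<Longrightarrow> 0 < r \<Longrightarrow> ennreal r < ediam F \<Longrightarrow>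
    dist_power F q (ball x r) \<le> ennreal (C * (r powr - q * vol x r))"
    using codim_small_radii[OF codim Q] by blast
  have q0: "0 < q" using q p by simp
  obtain CS where CS: "0 < CS" "\<And>x R. 0 < R \<Longrightarrow> dist_power {x} q (ball x R) \<le> ennreal (CS * (R powr - q * vol x R))"
    using point_integral_le[OF q0 q(2)] by blast
  show ?thesis
  proof (cases "ediam F = \<infinity>")
    case True
    then show ?thesis using H q C by (intro exI[of _ q] exI[of _ C]) auto
  next
    case False
    then obtain D where D: "ediam F = ennreal D" "0 \<le> D" by (cases "ediam F") auto
    have diam: "dist x y \<le> D" if "x \<in> F" "y \<in> F" for x y
    proof -
      have "ennreal (dist x y) \<le> ediam F" unfolding ediam_def
        by (rule SUP_upper2[OF that(1)], rule SUP_upper[OF that(2)])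
      then show ?thesis using D by simp
    qed
    show ?thesis
    proof (cases "D = 0")
      case True
      have one: "F = {x}" if "x \<in> F" for x
      proof -
        have "y = x" if "y \<in> F" for y using diam[OF that \<open>x \<in> F\<close>] True by simp
        then show ?thesis using that by blast
      qed
      have "dist_power F q (ball x r) \<le> ennreal (CS * (r powr - q * vol x r))" if "x \<in> F" "0 < r" for x r
        using CS(2)[OF that(2), of x] unfolding one[OF that(1)] .
      then show ?thesis using CS(1) q(1) by (intro exI[of _ q] exI[of _ CS]) simp
    next
      case False
      then have D0: "0 < D" using D by simp
      obtain x1 where x1: "x1 \<in> F" using F by blast
      have "0 < D / 4" using D0 by simp
      then obtain S where S: "S \<subseteq> F" "F \<subseteq> (\<Union>x\<in>S. ball x (D / 4))" "\<And>x R. finite (S \<inter> ball x R)"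
        using exists_net[of 1] by meson
      have "S \<subseteq> ball x1 (2 * D)" using S(1) diam[OF x1] D0 by fastforce
      then have finS: "finite S" using S(3)[of x1 "2 * D"] by (simp add: inf.absorb1)
      let ?U = "{y. infdist y F < D / 4}"
      have setm: "{y. infdist y F < t} \<in> sets N" for t by measurable
      have "dist_power F q ?U \<le> (\<Sum>z\<in>S. dist_power F q (ball z (D / 2)))"
        unfolding dist_power_def
      proof (rule nn_integral_subcover_le[OF finS])
        show "?U \<subseteq> (\<Union>z\<in>S. ball z (D / 2))"
        proof
          fix y assume "y \<in> ?U"
          then obtain w where w: "w \<in> F" "dist y w < D / 4" using infdist_lt_obtain[OF F, of y "D / 4"] by auto
          then obtain z where z: "z \<in> S" "dist z w < D / 4" using S(2) by auto
          then have "dist z y < D / 2" using w dist_triangle[of z y w] by (simp add: dist_commute)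
          then show "y \<in> (\<Union>z\<in>S. ball z (D / 2))" using z by auto
        qed
      qed auto
      also have "\<dots> < \<infinity>"
      proof -
        have "dist_power F q (ball z (D / 2)) < \<infinity>" if "z \<in> S" for z
        proof -
          have "dist_power F q (ball z (D / 2)) \<le> ennreal (C * ((D / 2) powr - q * vol z (D / 2)))"
            using that S(1) D0 D by (intro H) (auto simp: ennreal_less_iff)
          then show ?thesis by (simp add: le_less_trans)
        qed
        then show ?thesis by (simp add: finS)
      qed
      finally obtain K0 where K0: "dist_power F q ?U = ennreal K0" "0 \<le> K0" by (cases "dist_power F q ?U") auto
      obtain Kc where Kc: "1 \<le> Kc" "\<And>x y r s. 0 < r \<Longrightarrow> s + dist x y \<le> 2 * r \<Longrightarrow> vol y s \<le> Kc * vol x r"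
        using vol_comparable[of 2] by auto
      define C1 where "C1 = max 1 Cq"
      define b where "b = vol x1 D * D powr - q / (Kc * C1)"
      have b: "0 < b" using vol_pos[OF D0, of x1] D0 Kc by (simp add: b_def C1_def)
      have low: "b \<le> r powr - q * vol x r" if x: "x \<in> F" and r: "D \<le> r" for x r
      proof -
        have r0: "0 < r" using r D0 by simp
        have "vol x D \<le> C1 * (D / r) powr Q * vol x r"
        proof (cases "D = r")
          case True then show ?thesis using vol_pos[OF r0, of x] r0 by (simp add: C1_def)
        next
          case False
          then have "vol x D \<le> Cq * (D / r) powr Q * vol x r" using r D0 by (intro growth) auto
          also have "\<dots> \<le> C1 * (D / r) powr Q * vol x r" by (intro mult_right_mono) (auto simp: C1_def)
          finally show ?thesis .
        qed
        also have "\<dots> \<le> C1 * (D / r) powr q * vol x r"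
          using r D0 q by (intro mult_right_mono mult_left_mono powr_mono') (auto simp: C1_def)
        finally have 1: "vol x D \<le> C1 * (D / r) powr q * vol x r" .
        have "vol x1 D \<le> Kc * vol x D" using diam[OF x x1] D0 by (intro Kc(2)) auto
        also have "\<dots> \<le> Kc * (C1 * (D / r) powr q * vol x r)" using 1 Kc by (intro mult_left_mono) auto
        finally have "vol x1 D * D powr - q \<le> Kc * (C1 * (D / r) powr q * vol x r) * D powr - q" by (intro mult_right_mono) auto
        also have "\<dots> = (Kc * C1) * (r powr - q * vol x r)"
          using D0 r0 by (simp add: powr_divide powr_minus_divide)
        finally show ?thesis unfolding b_def using Kc by (simp add: C1_def pos_divide_le_eq mult.commute)
      qed
      define C2 where "C2 = max C (K0 / b + 5 powr q * CS)"
      have "dist_power F q (ball x r) \<le> ennreal (C2 * (r powr - q * vol x r))" if x: "x \<in> F" and r: "0 < r" for x r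
      proof (cases "r < D")
        case True
        have "dist_power F q (ball x r) \<le> ennreal (C * (r powr - q * vol x r))"
          using True r D by (intro H x) (auto simp: ennreal_less_iff)
        also have "\<dots> \<le> ennreal (C2 * (r powr - q * vol x r))"
          by (intro ennreal_leI mult_right_mono) (auto simp: C2_def)
        finally show ?thesis .
      next
        case False
        then have rD: "D \<le> r" by simp
        have "dist_power F q (ball x r) \<le> (\<integral>\<^sup>+ y. ennreal (infdist y F powr - q) * indicator ?U y +
           ennreal (5 powr q) * (ennreal (infdist y {x} powr - q) * indicator (ball x r) y) \<partial>N)"
          unfolding dist_power_def
        proof (rule nn_integral_mono)
          fix y
          show "ennreal (infdist y F powr - q) * indicator (ball x r) y \<le> ennreal (infdist y F powr - q) * indicator ?U y +
           ennreal (5 powr q) * (ennreal (infdist y {x} powr - q) * indicator (ball x r) y)"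
          proof (cases "y \<in> ?U \<or> y \<notin> ball x r")
            case True then show ?thesis by (cases "y \<in> ball x r") (auto intro: add_increasing2)
          next
            case False
            then have d: "D / 4 \<le> infdist y F" by simp
            have "dist y x \<le> 5 * infdist y F"
            proof (rule ccontr)
              assume "\<not> ?thesis"
              then have "infdist y F < dist y x - D" using d by simp
              then obtain w where w: "w \<in> F" "dist y w < dist y x - D" using infdist_lt_obtain[OF F] by blast
              then show False using dist_triangle[of y x w] diam[OF w(1) x] by simp
            qed
            moreover have "0 < infdist y F" using d D0 by simp
            moreover have "infdist y F \<le> dist y x" by (rule infdist_le[OF x])
            ultimately have "(5 * infdist y F) powr - q \<le> dist y x powr - q" using q0 by (intro powr_mono2') auto
            then have "5 powr q * (5 * infdist y F) powr - q \<le> 5 powr q * dist y x powr - q" by (intro mult_left_mono) auto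
            moreover have "5 powr q * (5 * infdist y F) powr - q = infdist y F powr - q"
              using \<open>0 < infdist y F\<close> by (simp add: powr_mult powr_minus_divide)
            ultimately show ?thesis using False by (simp add: ennreal_mult[symmetric] ennreal_leI)
          qed
        qed
        also have "\<dots> = dist_power F q ?U + ennreal (5 powr q) * dist_power {x} q (ball x r)"
        proof -
          have m: "(\<lambda>y. ennreal (infdist y F powr - q) * indicator ?U y) \<in> borel_measurable N"
            "(\<lambda>y. ennreal (infdist y {x} powr - q) * indicator (ball x r) y) \<in> borel_measurable N"
            by (intro borel_measurable_times_ennreal borel_measurable_indicator setm ball_sets; measurable)+
          have "(\<lambda>y. ennreal (5 powr q) * (ennreal (infdist y {x} powr - q) * indicator (ball x r) y)) \<in> borel_measurable N"
            by (intro borel_measurable_times_ennreal[OF _ m(2)]) simp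
          from nn_integral_add[OF m(1) this] nn_integral_cmult[OF m(2)] show ?thesis
            unfolding dist_power_def by (simp only:)
        qed
        also have "\<dots> \<le> ennreal K0 + ennreal (5 powr q) * ennreal (CS * (r powr - q * vol x r))"
          unfolding K0(1) by (intro add_left_mono mult_left_mono CS(2) r) auto
        also have "\<dots> = ennreal (K0 + 5 powr q * (CS * (r powr - q * vol x r)))"
          using K0 CS by (simp add: ennreal_mult)
        also have "\<dots> \<le> ennreal (C2 * (r powr - q * vol x r))"
        proof (rule ennreal_leI)
          have "K0 = K0 / b * b" using b by simp
          also have "\<dots> \<le> K0 / b * (r powr - q * vol x r)"
            by (rule mult_left_mono[OF low[OF x rD]]) (use K0(2) b in simp)
          finally have "K0 + 5 powr q * (CS * (r powr - q * vol x r)) \<le> (K0 / b + 5 powr q * CS) * (r powr - q * vol x r)"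
            by (simp only: distrib_right mult.assoc add_right_mono)
          also have "\<dots> \<le> C2 * (r powr - q * vol x r)" by (intro mult_right_mono) (auto simp: C2_def)
          finally show "K0 + 5 powr q * (CS * (r powr - q * vol x r)) \<le> C2 * (r powr - q * vol x r)" .
        qed
        finally show ?thesis .
      qed
      moreover have "0 < C2" using C by (simp add: C2_def)
      ultimately show ?thesis using q by (intro exI[of _ q] exI[of _ C2]) auto
    qed
  qed
qed

end

section \<open>The Hardy inequality for a thin set with the discrete John condition\<close>

lemma sum_power_le:
  fixes \<alpha> :: real
  assumes "1 < \<alpha>" "finite A" "\<And>l. l \<in> A \<Longrightarrow> \<alpha> ^ l \<le> X" "0 \<le> X"
  shows "(\<Sum>l\<in>A. \<alpha> ^ l) \<le> \<alpha> / (\<alpha> - 1) * X"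
proof (cases "A = {}")
  case True then show ?thesis using assms by simp
next
  case False
  define m where "m = Max A"
  have m: "m \<in> A" "\<And>l. l \<in> A \<Longrightarrow> l \<le> m" using False assms by (auto simp: m_def)
  have "(\<Sum>l\<in>A. \<alpha> ^ l) \<le> (\<Sum>l<Suc m. \<alpha> ^ l)" using m assms by (intro sum_mono2) (auto simp: less_Suc_eq_le)
  also have "\<dots> = (\<alpha> ^ Suc m - 1) / (\<alpha> - 1)" using assms by (intro geometric_sum) auto
  also have "\<dots> \<le> \<alpha> * \<alpha> ^ m / (\<alpha> - 1)" using assms by (intro divide_right_mono) auto
  also have "\<dots> \<le> \<alpha> * X / (\<alpha> - 1)" using assms m by (intro divide_right_mono mult_left_mono) auto
  finally show ?thesis by simp
qed

lemma filterlim_power_at_top: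
  fixes a :: real
  assumes "1 < a"
  shows "filterlim (\<lambda>m. a ^ m) at_top sequentially"
  unfolding filterlim_at_top eventually_sequentially
proof
  fix Z
  obtain n where n: "Z < a ^ n" using real_arch_pow[OF assms] by blast
  have "Z \<le> a ^ m" if "n \<le> m" for m
    using n power_increasing[OF that, of a] assms by linarith
  then show "\<exists>n. \<forall>m\<ge>n. Z \<le> a ^ m" by blast
qed

lemma filterlim_powr_const_at_top:
  fixes Q :: real
  assumes "0 < Q"
  shows "filterlim (\<lambda>x. x powr Q) at_top at_top"
  unfolding filterlim_at_top_gt[where c = 0] eventually_at_top_linorder
proof (intro allI impI)
  fix Z :: real assume Z: "0 < Z"
  have "Z \<le> x powr Q" if "Z powr (1 / Q) \<le> x" for x
  proof -
    have "Z = (Z powr (1 / Q)) powr Q" using Z assms by (simp add: powr_powr)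
    also have "\<dots> \<le> x powr Q" using that assms by (intro powr_mono2) auto
    finally show ?thesis .
  qed
  then show "\<exists>N. \<forall>x\<ge>N. Z \<le> x powr Q" by blast
qed

lemma ennreal_enn2real_le: "x \<le> ennreal y \<Longrightarrow> x = ennreal (enn2real x)"
  by (cases x) (auto simp: top_unique)

context growing_poincare_space begin

text \<open>
  Integrate the pointwise estimate \<open>u \<le> \<eta> + \<eta>\<^sup>1\<^sup>-\<^sup>p u\<^sup>p\<close>.
\<close>

lemma ball_mean_le_small:
  assumes u: "test_pair g u" and P: "p_integral u UNIV = ennreal P" "0 \<le> P" and r: "0 < r" and \<eta>: "0 < \<eta>"
  shows "ball_mean u x r \<le> \<eta> + \<eta> powr (1 - p) * (P / vol x r)"
proof -
  note [measurable] = test_pairD(1)[OF u]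
  have V: "0 < vol x r" by (rule vol_pos[OF r])
  have pt: "u y \<le> \<eta> + \<eta> powr (1 - p) * u y powr p" for y
  proof (cases "u y \<le> \<eta>")
    case False
    then have "u y powr (1 - p) \<le> \<eta> powr (1 - p)" using \<eta> p by (intro powr_mono2') auto
    then have "u y powr (1 - p) * u y powr p \<le> \<eta> powr (1 - p) * u y powr p" by (intro mult_right_mono) auto
    moreover have "u y powr (1 - p) * u y powr p = u y" using False \<eta> by (simp add: powr_add[symmetric])
    ultimately show ?thesis using \<eta> by simp
  qed (simp add: add_increasing2)
  have "ennreal (ball_mean u x r * vol x r) = (\<integral>\<^sup>+ y \<in> ball x r. ennreal (u y) \<partial>N)" by (rule ball_mean_mult_vol[OF u r, symmetric])
  also have "\<dots> \<le> (\<integral>\<^sup>+ y. ennreal \<eta> * indicator (ball x r) y + ennreal (\<eta> powr (1 - p)) * ennreal (u y powr p) \<partial>N)"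
  proof (rule nn_integral_mono)
    fix y
    have "ennreal (u y) \<le> ennreal \<eta> + ennreal (\<eta> powr (1 - p)) * ennreal (u y powr p)"
      using ennreal_leI[OF pt[of y]] \<eta> by (simp add: ennreal_mult)
    then show "ennreal (u y) * indicator (ball x r) y \<le> ennreal \<eta> * indicator (ball x r) y + ennreal (\<eta> powr (1 - p)) * ennreal (u y powr p)"
      by (cases "y \<in> ball x r") auto
  qed
  also have "\<dots> = ennreal \<eta> * ennreal (vol x r) + ennreal (\<eta> powr (1 - p)) * p_integral u UNIV"
    unfolding p_integral_def using r by (simp add: nn_integral_add nn_integral_cmult nn_integral_cmult_indicator emeasure_ball_eq)
  also have "\<dots> = ennreal (\<eta> * vol x r + \<eta> powr (1 - p) * P)"
    unfolding P(1) using \<eta> P by (simp add: ennreal_mult)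
  finally have "ball_mean u x r * vol x r \<le> \<eta> * vol x r + \<eta> powr (1 - p) * P"
    using \<eta> P V by (subst (asm) ennreal_le_iff) auto
  then have "ball_mean u x r \<le> (\<eta> * vol x r + \<eta> powr (1 - p) * P) / vol x r" using V by (simp add: pos_le_divide_eq)
  then show ?thesis using V by (simp add: add_divide_distrib)
qed

end

text \<open>
  A Whitney cover of the complement of \<open>F\<close> with the discrete John condition, the codimension of \<open>F\<close>
  entering through the integrals of \<open>d\<^sup>-\<^sup>q\<close> for one \<open>q > p\<close>.
\<close>

locale john_cover = growing_poincare_space +
  fixes F :: "'a set" and c :: real and I :: "nat set" and z :: "nat \<Rightarrow> 'a" and L a Cj q CA :: real and n0 :: nat
  assumes F: "closed F" "F \<noteq> {}"
    and c: "0 < c" "c \<le> 1 / (6 * lam)"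
    and q: "p < q"
    and CA: "0 < CA" "x \<in> F \<Longrightarrow> 0 < r \<Longrightarrow> dist_power F q (ball x r) \<le> ennreal (CA * (r powr - q * vol x r))"
    and z: "i \<in> I \<Longrightarrow> z i \<notin> F"
    and cover: "- F \<subseteq> (\<Union>i\<in>I. ball (z i) (c * infdist (z i) F))"
    and overlap: "finite {i \<in> I. x \<in> ball (z i) (c * infdist (z i) F)} \<and> card {i \<in> I. x \<in> ball (z i) (c * infdist (z i) F)} \<le> n0"
    and L: "1 < L" and a: "1 < a" and Cj: "0 < Cj"
    and john: "i \<in> I \<Longrightarrow> \<exists>k. k 0 = i \<and> (\<forall>m. k m \<in> I \<and>
       ball (z (k m)) (c * infdist (z (k m)) F) \<inter> ball (z (k (Suc m))) (c * infdist (z (k (Suc m))) F) \<noteq> {} \<and>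
       ball (z i) (c * infdist (z i) F) \<subseteq> ball (z (k m)) (L * (c * infdist (z (k m)) F)) \<and>
       Cj * a ^ m * (c * infdist (z i) F) \<le> c * infdist (z (k m)) F)"
begin

abbreviation d :: "nat \<Rightarrow> real" where "d i \<equiv> infdist (z i) F"
abbreviation B :: "nat \<Rightarrow> 'a set" where "B i \<equiv> ball (z i) (c * d i)"
abbreviation V :: "nat \<Rightarrow> real" where "V i \<equiv> vol (z i) (c * d i)"
abbreviation A :: "('a \<Rightarrow> real) \<Rightarrow> nat \<Rightarrow> real" where "A u i \<equiv> ball_mean u (z i) (c * d i)"

text \<open>
  The balls of radius \<open>2 d / 3\<close> contain all dilated balls to which the Poincare inequality is applied
  near \<open>B i\<close>, and they still have bounded overlap.
\<close>

definition local_energy :: "('a \<Rightarrow> ennreal) \<Rightarrow> nat \<Rightarrow> real" where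
  "local_energy g i = enn2real (energy g (ball (z i) (2 / 3 * d i)))"

lemma c6: "c \<le> 1 / 6" "6 * (lam * c) \<le> 1"
proof -
  show 1: "6 * (lam * c) \<le> 1" using c lam by (simp add: field_simps)
  have "1 * c \<le> lam * c" using lam c by (intro mult_right_mono) auto
  then show "c \<le> 1 / 6" using 1 by simp
qed

lemma d_pos: "i \<in> I \<Longrightarrow> 0 < d i"
  using infdist_pos_not_in_closed[OF F] z by auto

lemma rad_pos: "i \<in> I \<Longrightarrow> 0 < c * d i"
  using d_pos c by simp

lemma V_pos: "i \<in> I \<Longrightarrow> 0 < V i"
  by (rule vol_pos[OF rad_pos])

lemma local_energy_eq: "energy g UNIV = ennreal E \<Longrightarrow> energy g (ball (z i) (2 / 3 * d i)) = ennreal (local_energy g i)"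
  unfolding local_energy_def using energy_mono[of "ball (z i) (2 / 3 * d i)" UNIV g] by (intro ennreal_enn2real_le[of _ E]) simp

lemma local_energy_nonneg: "0 \<le> local_energy g i" by (simp add: local_energy_def)

lemma dist_in_B: "y \<in> B i \<Longrightarrow> \<bar>d i - infdist y F\<bar> \<le> c * d i"
  using infdist_triangle_abs[of "z i" F y] by simp

lemma local_energy_sum_le:
  "\<exists>n::nat. \<forall>g E J. energy g UNIV = ennreal E \<longrightarrow> 0 \<le> E \<longrightarrow> g \<in> borel_measurable borel \<longrightarrow> finite J \<longrightarrow> J \<subseteq> I \<longrightarrow>
     (\<Sum>j\<in>J. local_energy g j) \<le> n * E"
proof -
  have "\<exists>n. \<forall>F I (z :: nat \<Rightarrow> 'a). (\<forall>i\<in>I. 0 < infdist (z i) F) \<longrightarrow>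
    (\<forall>x. finite {i \<in> I. x \<in> ball (z i) (c * infdist (z i) F)} \<and> card {i \<in> I. x \<in> ball (z i) (c * infdist (z i) F)} \<le> n0) \<longrightarrow>
    (\<forall>x. finite {i \<in> I. x \<in> ball (z i) (2 / 3 * infdist (z i) F)} \<and> card {i \<in> I. x \<in> ball (z i) (2 / 3 * infdist (z i) F)} \<le> n)"
    by (rule whitney_overlap) (use c c6(1) in auto)
  then obtain n where n: "\<forall>F I (z :: nat \<Rightarrow> 'a). (\<forall>i\<in>I. 0 < infdist (z i) F) \<longrightarrow>
    (\<forall>x. finite {i \<in> I. x \<in> ball (z i) (c * infdist (z i) F)} \<and> card {i \<in> I. x \<in> ball (z i) (c * infdist (z i) F)} \<le> n0) \<longrightarrow>
    (\<forall>x. finite {i \<in> I. x \<in> ball (z i) (2 / 3 * infdist (z i) F)} \<and> card {i \<in> I. x \<in> ball (z i) (2 / 3 * infdist (z i) F)} \<le> n)"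
    by (rule exE)
  have n': "finite {i \<in> I. x \<in> ball (z i) (2 / 3 * d i)} \<and> card {i \<in> I. x \<in> ball (z i) (2 / 3 * d i)} \<le> n" for x
    by (rule n[rule_format]) (use d_pos overlap in auto)
  show ?thesis
  proof (intro exI[of _ n] allI impI)
    fix g E J assume E: "energy g UNIV = ennreal E" "0 \<le> E" and g: "g \<in> borel_measurable borel" and J: "finite J" "J \<subseteq> I"
    have [measurable]: "g \<in> borel_measurable N" using g by simp
    have "(\<Sum>j\<in>J. energy g (ball (z j) (2 / 3 * d j))) \<le> of_nat n * energy g UNIV"
      unfolding energy_def
    proof (rule nn_integral_overlap_le[OF J(1)])
      fix x
      have "card {j \<in> J. x \<in> ball (z j) (2 / 3 * d j)} \<le> card {i \<in> I. x \<in> ball (z i) (2 / 3 * d i)}"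
        by (rule card_mono) (use n'[of x] J in auto)
      then show "card {j \<in> J. x \<in> ball (z j) (2 / 3 * d j)} \<le> n" using n'[of x] by linarith
    qed auto
    then have "(\<Sum>j\<in>J. ennreal (local_energy g j)) \<le> of_nat n * ennreal E" using local_energy_eq[OF E(1)] E(1) by simp
    then show "(\<Sum>j\<in>J. local_energy g j) \<le> n * E"
      using local_energy_nonneg E(2) by (simp add: sum_ennreal ennreal_of_nat_eq_real_of_nat ennreal_mult[symmetric] ennreal_le_iff)
  qed
qed

text \<open>
  The radii of intersecting Whitney balls differ by a factor of at most \<open>7/5\<close>, so both balls lie in
  the ball \<open>4 B i\<close>. As \<open>4 lam c \<le> 2/3\<close>, its dilation stays away from \<open>F\<close>.
\<close>

lemma ball_mean_neighbour:
  "\<exists>K1>0. \<forall>g u E i j. test_pair g u \<longrightarrow> energy g UNIV = ennreal E \<longrightarrow> i \<in> I \<longrightarrow> j \<in> I \<longrightarrow> B i \<inter> B j \<noteq> {} \<longrightarrow>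
     \<bar>A u i - A u j\<bar> powr p \<le> K1 powr p * (c * d i) powr p * (local_energy g i / V i)"
proof -
  obtain K where K: "1 \<le> K" "\<And>x y r s. 0 < r \<Longrightarrow> s + dist x y \<le> 8 * r \<Longrightarrow> vol y s \<le> K * vol x r"
    using vol_comparable[of 8] by auto
  define K1 where "K1 = 8 * K * Cp"
  have K1: "0 < K1" using K Cp by (simp add: K1_def)
  have "\<bar>A u i - A u j\<bar> powr p \<le> K1 powr p * (c * d i) powr p * (local_energy g i / V i)"
    if u: "test_pair g u" and E: "energy g UNIV = ennreal E" and ij: "i \<in> I" "j \<in> I" and meet: "B i \<inter> B j \<noteq> {}" for g u E i j
  proof -
    let ?R = "4 * (c * d i)"
    obtain y where y: "y \<in> B i" "y \<in> B j" using meet by blast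
    have dij: "dist (z i) (z j) < c * d i + c * d j"
      using y dist_triangle[of "z i" "z j" y] by (simp add: dist_commute)
    have "\<bar>d i - d j\<bar> \<le> dist (z i) (z j)" by (rule infdist_triangle_abs)
    then have "d j - d i < c * d i + c * d j" "d i - d j < c * d i + c * d j" using dij by auto
    moreover have "c * d i \<le> 1 / 6 * d i" "c * d j \<le> 1 / 6 * d j" using c6(1) d_pos ij by (auto intro!: mult_right_mono less_imp_le)
    ultimately have "d j \<le> 7 / 5 * d i" "d i \<le> 7 / 5 * d j" by linarith+
    then have comp: "c * d j \<le> 7 / 5 * (c * d i)" "c * d i \<le> 7 / 5 * (c * d j)" using c mult_left_mono[of _ _ c] by fastforce+
    have pos: "0 < c * d i" "0 < c * d j" using rad_pos ij by auto
    have "lam * ?R \<le> 2 / 3 * d i"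
      using mult_right_mono[OF c6(2), of "d i"] d_pos[OF ij(1)] by (simp add: mult_ac)
    then have sub: "ball (z i) (lam * ?R) \<subseteq> ball (z i) (2 / 3 * d i)" by (rule subset_ball)
    define E' where "E' = enn2real (energy g (ball (z i) (lam * ?R)))"
    have le: "energy g (ball (z i) (lam * ?R)) \<le> ennreal (local_energy g i)" using energy_mono[OF sub, of g] unfolding local_energy_eq[OF E] .
    have E': "energy g (ball (z i) (lam * ?R)) = ennreal E'" "0 \<le> E'" "E' \<le> local_energy g i"
    proof -
      show 1: "energy g (ball (z i) (lam * ?R)) = ennreal E'" unfolding E'_def by (rule ennreal_enn2real_le[OF le])
      show "0 \<le> E'" by (simp add: E'_def)
      show "E' \<le> local_energy g i" using le local_energy_nonneg unfolding 1 by simp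
    qed
    have 1: "\<bar>A u i - ball_mean u (z i) ?R\<bar> \<le> K * Cp * ?R * (E' / vol (z i) ?R) powr (1 / p)"
      using pos by (intro ball_mean_step[OF u _ _ _ E'(1,2)] K subset_ball) auto
    have 2: "\<bar>A u j - ball_mean u (z i) ?R\<bar> \<le> K * Cp * ?R * (E' / vol (z i) ?R) powr (1 / p)"
      using pos comp dij by (intro ball_mean_step[OF u _ _ _ E'(1,2)] K ball_subset_ballI) (auto simp: dist_commute)
    have VR: "V i \<le> vol (z i) ?R" using pos by (intro vol_mono subset_ball) simp
    have "\<bar>A u i - A u j\<bar> \<le> 2 * (K * Cp * ?R * (E' / vol (z i) ?R) powr (1 / p))" using 1 2 by linarith
    also have "\<dots> = K1 * (c * d i) * (E' / vol (z i) ?R) powr (1 / p)" by (simp add: K1_def)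
    also have "\<dots> \<le> K1 * (c * d i) * (local_energy g i / V i) powr (1 / p)"
      using K1 pos E' V_pos[OF ij(1)] VR p by (intro mult_left_mono powr_mono2 frac_le) auto
    finally show ?thesis
      using K1 pos local_energy_nonneg by (intro powr_le_of_root_bound) auto
  qed
  then show ?thesis using K1 by blast
qed

text \<open>
  The balls from which \<open>B j\<close> can be reached lie in \<open>L B j\<close>, and the integral of \<open>d\<^sup>-\<^sup>q\<close> over that
  ball is controlled by the codimension of \<open>F\<close>.
\<close>

lemma shadow_sum_le:
  "\<exists>C>0. \<forall>J j. finite J \<longrightarrow> J \<subseteq> I \<longrightarrow> j \<in> I \<longrightarrow> (\<forall>i\<in>J. B i \<subseteq> ball (z j) (L * (c * d j))) \<longrightarrow>
     (\<Sum>i\<in>J. d i powr - q * V i) \<le> C * (d j powr - q * V j)"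
proof -
  define t where "t = (L * c + 4) / c"
  obtain K where K: "1 \<le> K" "\<And>x y r s. 0 < r \<Longrightarrow> s + dist x y \<le> t * r \<Longrightarrow> vol y s \<le> K * vol x r"
    using vol_comparable[of t] by auto
  define C where "C = 2 powr q * (Suc n0 * (CA * K))"
  have C: "0 < C" unfolding C_def using CA K(1) by (intro mult_pos_pos) auto
  have q0: "0 < q" using p q by simp
  have main: "(\<Sum>i\<in>J. d i powr - q * V i) \<le> C * (d j powr - q * V j)"
    if J: "finite J" "J \<subseteq> I" and j: "j \<in> I" and sub: "\<forall>i\<in>J. B i \<subseteq> ball (z j) (L * (c * d j))" for J j
  proof -
    have dj: "0 < d j" by (rule d_pos[OF j])
    obtain x where x: "x \<in> F" "dist (z j) x < 2 * d j" using infdist_lt_obtain[OF F(2), of "z j" "2 * d j"] dj by auto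
    define R where "R = (L * c + 2) * d j"
    have "0 < L * c" using L c by simp
    then have "0 < L * c * d j" using dj by (rule mult_pos_pos)
    moreover have "R = L * c * d j + 2 * d j" by (simp add: R_def distrib_right)
    ultimately have R: "0 < R" "d j \<le> R" using dj by linarith+
    have "(\<Sum>i\<in>J. ennreal (d i powr - q * V i)) \<le> (\<Sum>i\<in>J. ennreal (2 powr q) * dist_power F q (B i))"
    proof (rule sum_mono)
      fix i assume "i \<in> J"
      then have i: "i \<in> I" using J by auto
      have "ennreal (d i powr - q * V i) = ennreal (2 powr q) * (ennreal ((2 * d i) powr - q) * emeasure N (B i))"
      proof -
        have "2 powr q * (2 * d i) powr - q = d i powr - q"
          using d_pos[OF i] by (simp add: powr_mult powr_add[symmetric] mult.assoc[symmetric])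
        then have eq: "d i powr - q * V i = 2 powr q * ((2 * d i) powr - q * V i)" by (metis mult.assoc)
        show ?thesis unfolding eq emeasure_completion_ball emeasure_ball_eq[OF rad_pos[OF i]]
          by (simp add: ennreal_mult)
      qed
      also have "ennreal ((2 * d i) powr - q) * emeasure N (B i) = (\<integral>\<^sup>+ y \<in> B i. ennreal ((2 * d i) powr - q) \<partial>N)"
        by (rule nn_integral_cmult_indicator[symmetric]) simp
      also have "\<dots> \<le> dist_power F q (B i)"
        unfolding dist_power_def
      proof (rule nn_integral_mono)
        fix y
        show "ennreal ((2 * d i) powr - q) * indicator (B i) y \<le> ennreal (infdist y F powr - q) * indicator (B i) y"
        proof (cases "y \<in> B i")
          case True
          have "c * d i \<le> 1 / 6 * d i" using c6(1) d_pos[OF i] by (intro mult_right_mono) auto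
          then have "0 < infdist y F" "infdist y F \<le> 2 * d i" using dist_in_B[OF True] d_pos[OF i] by linarith+
          then show ?thesis using True q0 by (simp add: ennreal_leI powr_mono2')
        qed simp
      qed
      finally show "ennreal (d i powr - q * V i) \<le> ennreal (2 powr q) * dist_power F q (B i)"
        by (simp add: mult_left_mono)
    qed
    also have "\<dots> = ennreal (2 powr q) * (\<Sum>i\<in>J. dist_power F q (B i))" by (simp add: sum_distrib_left)
    also have "\<dots> \<le> ennreal (2 powr q) * (of_nat (Suc n0) * dist_power F q (ball x R))"
      unfolding dist_power_def
    proof (intro mult_left_mono nn_integral_overlap_le J(1))
      show "B i \<subseteq> ball x R" if "i \<in> J" for i
      proof -
        have "ball (z j) (L * (c * d j)) \<subseteq> ball x R"
          using x by (intro ball_subset_ballI) (simp add: R_def dist_commute algebra_simps)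
        then show ?thesis using sub that by blast
      qed
      fix y
      have "card {i \<in> J. y \<in> B i} \<le> card {i \<in> I. y \<in> B i}" by (rule card_mono) (use overlap J in auto)
      then show "card {i \<in> J. y \<in> B i} \<le> Suc n0" using overlap[of y] by linarith
    qed auto
    also have "\<dots> \<le> ennreal (2 powr q) * (of_nat (Suc n0) * ennreal (CA * (R powr - q * vol x R)))"
      by (intro mult_left_mono CA(2) x R) auto
    also have "\<dots> = ennreal (2 powr q * (Suc n0 * (CA * (R powr - q * vol x R))))"
      using CA(1) by (simp add: ennreal_mult ennreal_of_nat_eq_real_of_nat del: of_nat_Suc)
    also have "\<dots> \<le> ennreal (C * (d j powr - q * V j))"
    proof (rule ennreal_leI)
      have "vol x R \<le> K * V j"
      proof (rule K(2))
        show "0 < c * d j" by (rule rad_pos[OF j])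
        have "R + dist (z j) x \<le> (L * c + 4) * d j" using x(2) by (simp add: R_def algebra_simps)
        also have "\<dots> = t * c * d j" using c by (simp add: t_def)
        finally show "R + dist (z j) x \<le> t * (c * d j)" by (simp add: mult.assoc)
      qed
      moreover have "R powr - q \<le> d j powr - q" using R dj q0 by (intro powr_mono2') auto
      ultimately have "R powr - q * vol x R \<le> d j powr - q * (K * V j)" by (intro mult_mono) auto
      then have "2 powr q * (Suc n0 * (CA * (R powr - q * vol x R))) \<le> 2 powr q * (Suc n0 * (CA * (d j powr - q * (K * V j))))"
        using CA(1) by (intro mult_left_mono) auto
      also have "\<dots> = C * (d j powr - q * V j)" unfolding C_def by (simp only: mult_ac)
      finally show "2 powr q * (Suc n0 * (CA * (R powr - q * vol x R))) \<le> C * (d j powr - q * V j)" .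
    qed
    finally have "ennreal (\<Sum>i\<in>J. d i powr - q * V i) \<le> ennreal (C * (d j powr - q * V j))"
      by (simp add: sum_ennreal)
    then show ?thesis using C by (subst (asm) ennreal_le_iff) auto
  qed
  show ?thesis using C main by blast
qed

definition chain :: "nat \<Rightarrow> (nat \<Rightarrow> nat) \<Rightarrow> bool" where
  "chain i k \<longleftrightarrow> k 0 = i \<and> (\<forall>m. k m \<in> I \<and> B (k m) \<inter> B (k (Suc m)) \<noteq> {} \<and>
       B i \<subseteq> ball (z (k m)) (L * (c * d (k m))) \<and> Cj * a ^ m * (c * d i) \<le> c * d (k m))"

lemma chainD:
  assumes "chain i k"
  shows "k 0 = i" "k m \<in> I" "B (k m) \<inter> B (k (Suc m)) \<noteq> {}" "B i \<subseteq> ball (z (k m)) (L * (c * d (k m)))"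
    "Cj * a ^ m * d i \<le> d (k m)"
proof -
  have "c * (Cj * a ^ m * d i) \<le> c * d (k m)" using assms by (simp add: chain_def mult_ac)
  then show "Cj * a ^ m * d i \<le> d (k m)" using c by (simp only: mult_le_cancel_left_pos)
qed (use assms in \<open>auto simp: chain_def\<close>)

lemma chain_exists: "i \<in> I \<Longrightarrow> \<exists>k. chain i k"
  unfolding chain_def by (rule john)

text \<open>
  The volumes along a chain tend to infinity, since the radii do and the volume has a positive growth
  exponent, whereas \<open>u\<close> is in \<open>L\<^sup>p\<close>.
\<close>

lemma chain_average_vanishes:
  assumes u: "test_pair g u" and P: "p_integral u UNIV = ennreal P" "0 \<le> P" and k: "chain i k" and \<eta>: "0 < \<eta>"
  shows "\<forall>\<^sub>F m in sequentially. A u (k m) \<le> 2 * \<eta>"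
proof -
  have i: "i \<in> I" using chainD(1)[OF k] chainD(2)[OF k, of 0] by simp
  obtain K where K: "1 \<le> K" "\<And>x y r s. 0 < r \<Longrightarrow> s + dist x y \<le> L * r \<Longrightarrow> vol y s \<le> K * vol x r"
    using vol_comparable[of L] by auto
  define X where "X m = (L * Cj * a ^ m) powr Q * (V i / (Cq * K))" for m :: nat
  have lim: "filterlim X at_top sequentially"
  proof -
    have "filterlim (\<lambda>m. a ^ m) at_top sequentially" by (rule filterlim_power_at_top[OF a])
    then have "filterlim (\<lambda>m. L * Cj * a ^ m) at_top sequentially"
      using L Cj by (intro filterlim_tendsto_pos_mult_at_top[OF tendsto_const]) auto
    then have "filterlim (\<lambda>m. (L * Cj * a ^ m) powr Q) at_top sequentially"
      by (rule filterlim_compose[OF filterlim_powr_const_at_top[OF Q]])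
    then show ?thesis unfolding X_def
      using V_pos[OF i] Cq K(1) by (intro filterlim_at_top_mult_tendsto_pos[OF tendsto_const]) auto
  qed
  have "\<forall>\<^sub>F m in sequentially. 1 < L * Cj * a ^ m"
  proof -
    have "filterlim (\<lambda>m. a ^ m) at_top sequentially" by (rule filterlim_power_at_top[OF a])
    then have "filterlim (\<lambda>m. L * Cj * a ^ m) at_top sequentially"
      using L Cj by (intro filterlim_tendsto_pos_mult_at_top[OF tendsto_const]) auto
    then show ?thesis by (simp add: filterlim_at_top_dense)
  qed
  moreover have "\<forall>\<^sub>F m in sequentially. max 1 (\<eta> powr (1 - p) * P / \<eta>) \<le> X m"
    using lim unfolding filterlim_at_top by blast
  ultimately show ?thesis
  proof eventually_elim
    case (elim m)
    let ?j = "k m"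
    let ?R = "L * (c * d ?j)"
    have j: "?j \<in> I" by (rule chainD(2)[OF k])
    have R: "L * Cj * a ^ m * (c * d i) \<le> ?R"
      using mult_left_mono[OF chainD(5)[OF k, of m], of "L * c"] L c by (simp add: mult_ac)
    have "1 * (c * d i) < L * Cj * a ^ m * (c * d i)" using elim(1) rad_pos[OF i] by (intro mult_strict_right_mono) auto
    then have lt: "c * d i < ?R" using R by simp
    have R0: "0 < ?R" using rad_pos[OF j] L by simp
    have "z i \<in> B i" using rad_pos[OF i] by simp
    then have "z i \<in> ball (z ?j) ?R" using chainD(4)[OF k, of m] by blast
    from growth[OF rad_pos[OF i] lt this] have "V i \<le> Cq * (c * d i / ?R) powr Q * vol (z ?j) ?R" .
    also have "\<dots> \<le> Cq * (1 / (L * Cj * a ^ m)) powr Q * (K * V ?j)"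
    proof (intro mult_mono powr_mono2)
      have aux: "x / y \<le> 1 / t" if "t * x \<le> y" "0 < y" "0 < t" for x y t :: real
        using that by (simp add: field_simps)
      show "c * d i / ?R \<le> 1 / (L * Cj * a ^ m)" by (rule aux[OF R R0]) (use elim(1) in linarith)
      show "vol (z ?j) ?R \<le> K * V ?j" using rad_pos[OF j] by (intro K(2)) auto
      show "0 \<le> c * d i / ?R" by (rule divide_nonneg_pos[OF _ R0]) (use rad_pos[OF i] in linarith)
    qed (use Cq Q in auto)
    also have "\<dots> = V ?j * (Cq * K / (L * Cj * a ^ m) powr Q)"
      using elim(1) by (simp add: powr_divide)
    finally have "V i \<le> V ?j * (Cq * K / (L * Cj * a ^ m) powr Q)" .
    then have "X m \<le> V ?j"
    proof -
      assume le: "V i \<le> V ?j * (Cq * K / (L * Cj * a ^ m) powr Q)"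
      have "L * Cj * a ^ m \<noteq> 0" using elim(1) by linarith
      then have pos: "0 < (L * Cj * a ^ m) powr Q" by (rule powr_gt_zero[THEN iffD2])
      have pos': "0 < Cq * K" using Cq K(1) by simp
      have "V i * (L * Cj * a ^ m) powr Q \<le> V ?j * (Cq * K / (L * Cj * a ^ m) powr Q) * (L * Cj * a ^ m) powr Q"
        by (rule mult_right_mono[OF le]) (use pos in linarith)
      also have "\<dots> = V ?j * (Cq * K)" using less_imp_neq[OF pos] by simp
      finally have "V i * (L * Cj * a ^ m) powr Q \<le> V ?j * (Cq * K)" .
      then have "V i * (L * Cj * a ^ m) powr Q / (Cq * K) \<le> V ?j" by (simp only: pos_divide_le_eq[OF pos'])
      then show ?thesis unfolding X_def by (simp add: mult.commute)
    qed
    then have Vj: "\<eta> powr (1 - p) * P / \<eta> \<le> V ?j" using elim(2) by linarith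
    have "\<eta> powr (1 - p) * (P / V ?j) \<le> \<eta>"
      using Vj \<eta> V_pos[OF j] by (simp add: field_simps)
    with ball_mean_le_small[OF u P rad_pos[OF j] \<eta>, of "z ?j"] show ?case by linarith
  qed
qed

text \<open>
  The mean over \<open>B i\<close> telescopes along the chain. The weights \<open>\<alpha>\<^sup>l\<close>, \<open>\<alpha> = a\<^sup>q\<^sup>-\<^sup>p\<close>, make
  the increments summable in \<open>\<ell>\<^sup>p\<close>. When the order of summation over balls and chains is reversed,
  they turn \<open>d\<^sup>-\<^sup>p\<close> into \<open>d\<^sup>-\<^sup>q\<close>, which is integrable over the balls \<open>L B j\<close>.
\<close>

lemma average_sum_le:
  "\<exists>C>0. \<forall>g u P E J. test_pair g u \<longrightarrow> p_integral u UNIV = ennreal P \<longrightarrow> 0 \<le> P \<longrightarrow> energy g UNIV = ennreal E \<longrightarrow> 0 \<le> E \<longrightarrow>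
     finite J \<longrightarrow> J \<subseteq> I \<longrightarrow> (\<Sum>i\<in>J. d i powr - p * V i * A u i powr p) \<le> C * E"
proof -
  obtain K1 where K1: "0 < K1" "\<And>g u E i j. test_pair g u \<Longrightarrow> energy g UNIV = ennreal E \<Longrightarrow> i \<in> I \<Longrightarrow> j \<in> I \<Longrightarrow> B i \<inter> B j \<noteq> {} \<Longrightarrow>
     \<bar>A u i - A u j\<bar> powr p \<le> K1 powr p * (c * d i) powr p * (local_energy g i / V i)"
    using ball_mean_neighbour by meson
  obtain C7 where C7: "0 < C7" "\<And>J j. finite J \<Longrightarrow> J \<subseteq> I \<Longrightarrow> j \<in> I \<Longrightarrow> (\<forall>i\<in>J. B i \<subseteq> ball (z j) (L * (c * d j))) \<Longrightarrow>
     (\<Sum>i\<in>J. d i powr - q * V i) \<le> C7 * (d j powr - q * V j)"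
    using shadow_sum_le by meson
  obtain n1 :: nat where n1: "\<And>g E J. energy g UNIV = ennreal E \<Longrightarrow> 0 \<le> E \<Longrightarrow> g \<in> borel_measurable borel \<Longrightarrow> finite J \<Longrightarrow> J \<subseteq> I \<Longrightarrow>
     (\<Sum>j\<in>J. local_energy g j) \<le> real n1 * E"
    using local_energy_sum_le by meson
  define kk where "kk i = (SOME k. chain i k)" for i
  have kk: "chain i (kk i)" if "i \<in> I" for i unfolding kk_def using chain_exists[OF that] by (rule someI_ex)
  \<comment> \<open>Along a chain the radii grow at least like \<open>a\<^sup>m\<close>, so the weights \<open>\<alpha>\<^sup>m\<close> grow at most like the radius to the power \<open>q - p\<close>.\<close>
  define \<alpha> where "\<alpha> = a powr (q - p)"
  have \<alpha>: "1 < \<alpha>" unfolding \<alpha>_def using a q by (simp add: less_powr_iff gr_one_powr)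
  define \<beta> where "\<beta> = \<alpha> powr (- 1 / p)"
  have \<beta>: "0 < \<beta>" "\<beta> < 1" using \<alpha> p by (auto simp: \<beta>_def powr_less_one)
  define c1 where "c1 = 1 / (1 - \<beta>)"
  have c1: "0 < c1" using \<beta> by (simp add: c1_def)
  define C6 where "C6 = \<alpha> / (\<alpha> - 1) * Cj powr (p - q) * C7"
  have C6: "0 < C6" using \<alpha> Cj C7 by (simp add: C6_def)
  define C5 where "C5 = K1 powr p * c powr p * C6 * n1"
  have C5: "0 \<le> C5" using C6 by (simp add: C5_def)
  define w where "w i = d i powr - p * V i" for i
  have w0: "0 \<le> w i" for i by (simp add: w_def)
  \<comment> \<open>The total weight of all passages of chains through the ball \<open>B j\<close>.\<close>
  have inner: "(\<Sum>i\<in>J. \<Sum>l\<in>{l \<in> {..<m}. kk i l = j}. w i * \<alpha> ^ l) \<le> C6 * w j"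
    if J: "finite J" "J \<subseteq> I" and j: "j \<in> I" for J j m
  proof -
    define J' where "J' = {i \<in> J. \<exists>l<m. kk i l = j}"
    let ?S = "\<lambda>i. {l \<in> {..<m}. kk i l = j}"
    have J': "finite J'" "J' \<subseteq> I" "J' \<subseteq> J" using J by (auto simp: J'_def)
    have "(\<Sum>i\<in>J. \<Sum>l\<in>?S i. w i * \<alpha> ^ l) = (\<Sum>i\<in>J'. \<Sum>l\<in>?S i. w i * \<alpha> ^ l)"
      using J by (intro sum.mono_neutral_right) (auto simp: J'_def intro!: sum.neutral)
    also have "\<dots> \<le> (\<Sum>i\<in>J'. \<alpha> / (\<alpha> - 1) * (Cj powr (p - q) * d j powr (q - p)) * (d i powr - q * V i))"
    proof (rule sum_mono)
      fix i assume "i \<in> J'"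
      then have i: "i \<in> I" using J' by auto
      define X where "X = (d j / (Cj * d i)) powr (q - p)"
      have "\<alpha> ^ l \<le> X" if "l \<in> ?S i" for l
      proof -
        have "Cj * a ^ l * d i \<le> d j" using chainD(5)[OF kk[OF i], of l] that by simp
        then have "a ^ l \<le> d j / (Cj * d i)" using Cj d_pos[OF i] by (simp add: field_simps)
        then have "(a ^ l) powr (q - p) \<le> X" unfolding X_def using a q by (intro powr_mono2) auto
        then show ?thesis using a by (simp add: \<alpha>_def powr_realpow[symmetric] powr_powr powr_power mult.commute)
      qed
      then have "(\<Sum>l\<in>?S i. \<alpha> ^ l) \<le> \<alpha> / (\<alpha> - 1) * X"
        by (intro sum_power_le \<alpha>) (auto simp: X_def)
      then have "w i * (\<Sum>l\<in>?S i. \<alpha> ^ l) \<le> w i * (\<alpha> / (\<alpha> - 1) * X)" using w0 by (intro mult_left_mono) auto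
      also have "w i * (\<alpha> / (\<alpha> - 1) * X) = \<alpha> / (\<alpha> - 1) * (Cj powr (p - q) * d j powr (q - p)) * (d i powr - q * V i)"
      proof -
        have X: "X = d j powr (q - p) * Cj powr (p - q) * d i powr (p - q)"
        proof -
          have "X = d j powr (q - p) / (Cj * d i) powr (q - p)"
            unfolding X_def by (rule powr_divide)
          also have "\<dots> = d j powr (q - p) * (Cj * d i) powr - (q - p)"
            by (simp only: powr_minus divide_inverse)
          also have "(Cj * d i) powr - (q - p) = Cj powr (p - q) * d i powr (p - q)"
            using Cj d_pos[OF i] by (simp add: powr_mult)
          finally show ?thesis by (simp add: mult.assoc)
        qed
        have "w i * (\<alpha> / (\<alpha> - 1) * X) = \<alpha> / (\<alpha> - 1) * (Cj powr (p - q) * d j powr (q - p)) * ((d i powr - p * d i powr (p - q)) * V i)"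
          unfolding w_def X by (simp only: mult_ac)
        also have "d i powr - p * d i powr (p - q) = d i powr - q" by (simp add: powr_add[symmetric])
        finally show ?thesis .
      qed
      finally show "(\<Sum>l\<in>?S i. w i * \<alpha> ^ l) \<le> \<alpha> / (\<alpha> - 1) * (Cj powr (p - q) * d j powr (q - p)) * (d i powr - q * V i)"
        by (simp add: sum_distrib_left)
    qed
    also have "\<dots> = \<alpha> / (\<alpha> - 1) * (Cj powr (p - q) * d j powr (q - p)) * (\<Sum>i\<in>J'. d i powr - q * V i)"
      by (rule sum_distrib_left[symmetric])
    also have "\<dots> \<le> \<alpha> / (\<alpha> - 1) * (Cj powr (p - q) * d j powr (q - p)) * (C7 * (d j powr - q * V j))"
    proof (rule mult_left_mono[OF C7(2)[OF J'(1,2) j]])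
      show "\<forall>i\<in>J'. B i \<subseteq> ball (z j) (L * (c * d j))"
      proof
        fix i assume i: "i \<in> J'"
        then obtain l where "kk i l = j" by (auto simp: J'_def)
        then show "B i \<subseteq> ball (z j) (L * (c * d j))" using chainD(4)[OF kk, of i l] i J' by auto
      qed
    qed (use \<alpha> in auto)
    also have "\<dots> = C6 * w j"
    proof -
      have "d j powr (q - p) * d j powr - q = d j powr - p" by (simp add: powr_add[symmetric])
      moreover have "\<alpha> / (\<alpha> - 1) * (Cj powr (p - q) * d j powr (q - p)) * (C7 * (d j powr - q * V j)) =
        C6 * ((d j powr (q - p) * d j powr - q) * V j)"
        unfolding C6_def by (simp only: mult_ac)
      ultimately show ?thesis by (simp only: w_def)
    qed
    finally show ?thesis .
  qed
  have main: "(\<Sum>i\<in>J. w i * A u i powr p) \<le> (2 powr p * c1 powr p * C5 + 1) * E"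
    if u: "test_pair g u" and P: "p_integral u UNIV = ennreal P" "0 \<le> P" and E: "energy g UNIV = ennreal E" "0 \<le> E" and J: "finite J" "J \<subseteq> I"
    for g u P E J
  proof -
    define s where "s j = K1 powr p * (c * d j) powr p * (local_energy g j / V j)" for j
    have s0: "0 \<le> s j" for j by (simp add: s_def local_energy_nonneg)
    define T where "T i m = (\<Sum>l<m. \<alpha> ^ l * s (kk i l))" for i m
    have T0: "0 \<le> T i m" for i m unfolding T_def using \<alpha> s0 by (intro sum_nonneg) auto
    have tele: "A u i \<le> c1 * T i m powr (1 / p) + A u (kk i m)" if i: "i \<in> I" for i m
    proof -
      note ch = chainD[OF kk[OF i]]
      have st: "\<bar>A u (kk i l) - A u (kk i (Suc l))\<bar> \<le> \<beta> ^ l * T i m powr (1 / p)" if l: "l < m" for l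
      proof -
        have "\<bar>A u (kk i l) - A u (kk i (Suc l))\<bar> powr p \<le> s (kk i l)"
          unfolding s_def by (rule K1(2)[OF u E(1) ch(2) ch(2) ch(3)])
        also have "\<dots> \<le> (1 / \<alpha>) ^ l * T i m"
        proof -
          have "\<alpha> ^ l * s (kk i l) \<le> T i m" unfolding T_def
            using l \<alpha> s0 by (intro member_le_sum) auto
          then show ?thesis using \<alpha> by (simp add: field_simps)
        qed
        finally have "(\<bar>A u (kk i l) - A u (kk i (Suc l))\<bar> powr p) powr (1 / p) \<le> ((1 / \<alpha>) ^ l * T i m) powr (1 / p)"
          using p by (intro powr_mono2) auto
        also have "\<dots> = ((1 / \<alpha>) ^ l) powr (1 / p) * T i m powr (1 / p)" using \<alpha> T0 by (simp add: powr_mult)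
        also have "((1 / \<alpha>) ^ l) powr (1 / p) = \<beta> ^ l"
        proof -
          have x: "0 < 1 / \<alpha>" using \<alpha> by simp
          have "((1 / \<alpha>) ^ l) powr (1 / p) = ((1 / \<alpha>) powr real l) powr (1 / p)" by (simp only: powr_realpow[OF x])
          also have "\<dots> = ((1 / \<alpha>) powr (1 / p)) powr real l" by (simp only: powr_powr mult.commute)
          also have "\<dots> = ((1 / \<alpha>) powr (1 / p)) ^ l" using \<alpha> by (intro powr_realpow) auto
          also have "(1 / \<alpha>) powr (1 / p) = \<beta>" unfolding \<beta>_def using \<alpha> by (simp add: powr_divide powr_minus_divide)
          finally show ?thesis .
        qed
        finally show ?thesis using p by (simp add: powr_powr)
      qed
      have "\<bar>A u i - A u (kk i l)\<bar> \<le> (\<Sum>l<l. \<beta> ^ l) * T i m powr (1 / p)" if "l \<le> m" for l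
        using that
      proof (induction l)
        case 0 then show ?case using ch(1) by simp
      next
        case (Suc l)
        then show ?case using st[of l] by (simp add: distrib_right)
      qed
      from this[of m] have "\<bar>A u i - A u (kk i m)\<bar> \<le> (\<Sum>l<m. \<beta> ^ l) * T i m powr (1 / p)" by simp
      also have "\<dots> \<le> c1 * T i m powr (1 / p)"
      proof (intro mult_right_mono)
        have "(\<Sum>k<m. \<beta> ^ k) \<le> (\<Sum>k. \<beta> ^ k)" using \<beta> by (intro sum_le_suminf summable_geometric) auto
        then show "(\<Sum>k<m. \<beta> ^ k) \<le> c1" using \<beta> by (simp add: suminf_geometric c1_def)
      qed auto
      finally show ?thesis by linarith
    qed
    \<comment> \<open>The steps of all chains are collected according to the ball at which they start.\<close>
    have swap: "(\<Sum>i\<in>J. w i * T i m) \<le> C5 * E" for m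
    proof -
      define js where "js = (\<Union>i\<in>J. kk i ` {..<m})"
      have js: "finite js" "js \<subseteq> I" unfolding js_def using J chainD(2)[OF kk] by auto
      have "(\<Sum>i\<in>J. w i * T i m) = (\<Sum>i\<in>J. \<Sum>j\<in>js. \<Sum>l\<in>{l \<in> {..<m}. kk i l = j}. w i * \<alpha> ^ l * s (kk i l))"
      proof (rule sum.cong[OF refl])
        fix i assume "i \<in> J"
        then have "kk i ` {..<m} \<subseteq> js" by (auto simp: js_def)
        then have "(\<Sum>j\<in>js. \<Sum>l\<in>{l \<in> {..<m}. kk i l = j}. w i * \<alpha> ^ l * s (kk i l)) = (\<Sum>l<m. w i * \<alpha> ^ l * s (kk i l))"
          using js by (intro sum.group) auto
        then show "w i * T i m = (\<Sum>j\<in>js. \<Sum>l\<in>{l \<in> {..<m}. kk i l = j}. w i * \<alpha> ^ l * s (kk i l))"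
          by (simp add: T_def sum_distrib_left mult.assoc)
      qed
      also have "\<dots> = (\<Sum>j\<in>js. \<Sum>i\<in>J. \<Sum>l\<in>{l \<in> {..<m}. kk i l = j}. w i * \<alpha> ^ l * s (kk i l))" by (rule sum.swap)
      also have "\<dots> = (\<Sum>j\<in>js. s j * (\<Sum>i\<in>J. \<Sum>l\<in>{l \<in> {..<m}. kk i l = j}. w i * \<alpha> ^ l))"
        unfolding sum_distrib_left by (intro sum.cong refl) (auto simp: mult.commute)
      also have "\<dots> \<le> (\<Sum>j\<in>js. s j * (C6 * w j))"
        using js J by (intro sum_mono mult_left_mono inner s0) auto
      also have "\<dots> = (\<Sum>j\<in>js. K1 powr p * c powr p * C6 * local_energy g j)"
      proof (rule sum.cong[OF refl])
        fix j assume "j \<in> js"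
        then have j: "j \<in> I" using js by auto
        have "(c * d j) powr p * d j powr - p = c powr p"
          using c d_pos[OF j] by (simp add: powr_mult mult.assoc powr_add[symmetric])
        moreover have "local_energy g j / V j * V j = local_energy g j" using V_pos[OF j] by simp
        moreover have "s j * (C6 * w j) = K1 powr p * ((c * d j) powr p * d j powr - p) * C6 * (local_energy g j / V j * V j)"
          unfolding s_def w_def by (simp only: mult_ac)
        ultimately show "s j * (C6 * w j) = K1 powr p * c powr p * C6 * local_energy g j" by (simp only:)
      qed
      also have "\<dots> = K1 powr p * c powr p * C6 * (\<Sum>j\<in>js. local_energy g j)" by (rule sum_distrib_left[symmetric])
      also have "\<dots> \<le> K1 powr p * c powr p * C6 * (n1 * E)"
        using C6 by (intro mult_left_mono n1[OF E test_pairD(5)[OF u] js]) auto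
      finally show ?thesis by (simp add: C5_def mult.assoc)
    qed
    define W where "W = (\<Sum>i\<in>J. w i)"
    have W: "0 \<le> W" unfolding W_def using w0 by (intro sum_nonneg) auto
    have approx: "(\<Sum>i\<in>J. w i * A u i powr p) \<le> 2 powr p * (c1 powr p * (C5 * E) + (2 * \<eta>) powr p * W)" if \<eta>: "0 < \<eta>" for \<eta>
    proof -
      have "\<forall>\<^sub>F m in sequentially. \<forall>i\<in>J. A u (kk i m) \<le> 2 * \<eta>"
        using J by (intro eventually_ball_finite ballI chain_average_vanishes[OF u P kk \<eta>]) auto
      then obtain m where m: "\<And>i. i \<in> J \<Longrightarrow> A u (kk i m) \<le> 2 * \<eta>" by (auto simp: eventually_sequentially)
      have "(\<Sum>i\<in>J. w i * A u i powr p) \<le> (\<Sum>i\<in>J. w i * (2 powr p * (c1 powr p * T i m + (2 * \<eta>) powr p)))"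
      proof (intro sum_mono mult_left_mono w0)
        fix i assume i: "i \<in> J"
        then have iI: "i \<in> I" using J by auto
        have "A u i \<le> c1 * T i m powr (1 / p) + 2 * \<eta>" using tele[OF iI, of m] m[OF i] by linarith
        then have "A u i powr p \<le> (c1 * T i m powr (1 / p) + 2 * \<eta>) powr p"
          using p ball_mean_bounds(1)[OF u rad_pos[OF iI]] by (intro powr_mono2) auto
        also have "\<dots> \<le> 2 powr p * ((c1 * T i m powr (1 / p)) powr p + (2 * \<eta>) powr p)"
          using p c1 \<eta> by (intro powr_add_le) auto
        also have "(c1 * T i m powr (1 / p)) powr p = c1 powr p * T i m"
          using c1 p T0 by (simp add: powr_mult powr_powr)
        finally show "A u i powr p \<le> 2 powr p * (c1 powr p * T i m + (2 * \<eta>) powr p)" .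
      qed
      also have "\<dots> = 2 powr p * (c1 powr p * (\<Sum>i\<in>J. w i * T i m) + (2 * \<eta>) powr p * W)"
        unfolding W_def by (simp add: sum_distrib_left sum_distrib_right sum.distrib distrib_left mult_ac)
      also have "\<dots> \<le> 2 powr p * (c1 powr p * (C5 * E) + (2 * \<eta>) powr p * W)"
        by (intro mult_left_mono add_right_mono swap) auto
      finally show ?thesis .
    qed
    \<comment> \<open>The truncated chains leave the error \<open>\<eta>\<close>, which is arbitrary as long as \<open>J\<close> is finite.\<close>
    have "((\<lambda>\<eta>. 2 powr p * (c1 powr p * (C5 * E) + (2 * \<eta>) powr p * W)) \<longlongrightarrow> 2 powr p * (c1 powr p * (C5 * E) + (2 * 0) powr p * W)) (at_right 0)"
      using p by (intro tendsto_intros tendsto_powr') (auto simp: eventually_at_filter)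
    then have "(\<Sum>i\<in>J. w i * A u i powr p) \<le> 2 powr p * (c1 powr p * (C5 * E) + (2 * 0) powr p * W)"
      by (rule tendsto_lowerbound) (auto simp: eventually_at_filter approx)
    also have "\<dots> \<le> (2 powr p * c1 powr p * C5 + 1) * E" using p E by (simp add: distrib_right)
    finally show ?thesis .
  qed
  have "0 < 2 powr p * c1 powr p * C5 + 1" using C5 by (intro add_nonneg_pos) auto
  then show ?thesis using main unfolding w_def by meson
qed

text \<open>
  On each Whitney ball \<open>u\<close> is split into its oscillation, which the strong Poincare inequality
  controls, and its mean, for which the preceding lemma sums the contributions of all balls.
\<close>

lemma thin_hardy:
  "\<exists>C>0. \<forall>g u. test_pair g u \<longrightarrow> p_integral u UNIV < \<infinity> \<longrightarrow> p_integral (\<lambda>y. u y / infdist y F) (- F) \<le> ennreal C * energy g UNIV"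
proof -
  obtain C1 where C1: "0 < C1" "\<And>g u P E J. test_pair g u \<Longrightarrow> p_integral u UNIV = ennreal P \<Longrightarrow> 0 \<le> P \<Longrightarrow> energy g UNIV = ennreal E \<Longrightarrow> 0 \<le> E \<Longrightarrow>
     finite J \<Longrightarrow> J \<subseteq> I \<Longrightarrow> (\<Sum>i\<in>J. d i powr - p * V i * A u i powr p) \<le> C1 * E"
    using average_sum_le by meson
  obtain n1 :: nat where n1: "\<And>g E J. energy g UNIV = ennreal E \<Longrightarrow> 0 \<le> E \<Longrightarrow> g \<in> borel_measurable borel \<Longrightarrow> finite J \<Longrightarrow> J \<subseteq> I \<Longrightarrow>
     (\<Sum>j\<in>J. local_energy g j) \<le> real n1 * E"
    using local_energy_sum_le by meson
  obtain C2 where C2: "0 < C2" "\<And>f g x0 r. test_pair g f \<Longrightarrow> 0 < r \<Longrightarrow>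
     p_integral (\<lambda>y. \<bar>f y - ball_mean f x0 r\<bar>) (ball x0 r) \<le> ennreal (C2 * r powr p) * energy g (ball x0 (2 * lam * r))"
    using poincare_strong unfolding p_integral_def by blast
  define C where "C = 2 powr p * 2 powr p * (C2 * c powr p * n1 + C1)"
  have C: "0 < C" unfolding C_def using C1 C2 by (intro mult_pos_pos add_nonneg_pos) auto
  have main: "p_integral (\<lambda>y. u y / infdist y F) (- F) \<le> ennreal C * energy g UNIV"
    if u: "test_pair g u" and fin: "p_integral u UNIV < \<infinity>" for g u
  proof (cases "energy g UNIV = \<infinity>")
    case True then show ?thesis using C by (simp add: ennreal_mult_top)
  next
    case False
    obtain E where E: "energy g UNIV = ennreal E" "0 \<le> E" using False by (cases "energy g UNIV") auto
    obtain P where P: "p_integral u UNIV = ennreal P" "0 \<le> P" using fin by (cases "p_integral u UNIV") auto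
    note [measurable] = test_pairD(1)[OF u]
    have one: "p_integral (\<lambda>y. u y / infdist y F) (B i) \<le> ennreal (2 powr p * 2 powr p * (C2 * c powr p * local_energy g i + d i powr - p * V i * A u i powr p))"
      if i: "i \<in> I" for i
    proof -
      have di: "0 < d i" by (rule d_pos[OF i])
      have A0: "0 \<le> A u i" by (rule ball_mean_bounds[OF u rad_pos[OF i]])
      have "p_integral (\<lambda>y. u y / infdist y F) (B i) \<le> p_integral (\<lambda>y. 2 / d i * (\<bar>u y - A u i\<bar> + A u i)) (B i)"
      proof (rule p_integral_mono)
        fix y assume y: "y \<in> B i"
        have "c * d i \<le> 1 / 6 * d i" using c6(1) di by (intro mult_right_mono) auto
        then have "d i / 2 \<le> infdist y F" using dist_in_B[OF y] di by linarith
        then have "u y / infdist y F \<le> u y / (d i / 2)" using di test_pairD(2)[OF u, of y] by (intro divide_left_mono) auto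
        also have "\<dots> = 2 / d i * u y" by simp
        also have "\<dots> \<le> 2 / d i * (\<bar>u y - A u i\<bar> + A u i)" using di by (intro mult_left_mono) auto
        finally show "0 \<le> u y / infdist y F \<and> u y / infdist y F \<le> 2 / d i * (\<bar>u y - A u i\<bar> + A u i)"
          using test_pairD(2)[OF u, of y] infdist_nonneg[of y F] by simp
      qed simp
      also have "\<dots> = ennreal ((2 / d i) powr p) * p_integral (\<lambda>y. \<bar>u y - A u i\<bar> + A u i) (B i)"
        using di A0 by (intro p_integral_cmult) auto
      also have "\<dots> \<le> ennreal ((2 / d i) powr p) * (ennreal (2 powr p) * (p_integral (\<lambda>y. \<bar>u y - A u i\<bar>) (B i) + p_integral (\<lambda>y. A u i) (B i)))"
        using A0 by (intro mult_left_mono p_integral_add_le) auto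
      also have "p_integral (\<lambda>y. A u i) (B i) = ennreal (A u i powr p * V i)"
        unfolding p_integral_def by (simp add: nn_integral_cmult_indicator emeasure_ball_eq[OF rad_pos[OF i]] ennreal_mult)
      also have "ennreal ((2 / d i) powr p) * (ennreal (2 powr p) * (p_integral (\<lambda>y. \<bar>u y - A u i\<bar>) (B i) + ennreal (A u i powr p * V i))) \<le>
        ennreal ((2 / d i) powr p) * (ennreal (2 powr p) * (ennreal (C2 * (c * d i) powr p * local_energy g i) + ennreal (A u i powr p * V i)))"
      proof (intro mult_left_mono add_right_mono)
        have "2 * lam * (c * d i) \<le> 2 / 3 * d i"
          using mult_right_mono[OF c6(2), of "d i"] di by (simp add: mult_ac)
        then have sub: "ball (z i) (2 * lam * (c * d i)) \<subseteq> ball (z i) (2 / 3 * d i)" by (rule subset_ball)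
        have "p_integral (\<lambda>y. \<bar>u y - A u i\<bar>) (B i) \<le> ennreal (C2 * (c * d i) powr p) * energy g (ball (z i) (2 * lam * (c * d i)))"
          by (rule C2(2)[OF u rad_pos[OF i]])
        also have "\<dots> \<le> ennreal (C2 * (c * d i) powr p) * ennreal (local_energy g i)"
          unfolding local_energy_eq[OF E(1), symmetric] by (intro mult_left_mono energy_mono sub) simp
        also have "\<dots> = ennreal (C2 * (c * d i) powr p * local_energy g i)" using C2(1) local_energy_nonneg by (simp add: ennreal_mult)
        finally show "p_integral (\<lambda>y. \<bar>u y - A u i\<bar>) (B i) \<le> ennreal (C2 * (c * d i) powr p * local_energy g i)" .
      qed auto
      also have "\<dots> = ennreal ((2 / d i) powr p * (2 powr p * (C2 * (c * d i) powr p * local_energy g i + A u i powr p * V i)))"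
        using C2(1) local_energy_nonneg by (simp add: ennreal_mult)
      also have "(2 / d i) powr p * (2 powr p * (C2 * (c * d i) powr p * local_energy g i + A u i powr p * V i)) =
        2 powr p * 2 powr p * (C2 * c powr p * local_energy g i + d i powr - p * V i * A u i powr p)"
      proof -
        have x: "(2 / d i) powr p = 2 powr p * d i powr - p" using di by (simp add: powr_divide powr_minus_divide)
        have y: "d i powr - p * (c * d i) powr p = c powr p" using di c by (simp add: powr_mult mult.left_commute powr_add[symmetric])
        have "(2 / d i) powr p * (2 powr p * (C2 * (c * d i) powr p * local_energy g i + A u i powr p * V i)) =
          2 powr p * 2 powr p * (C2 * (d i powr - p * (c * d i) powr p) * local_energy g i + d i powr - p * V i * A u i powr p)"
          unfolding x by (simp add: algebra_simps)
        then show ?thesis unfolding y .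
      qed
      finally show ?thesis .
    qed
    show ?thesis unfolding p_integral_def
    proof (rule nn_integral_exhaust_le[where B = "\<lambda>n. \<Union>i\<in>I \<inter> {..<n}. B i"])
      show "- F \<in> sets N" using F(1) by (intro borel_in_sets borel_open) (rule open_Compl)
      show "(\<Union>i\<in>I \<inter> {..<n}. B i) \<in> sets N" for n by (intro borel_in_sets borel_open open_UN) auto
      show "incseq (\<lambda>n. \<Union>i\<in>I \<inter> {..<n}. B i)" by (intro monoI UN_mono) auto
      show "- F \<subseteq> (\<Union>n. \<Union>i\<in>I \<inter> {..<n}. B i)" using cover by blast
      show "(\<lambda>y. ennreal ((u y / infdist y F) powr p)) \<in> borel_measurable N" by measurable
      fix n :: nat
      let ?J = "I \<inter> {..<n}"
      have J: "finite ?J" "?J \<subseteq> I" by auto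
      have "(\<integral>\<^sup>+ y \<in> - F \<inter> (\<Union>i\<in>?J. B i). ennreal ((u y / infdist y F) powr p) \<partial>N) \<le> (\<Sum>i\<in>?J. p_integral (\<lambda>y. u y / infdist y F) (B i))"
        unfolding p_integral_def by (intro nn_integral_subcover_le) auto
      also have "\<dots> \<le> (\<Sum>i\<in>?J. ennreal (2 powr p * 2 powr p * (C2 * c powr p * local_energy g i + d i powr - p * V i * A u i powr p)))"
        by (intro sum_mono one) auto
      also have "\<dots> = ennreal (2 powr p * 2 powr p * (C2 * c powr p * (\<Sum>i\<in>?J. local_energy g i) + (\<Sum>i\<in>?J. d i powr - p * V i * A u i powr p)))"
        using C2(1) local_energy_nonneg by (subst sum_ennreal) (auto simp: sum_distrib_left sum.distrib distrib_left)
      also have "\<dots> \<le> ennreal (2 powr p * 2 powr p * (C2 * c powr p * (n1 * E) + C1 * E))"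
        using C2(1) by (intro ennreal_leI mult_left_mono add_mono n1[OF E test_pairD(5)[OF u] J] C1(2)[OF u P E J]) auto
      also have "2 powr p * 2 powr p * (C2 * c powr p * (n1 * E) + C1 * E) = C * E" by (simp add: C_def algebra_simps)
      also have "ennreal (C * E) = ennreal C * energy g UNIV" unfolding E(1) using C E(2) by (simp add: ennreal_mult)
      finally show "(\<integral>\<^sup>+ y \<in> - F \<inter> (\<Union>i\<in>?J. B i). ennreal ((u y / infdist y F) powr p) \<partial>N) \<le> ennreal C * energy g UNIV" .
    qed
  qed
  show ?thesis using C main by blast
qed

end

section \<open>From Hardy inequalities to quasiadditivity\<close>

context growing_poincare_space begin

text \<open>
  A Hardy inequality gives quasiadditivity: a test function for \<open>E\<close>, multiplied by a cutoff
  function of a Whitney ball \<open>Q\<close>, is one for \<open>E \<inter> Q\<close>. The gradient of the cutoff function is of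
  order \<open>1 / d\<close>, and the enlarged balls have bounded overlap.
\<close>

lemma quasiadditive_of_hardy:
  assumes C: "0 < C" and hardy: "\<And>g u. test_pair g u \<Longrightarrow> (\<And>y. y \<notin> \<Omega> \<Longrightarrow> u y = 0) \<Longrightarrow> p_integral u UNIV < \<infinity> \<Longrightarrow>
      p_integral (\<lambda>y. u y / infdist y (- \<Omega>)) \<Omega> \<le> ennreal C * energy g UNIV"
    and wc: "whitney_cover c \<Omega> I z" and c4: "c \<le> 1 / 4"
  shows "quasiadditive M p \<Omega> I (whitney_ball c \<Omega> z)"
proof -
  let ?d = "\<lambda>y. infdist y (- \<Omega>)"
  have \<Omega>: "open \<Omega>" "- \<Omega> \<noteq> {}" and c: "0 < c" and zI: "\<And>i. i \<in> I \<Longrightarrow> z i \<in> \<Omega>"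
    using wc by (auto simp: whitney_cover_def)
  have cl: "closed (- \<Omega>)" using \<Omega>(1) by (rule closed_Compl)
  obtain n0 :: nat where n0: "\<And>x. finite {i \<in> I. x \<in> ball (z i) (c * ?d (z i))} \<and> card {i \<in> I. x \<in> ball (z i) (c * ?d (z i))} \<le> n0"
    using wc unfolding whitney_cover_def whitney_ball_def whitney_radius_def by blast
  have dpos: "0 < ?d (z i)" if "i \<in> I" for i
    using infdist_pos_not_in_closed[OF cl \<Omega>(2), of "z i"] zI[OF that] by simp
  have "\<exists>n. \<forall>F I (z :: nat \<Rightarrow> 'a). (\<forall>i\<in>I. 0 < infdist (z i) F) \<longrightarrow>
    (\<forall>x. finite {i \<in> I. x \<in> ball (z i) (c * infdist (z i) F)} \<and> card {i \<in> I. x \<in> ball (z i) (c * infdist (z i) F)} \<le> n0) \<longrightarrow>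
    (\<forall>x. finite {i \<in> I. x \<in> ball (z i) (1 / 2 * infdist (z i) F)} \<and> card {i \<in> I. x \<in> ball (z i) (1 / 2 * infdist (z i) F)} \<le> n)"
    by (rule whitney_overlap) (use c c4 in auto)
  then obtain n where n: "\<forall>F I (z :: nat \<Rightarrow> 'a). (\<forall>i\<in>I. 0 < infdist (z i) F) \<longrightarrow>
    (\<forall>x. finite {i \<in> I. x \<in> ball (z i) (c * infdist (z i) F)} \<and> card {i \<in> I. x \<in> ball (z i) (c * infdist (z i) F)} \<le> n0) \<longrightarrow>
    (\<forall>x. finite {i \<in> I. x \<in> ball (z i) (1 / 2 * infdist (z i) F)} \<and> card {i \<in> I. x \<in> ball (z i) (1 / 2 * infdist (z i) F)} \<le> n)"
    by (rule exE)
  have n': "finite {i \<in> I. x \<in> ball (z i) (1 / 2 * ?d (z i))} \<and> card {i \<in> I. x \<in> ball (z i) (1 / 2 * ?d (z i))} \<le> n" for x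
    by (rule n[rule_format]) (use dpos n0 in auto)
  define r where "r i = c * ?d (z i)" for i
  have r: "0 < r i" if "i \<in> I" for i using dpos[OF that] c by (simp add: r_def)
  have r2: "ball (z i) (2 * r i) \<subseteq> ball (z i) (1 / 2 * ?d (z i))" if "i \<in> I" for i
    unfolding r_def using dpos[OF that] c4 by (intro subset_ball) (simp add: mult_right_mono[of "2 * c" "1 / 2"] mult.assoc[symmetric])
  have near: "\<bar>?d (z i) - ?d y\<bar> < 1 / 2 * ?d (z i)" if "i \<in> I" "y \<in> ball (z i) (2 * r i)" for i y
    using infdist_triangle_abs[of "z i" "- \<Omega>" y] subsetD[OF r2[OF that(1)] that(2)] by simp
  have in\<Omega>: "ball (z i) (2 * r i) \<subseteq> \<Omega>" if "i \<in> I" for i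
  proof
    fix y assume y: "y \<in> ball (z i) (2 * r i)"
    have "0 < ?d y" using near[OF that y] dpos[OF that] by linarith
    then show "y \<in> \<Omega>" by (metis ComplI infdist_zero less_irrefl)
  qed
  have ovl: "card {i \<in> J. y \<in> ball (z i) (2 * r i)} \<le> Suc n" if "J \<subseteq> I" for J y
  proof -
    have "card {i \<in> J. y \<in> ball (z i) (2 * r i)} \<le> card {i \<in> I. y \<in> ball (z i) (1 / 2 * ?d (z i))}"
    proof (rule card_mono)
      show "{i \<in> J. y \<in> ball (z i) (2 * r i)} \<subseteq> {i \<in> I. y \<in> ball (z i) (1 / 2 * ?d (z i))}" using that r2 by blast
    qed (use n'[of y] in blast)
    then show ?thesis using n'[of y] by linarith
  qed
  define a where "a = 2 powr p * (Suc n * (1 + (3 / c) powr p * C))"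
  have a: "0 < a" unfolding a_def using C by (intro mult_pos_pos add_pos_nonneg) auto
  have test: "(\<Sum>i\<in>J. cap M p (E \<inter> whitney_ball c \<Omega> z i) \<Omega>) \<le> ennreal a * energy g UNIV"
    if J: "finite J" "J \<subseteq> I" and u: "test_pair g u" "\<And>x. x \<in> E \<Longrightarrow> u x = 1" "\<And>x. x \<notin> \<Omega> \<Longrightarrow> u x = 0" "p_integral u UNIV < \<infinity>" for J E g u
  proof -
    note [measurable] = test_pairD(1)[OF u(1)]
    have [measurable]: "\<Omega> \<in> sets N" using \<Omega>(1) by simp
    have one: "cap M p (E \<inter> whitney_ball c \<Omega> z i) \<Omega> \<le> ennreal (2 powr p) * (energy g (ball (z i) (2 * r i)) +
        ennreal ((3 / c) powr p) * p_integral (\<lambda>y. u y / ?d y) (ball (z i) (2 * r i)))" if i: "i \<in> I" for i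
    proof -
      obtain g' where g': "test_pair g' (\<lambda>y. u y * ball_cutoff (z i) (r i) y)"
        "energy g' UNIV \<le> ennreal (2 powr p) * (energy g (ball (z i) (2 * r i)) + ennreal ((2 / r i) powr p) * p_integral u (ball (z i) (2 * r i)))"
        by (rule test_pair_ball_cutoff[OF u(1) r[OF i]])
      have "cap M p (E \<inter> whitney_ball c \<Omega> z i) \<Omega> \<le> energy g' UNIV"
      proof (rule cap_le_energy[OF g'(1)])
        show "u x * ball_cutoff (z i) (r i) x = 1" if "x \<in> E \<inter> whitney_ball c \<Omega> z i" for x
          using that u(2) ball_cutoff_simps(3)[OF r[OF i], of x "z i"] by (simp add: whitney_ball_def whitney_radius_def r_def)
        show "u x * ball_cutoff (z i) (r i) x = 0" if "x \<notin> \<Omega>" for x using u(3)[OF that] by simp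
        have "p_integral (\<lambda>y. u y * ball_cutoff (z i) (r i) y) UNIV \<le> p_integral u UNIV"
          using test_pairD(2)[OF u(1)] ball_cutoff_simps(1,2)[OF r[OF i]] by (intro p_integral_mono) (auto simp: mult_left_le)
        then show "p_integral (\<lambda>y. u y * ball_cutoff (z i) (r i) y) UNIV < \<infinity>" using u(4) by (rule le_less_trans)
      qed
      also note g'(2)
      also have "ennreal ((2 / r i) powr p) * p_integral u (ball (z i) (2 * r i)) = p_integral (\<lambda>y. 2 / r i * u y) (ball (z i) (2 * r i))"
        using r[OF i] test_pairD(2)[OF u(1)] by (intro p_integral_cmult[symmetric]) auto
      also have "\<dots> \<le> p_integral (\<lambda>y. 3 / c * (u y / ?d y)) (ball (z i) (2 * r i))"
      proof (rule p_integral_mono)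
        fix y assume y: "y \<in> ball (z i) (2 * r i)"
        have d: "0 < ?d y" "?d y \<le> 3 / 2 * ?d (z i)" using near[OF i y] dpos[OF i] by linarith+
        have "2 / r i \<le> 3 / c * (1 / ?d y)" using d c dpos[OF i] by (simp add: r_def field_simps)
        then have "2 / r i * u y \<le> 3 / c * (1 / ?d y) * u y" using test_pairD(2)[OF u(1)] by (intro mult_right_mono) auto
        then show "0 \<le> 2 / r i * u y \<and> 2 / r i * u y \<le> 3 / c * (u y / ?d y)" using r[OF i] test_pairD(2)[OF u(1), of y] by simp
      qed simp
      also have "\<dots> = ennreal ((3 / c) powr p) * p_integral (\<lambda>y. u y / ?d y) (ball (z i) (2 * r i))"
        using c test_pairD(2)[OF u(1)] infdist_nonneg[of _ "- \<Omega>"] by (intro p_integral_cmult) auto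
      finally show ?thesis by (simp add: mult_left_mono add_left_mono)
    qed
    have "(\<Sum>i\<in>J. cap M p (E \<inter> whitney_ball c \<Omega> z i) \<Omega>) \<le> (\<Sum>i\<in>J. ennreal (2 powr p) * (energy g (ball (z i) (2 * r i)) +
        ennreal ((3 / c) powr p) * p_integral (\<lambda>y. u y / ?d y) (ball (z i) (2 * r i))))"
      using J by (intro sum_mono one) auto
    also have "\<dots> = ennreal (2 powr p) * ((\<Sum>i\<in>J. energy g (ball (z i) (2 * r i))) +
        ennreal ((3 / c) powr p) * (\<Sum>i\<in>J. p_integral (\<lambda>y. u y / ?d y) (ball (z i) (2 * r i))))"
      by (simp only: sum_distrib_left[symmetric] sum.distrib)
    also have "\<dots> \<le> ennreal (2 powr p) * (of_nat (Suc n) * energy g UNIV +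
        ennreal ((3 / c) powr p) * (of_nat (Suc n) * (ennreal C * energy g UNIV)))"
    proof (intro mult_left_mono add_mono)
      have [measurable]: "g \<in> borel_measurable N" by (rule test_pairD(6)[OF u(1)])
      show "(\<Sum>i\<in>J. energy g (ball (z i) (2 * r i))) \<le> of_nat (Suc n) * energy g UNIV"
        unfolding energy_def using J ovl by (intro nn_integral_overlap_le) auto
      have "(\<Sum>i\<in>J. p_integral (\<lambda>y. u y / ?d y) (ball (z i) (2 * r i))) \<le> of_nat (Suc n) * p_integral (\<lambda>y. u y / ?d y) \<Omega>"
        unfolding p_integral_def
      proof (rule nn_integral_overlap_le[OF J(1)])
        show "ball (z i) (2 * r i) \<subseteq> \<Omega>" if "i \<in> J" for i by (rule in\<Omega>) (use that J in blast)
      qed (use J ovl in auto)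
      also have "\<dots> \<le> of_nat (Suc n) * (ennreal C * energy g UNIV)"
        by (intro mult_left_mono hardy u) auto
      finally show "(\<Sum>i\<in>J. p_integral (\<lambda>y. u y / ?d y) (ball (z i) (2 * r i))) \<le> of_nat (Suc n) * (ennreal C * energy g UNIV)" .
    qed auto
    also have "\<dots> = ennreal a * energy g UNIV"
    proof -
      have "ennreal a = ennreal (2 powr p) * (ennreal (Suc n) * (1 + ennreal ((3 / c) powr p) * ennreal C))"
        using C by (simp add: a_def ennreal_mult del: of_nat_Suc)
      then show ?thesis
        by (simp add: ennreal_of_nat_eq_real_of_nat[symmetric] distrib_left distrib_right mult_ac del: of_nat_Suc)
    qed
    finally show ?thesis .
  qed
  have "(\<Sum>\<^sub>\<infinity>i\<in>I. cap M p (E \<inter> whitney_ball c \<Omega> z i) \<Omega>) \<le> ennreal a * cap M p E \<Omega>" for E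
  proof -
    have "(\<Sum>i\<in>J. cap M p (E \<inter> whitney_ball c \<Omega> z i) \<Omega>) \<le> ennreal a * cap M p E \<Omega>" if J: "finite J" "J \<subseteq> I" for J
    proof -
      let ?X = "\<Sum>i\<in>J. cap M p (E \<inter> whitney_ball c \<Omega> z i) \<Omega>"
      have "?X / ennreal a \<le> cap M p E \<Omega>"
        using a by (intro cap_greatest divide_le_posI_ennreal test[OF J]) auto
      then have "ennreal a * (?X / ennreal a) \<le> ennreal a * cap M p E \<Omega>" by (rule mult_left_mono) simp
      moreover have "ennreal a * (?X / ennreal a) = ?X"
        using a by (simp add: ennreal_times_divide mult.commute[of "ennreal a"] ennreal_mult_divide_eq)
      ultimately show ?thesis by simp
    qed
    then show ?thesis
      by (subst nonneg_infsum_complete) (auto intro!: SUP_least)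
  qed
  then show ?thesis unfolding quasiadditive_def using a by blast
qed

text \<open>
  The distance to a union is the smaller of the two distances, hence its reciprocal is at most the
  sum of the two reciprocals.
\<close>

lemma hardy_union:
  assumes Z: "closed Z" "Z \<noteq> {}" and F: "closed F" "F \<noteq> {}"
    and u: "test_pair g u" and \<Omega>: "\<Omega> \<in> sets borel" "\<Omega> \<inter> (Z \<union> F) = {}"
    and hZ: "p_integral (\<lambda>y. u y / infdist y Z) UNIV \<le> ennreal C1 * X" and hF: "p_integral (\<lambda>y. u y / infdist y F) (- F) \<le> ennreal C2 * X"
    and C: "0 \<le> C1" "0 \<le> C2"
  shows "p_integral (\<lambda>y. u y / infdist y (Z \<union> F)) \<Omega> \<le> ennreal (2 powr p * (C1 + C2)) * X"
proof -
  note [measurable] = test_pairD(1)[OF u]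
  have nn: "0 \<le> u y / infdist y A" for y A
    using test_pairD(2)[OF u, of y] infdist_nonneg[of y A] by (rule divide_nonneg_nonneg)
  have "p_integral (\<lambda>y. u y / infdist y (Z \<union> F)) \<Omega> \<le> p_integral (\<lambda>y. u y / infdist y Z + u y / infdist y F) \<Omega>"
  proof (rule p_integral_mono)
    fix y assume "y \<in> \<Omega>"
    then have d: "0 < infdist y Z" "0 < infdist y F"
      using infdist_pos_not_in_closed[OF Z] infdist_pos_not_in_closed[OF F] \<Omega>(2) by auto
    have "infdist y (Z \<union> F) = min (infdist y Z) (infdist y F)" using Z F by (intro infdist_Un_min)
    then show "0 \<le> u y / infdist y (Z \<union> F) \<and> u y / infdist y (Z \<union> F) \<le> u y / infdist y Z + u y / infdist y F"
      using d test_pairD(2)[OF u, of y] by (auto simp: min_def)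
  qed simp
  also have "\<dots> \<le> ennreal (2 powr p) * (p_integral (\<lambda>y. u y / infdist y Z) \<Omega> + p_integral (\<lambda>y. u y / infdist y F) \<Omega>)"
    using nn \<Omega>(1) by (intro p_integral_add_le) auto
  also have "\<dots> \<le> ennreal (2 powr p) * (ennreal C1 * X + ennreal C2 * X)"
  proof (intro mult_left_mono add_mono)
    show "p_integral (\<lambda>y. u y / infdist y Z) \<Omega> \<le> ennreal C1 * X"
      using nn by (intro order_trans[OF p_integral_mono hZ]) auto
    show "p_integral (\<lambda>y. u y / infdist y F) \<Omega> \<le> ennreal C2 * X"
      using nn \<Omega>(2) by (intro order_trans[OF p_integral_mono hF]) auto
  qed simp
  also have "\<dots> = ennreal (2 powr p * (C1 + C2)) * X"
    using C by (simp add: ennreal_mult distrib_right mult.assoc)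
  finally show ?thesis .
qed

end

lemma ediam_UNIV_unbounded:
  assumes "\<not> bounded (UNIV :: 'a::metric_space set)"
  shows "ediam (UNIV :: 'a set) = \<infinity>"
proof (rule ccontr)
  assume "ediam (UNIV :: 'a set) \<noteq> \<infinity>"
  then obtain D where D: "ediam (UNIV :: 'a set) = ennreal D" "0 \<le> D" by (cases "ediam (UNIV :: 'a set)") auto
  have "dist x y \<le> D" for x y :: 'a
  proof -
    have "ennreal (dist x y) \<le> ediam (UNIV :: 'a set)" unfolding ediam_def
      by (rule SUP_upper2[of x], simp, rule SUP_upper) simp
    then show ?thesis using D by simp
  qed
  then show False using assms unfolding bounded_def by blast
qed

theorem lemma5p1:
  fixes M :: "'a::complete_space measure"
    and p Q lam c' :: real
    and \<Omega>0 F :: "'a set"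
    and I' :: "nat set" and z' :: "nat \<Rightarrow> 'a"
  assumes "metric_measure M"
    and "doubling M"
    and "volume_exponent M Q"
    and "poincare_inequality M p lam"
    and "\<not> bounded (UNIV :: 'a set)"
    and "1 < p" and "p < Q"
    and "open \<Omega>0"
    and "uniformly_fat M p (- \<Omega>0)"
    and "F \<subseteq> closure \<Omega>0" and "closed F" and "F \<noteq> {}"
    and "codim_A M F > ereal p"
    and "0 < c'" and "c' \<le> 1 / (6 * lam)"
    and "whitney_cover c' (- F) I' z'"
    and "discrete_john c' (- F) I' z'"
  shows "\<exists>c0. 0 < c0 \<and> c0 \<le> 1 / 2 \<and>
    (\<forall>c I z. 0 < c \<and> c \<le> c0 \<and> whitney_cover c (\<Omega>0 - F) I z \<longrightarrow>
       quasiadditive M p (\<Omega>0 - F) I (whitney_ball c (\<Omega>0 - F) z))"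
proof -
  obtain Cd where Cd: "\<And>x r. 0 < r \<Longrightarrow> measure M (ball x (2 * r)) \<le> Cd * measure M (ball x r)"
    using assms(2) unfolding doubling_def by blast
  obtain Cp where Cp: "0 < Cp" "1 \<le> lam" "\<And>x r f g. 0 < r \<Longrightarrow> upper_gradient M g f \<Longrightarrow>
     (\<integral>\<^sup>+ y \<in> ball x r. e2ennreal \<bar>f y - ereal (ball_average M f (ball x r))\<bar> \<partial>completion M)
        / emeasure M (ball x r)
     \<le> ennreal (Cp * r) *
       epow ((\<integral>\<^sup>+ y \<in> ball x (lam * r). epow (g y) p \<partial>M) / emeasure M (ball x (lam * r))) (1 / p)"
    using assms(4) unfolding poincare_inequality_def by blast
  obtain Cq where Cq: "0 < Q" "0 < Cq" "\<And>x y r R. 0 < r \<Longrightarrow> r < R \<Longrightarrow> y \<in> ball x R \<Longrightarrow>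
     measure M (ball y r) / measure M (ball x R) \<le> Cq * (r / R) powr Q"
    using assms(3) unfolding volume_exponent_def ediam_UNIV_unbounded[OF assms(5)] by auto
  interpret doubling_space M Cd
    by unfold_locales (use assms(1) Cd in \<open>auto simp: metric_measure_def\<close>)
  interpret growing_poincare_space M Cd p lam Cp Q Cq
  proof unfold_locales
    show "1 < p" "1 \<le> lam" "0 < Cp" "0 < Q" "0 < Cq" using assms(6) Cp Cq by auto
    show "vol y r \<le> Cq * (r / R) powr Q * vol x R" if "0 < r" "r < R" "y \<in> ball x R" for x y r R
    proof -
      have "0 < vol x R" using that by (intro vol_pos) simp
      then show ?thesis using Cq(3)[OF that] by (simp add: pos_divide_le_eq)
    qed
  qed (rule Cp(3))
  obtain q CA where q: "p < q" "0 < CA" "\<And>x r. x \<in> F \<Longrightarrow> 0 < r \<Longrightarrow>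
      dist_power F q (ball x r) \<le> ennreal (CA * (r powr - q * vol x r))"
    using codim_all_radii[of F] assms(7,12,13) by blast
  obtain n0 :: nat where n0: "\<And>x. finite {i \<in> I'. x \<in> whitney_ball c' (- F) z' i} \<and> card {i \<in> I'. x \<in> whitney_ball c' (- F) z' i} \<le> n0"
    using assms(16) unfolding whitney_cover_def by blast
  have wb: "whitney_ball c' (- F) z' i = ball (z' i) (c' * infdist (z' i) F)" "whitney_radius c' (- F) z' i = c' * infdist (z' i) F" for i
    by (simp_all add: whitney_ball_def whitney_radius_def)
  obtain L a Cj where John: "1 < L" "1 < a" "0 < Cj" "\<forall>i\<in>I'. \<exists>k :: nat \<Rightarrow> nat.
     k 0 = i \<and> (\<forall>m. k m \<in> I' \<and>
       whitney_ball c' (- F) z' (k m) \<inter> whitney_ball c' (- F) z' (k (Suc m)) \<noteq> {} \<and>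
       whitney_ball c' (- F) z' i \<subseteq> ball (z' (k m)) (L * whitney_radius c' (- F) z' (k m)) \<and>
       whitney_radius c' (- F) z' (k m) \<ge> Cj * a ^ m * whitney_radius c' (- F) z' i)"
    using assms(17) unfolding discrete_john_def by (elim exE conjE) (rule that; assumption)
  interpret john: john_cover M Cd p lam Cp Q Cq F c' I' z' L a Cj q CA n0
  proof unfold_locales
    show "- F \<subseteq> (\<Union>i\<in>I'. ball (z' i) (c' * infdist (z' i) F))" "\<And>i. i \<in> I' \<Longrightarrow> z' i \<notin> F"
      using assms(16) unfolding whitney_cover_def wb by auto
    fix i assume "i \<in> I'"
    from bspec[OF John(4) this]
    show "\<exists>k. k 0 = i \<and> (\<forall>m. k m \<in> I' \<and>
       ball (z' (k m)) (c' * infdist (z' (k m)) F) \<inter> ball (z' (k (Suc m))) (c' * infdist (z' (k (Suc m))) F) \<noteq> {} \<and>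
       ball (z' i) (c' * infdist (z' i) F) \<subseteq> ball (z' (k m)) (L * (c' * infdist (z' (k m)) F)) \<and>
       Cj * a ^ m * (c' * infdist (z' i) F) \<le> c' * infdist (z' (k m)) F)"
      unfolding wb .
  qed (rule assms q John(1-3) n0[unfolded wb] | assumption)+
  obtain CF where CF: "0 < CF" "\<And>g u. test_pair g u \<Longrightarrow> p_integral u UNIV < \<infinity> \<Longrightarrow> p_integral (\<lambda>y. u y / infdist y F) (- F) \<le> ennreal CF * energy g UNIV"
    using john.thin_hardy by blast
  let ?\<Omega> = "\<Omega>0 - F"
  have compl: "- ?\<Omega> = - \<Omega>0 \<union> F" by auto
  have op: "open ?\<Omega>" using assms(8,11) by (rule open_Diff)
  have "\<exists>C>0. \<forall>g u. test_pair g u \<longrightarrow> (\<forall>y. y \<notin> ?\<Omega> \<longrightarrow> u y = 0) \<longrightarrow> p_integral u UNIV < \<infinity> \<longrightarrow>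
      p_integral (\<lambda>y. u y / infdist y (- ?\<Omega>)) ?\<Omega> \<le> ennreal C * energy g UNIV"
  proof (cases "- \<Omega>0 = {}")
    case True
    then have "?\<Omega> = - F" "- ?\<Omega> = F" by auto
    then show ?thesis using CF by (intro exI[of _ CF]) auto
  next
    case False
    obtain cF where cF: "0 < cF" "\<And>x r. x \<in> - \<Omega>0 \<Longrightarrow> 0 < r \<Longrightarrow>
      ennreal cF * cap M p (ball x r) (ball x (2 * r)) \<le> cap M p (- \<Omega>0 \<inter> ball x r) (ball x (2 * r))"
      using assms(9) unfolding uniformly_fat_def by blast
    obtain CZ where CZ: "0 < CZ" "\<And>g u. test_pair g u \<Longrightarrow> (\<forall>y\<in>- \<Omega>0. u y = 0) \<Longrightarrow> p_integral u UNIV < \<infinity> \<Longrightarrow>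
      p_integral (\<lambda>y. u y / infdist y (- \<Omega>0)) UNIV \<le> ennreal CZ * energy g UNIV"
      using fat_hardy[OF cF False] by blast
    have "p_integral (\<lambda>y. u y / infdist y (- ?\<Omega>)) ?\<Omega> \<le> ennreal (2 powr p * (CZ + CF)) * energy g UNIV"
      if u: "test_pair g u" "\<forall>y. y \<notin> ?\<Omega> \<longrightarrow> u y = 0" "p_integral u UNIV < \<infinity>" for g u
      unfolding compl
    proof (rule hardy_union[OF _ False assms(11,12) u(1)])
      show "closed (- \<Omega>0)" using assms(8) by (rule closed_Compl)
      show "?\<Omega> \<in> sets borel" using op by simp
      show "p_integral (\<lambda>y. u y / infdist y (- \<Omega>0)) UNIV \<le> ennreal CZ * energy g UNIV"
        using u by (intro CZ(2)) auto
      show "p_integral (\<lambda>y. u y / infdist y F) (- F) \<le> ennreal CF * energy g UNIV" by (rule CF(2)[OF u(1,3)])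
    qed (use CZ CF in auto)
    moreover have "0 < 2 powr p * (CZ + CF)" using CZ CF by simp
    ultimately show ?thesis by blast
  qed
  then obtain C where C: "0 < C" "\<And>g u. test_pair g u \<Longrightarrow> (\<And>y. y \<notin> ?\<Omega> \<Longrightarrow> u y = 0) \<Longrightarrow> p_integral u UNIV < \<infinity> \<Longrightarrow>
      p_integral (\<lambda>y. u y / infdist y (- ?\<Omega>)) ?\<Omega> \<le> ennreal C * energy g UNIV"
    by blast
  \<comment> \<open>For \<open>c \<le> 1/4\<close> the doubled Whitney balls have radius at most half the distance of their centres to the boundary.\<close>
  show ?thesis
  proof (intro exI[of _ "1 / 4"] conjI allI impI)
    fix c I z assume "0 < c \<and> c \<le> 1 / 4 \<and> whitney_cover c ?\<Omega> I z"
    then show "quasiadditive M p ?\<Omega> I (whitney_ball c ?\<Omega> z)"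
      by (intro quasiadditive_of_hardy[OF C]) auto
  qed auto
qed

end
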